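(* For any $N\ge1$ (with no restriction on the form of $N$), as $N\to\infty$, $$\mathcal{E}_4(\mathrm{Gr}_{2,4},N)\le\frac{N^2\log N}{4}+C_4N^2+o(N^2),$$ where $$C_4=\frac{7\log2}{4}+2\int_0^1\!\!\int_0^1\frac{x^2y^2-16J_1(x)^2J_1(y)^2}{xy(x^2+y^2)^2}\,dx\,dy-32\int_1^\infty\!\!\int_1^\infty\frac{J_1(x)^2J_1(y)^2}{xy(x^2+y^2)^2}\,dx\,dy-64\int_1^\infty\!\!\int_0^1\frac{J_1(x)^2J_1(y)^2}{xy(x^2+y^2)^2}\,dx\,dy$$ and $J_1$ is the Bessel function of the first kind of order $1$.
   Context: $\mathrm{Gr}_{2,4}$ is the Grassmannian of $2$-dimensional linear subspaces of $\mathbb{R}^4$. For $P,Q\in\mathrm{Gr}_{2,4}$ the principal angles $0\le\theta_1\le\theta_2\le\pi/2$ are such that $\cos\theta_1\ge\cos\theta_2$ are the singular values of $A^{T}B$, where $A,B$ are $4\times2$ matrices with orthonormal columns spanning $P$ and $Q$. The chordal distance is $d_c(P,Q)=\sqrt{\sin^2\theta_1+\sin^2\theta_2}$. $\mathcal{E}_4(\mathrm{Gr}_{2,4},N)=\min\sum_{i\ne j}d_c(P_i,P_j)^{-4}$ over all collections $\{P_1,\dots,P_N\}$ of $N$ elements of $\mathrm{Gr}_{2,4}$. *)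

theory Defs
  imports "HOL-Analysis.Analysis" "HOL-Library.Landau_Symbols"
begin

definition Gr24 :: "(real ^ 4) set set" where
  "Gr24 = {P. subspace P \<and> dim P = 2}"

text \<open>Columns of a matrix in \<^typ>\<open>real ^ 2 ^ 4\<close> (4 rows, 2 columns) form an orthonormal basis of P.\<close>

definition orthonormal_frame :: "real ^ 2 ^ 4 \<Rightarrow> (real ^ 4) set \<Rightarrow> bool" where
  "orthonormal_frame A P \<longleftrightarrow> transpose A ** A = mat 1 \<and> span (columns A) = P"

definition diag_mat :: "real ^ 'n \<Rightarrow> real ^ 'n ^ 'n" where
  "diag_mat s = (\<chi> i j. if i = j then s $ i else 0)"

text \<open>The entries of s, with multiplicity and in some order, are the singular values of M:
  they are the diagonal entries in a singular value decomposition of M.\<close>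

definition singular_values :: "real ^ 'n ^ 'n \<Rightarrow> real ^ 'n \<Rightarrow> bool" where
  "singular_values M s \<longleftrightarrow> (\<forall>i. 0 \<le> s $ i) \<and>
     (\<exists>U V. orthogonal_matrix U \<and> orthogonal_matrix V \<and> M = U ** diag_mat s ** transpose V)"

text \<open>The pair of principal angles does not depend on the choice of the frames A and B.\<close>

definition principal_angles :: "(real ^ 4) set \<Rightarrow> (real ^ 4) set \<Rightarrow> real \<times> real" where
  "principal_angles P Q = (THE (\<theta>\<^sub>1, \<theta>\<^sub>2). 0 \<le> \<theta>\<^sub>1 \<and> \<theta>\<^sub>1 \<le> \<theta>\<^sub>2 \<and> \<theta>\<^sub>2 \<le> pi / 2 \<and>
     (\<exists>A B. orthonormal_frame A P \<and> orthonormal_frame B Q \<and>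
        singular_values (transpose A ** B) (vector [cos \<theta>\<^sub>1, cos \<theta>\<^sub>2])))"

definition chordal_dist :: "(real ^ 4) set \<Rightarrow> (real ^ 4) set \<Rightarrow> real" where
  "chordal_dist P Q =
     (let (\<theta>\<^sub>1, \<theta>\<^sub>2) = principal_angles P Q in sqrt ((sin \<theta>\<^sub>1)\<^sup>2 + (sin \<theta>\<^sub>2)\<^sup>2))"

text \<open>The sum runs over ordered pairs. Collections are sets of N distinct planes: a repeated plane
  has infinite energy and so never occurs in a minimizer, whereas \<^term>\<open>0 powr (- s) = (0::real)\<close>
  would make it free. The infimum is attained, since \<^const>\<open>Gr24\<close> is compact.\<close>

definition riesz_energy :: "real \<Rightarrow> (real ^ 4) set set \<Rightarrow> real" where
  "riesz_energy s S = (\<Sum>P\<in>S. \<Sum>Q\<in>S - {P}. chordal_dist P Q powr (- s))"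

definition min_energy :: "real \<Rightarrow> nat \<Rightarrow> real" where
  "min_energy s N = (INF S\<in>{S. S \<subseteq> Gr24 \<and> finite S \<and> card S = N}. riesz_energy s S)"

definition bessel_J :: "nat \<Rightarrow> real \<Rightarrow> real" where
  "bessel_J n x = (\<Sum>m. (- 1) ^ m / (fact m * fact (m + n)) * (x / 2) ^ (2 * m + n))"

definition C\<^sub>4 :: real where
  "C\<^sub>4 = 7 * ln 2 / 4
     + 2 * (LBINT y:{0..1}. LBINT x:{0..1}.
         (x\<^sup>2 * y\<^sup>2 - 16 * (bessel_J 1 x)\<^sup>2 * (bessel_J 1 y)\<^sup>2) / (x * y * (x\<^sup>2 + y\<^sup>2)\<^sup>2))
     - 32 * (LBINT y:{1..}. LBINT x:{1..}.
         (bessel_J 1 x)\<^sup>2 * (bessel_J 1 y)\<^sup>2 / (x * y * (x\<^sup>2 + y\<^sup>2)\<^sup>2))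
     - 64 * (LBINT y:{1..}. LBINT x:{0..1}.
         (bessel_J 1 x)\<^sup>2 * (bessel_J 1 y)\<^sup>2 / (x * y * (x\<^sup>2 + y\<^sup>2)\<^sup>2))"

end

theory Submission
  imports Defs "HOL-Probability.Probability" "HOL-Computational_Algebra.Polynomial"
      "HOL-Real_Asymp.Real_Asymp"
begin

text \<open>Oriented planes of \<open>\<real>\<^sup>4\<close> are pairs \<open>(u, v)\<close> of points of the unit 2-sphere, with \<open>(u, v)\<close> and
  \<open>(- u, - v)\<close> giving the same plane, and then \<open>d\<^sub>c\<^sup>2 = 1 - (u \<bullet> u') * (v \<bullet> v')\<close>. The points are taken from
  the determinantal process of the space spanned by the products of spherical harmonics of degrees below
  \<open>n\<close> that are even under \<open>(u, v) \<mapsto> (- u, - v)\<close>; its dimension is \<open>N = (n\<^sup>4 + n\<^sup>2) / 2\<close>. Its mean energy is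
  \<open>N\<^sup>2\<close> times the mean over \<open>s, t \<in> [-1, 1]\<close> of \<open>(1 - \<kappa>(s, t)\<^sup>2) / (1 - s t)\<^sup>2\<close>, where \<open>\<kappa>\<close> is the normalised
  reproducing kernel. With \<open>s = 1 - x\<^sup>2 / (2 n\<^sup>2)\<close> and \<open>t = 1 - y\<^sup>2 / (2 n\<^sup>2)\<close>, \<open>\<kappa>\<close> tends to
  \<open>4 J\<^sub>1(x) J\<^sub>1(y) / (x y)\<close>. Near \<open>s = t = 1\<close> (\<open>x, y < 1\<close>), dominated convergence applies; elsewhere
  \<open>(1 - s t)\<^sup>-\<^sup>2\<close> is integrated in closed form, which gives the logarithm, and Fatou's lemma bounds the
  \<open>\<kappa>\<^sup>2\<close> part from below, which is the direction needed. A general number of points is reached by thinning a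
  slightly larger configuration.\<close>

section \<open>Integration over the 2-sphere\<close>

text \<open>The mean of (1 - \<kappa>^2) / (1 - s t)^2 is finite only because the numerator is of
  order x^2 + y^2 near the diagonal; without that repulsion the integral diverges logarithmically.
  The potential (1 - s t)^-2 itself is unbounded, so the probabilistic step uses a cut-off at
  \<epsilon>. The estimate of the mean does not involve \<epsilon>, which is then taken so small
  that one coinciding pair would cost more than the whole mean. No point process is constructed:
  averaging over one point at a time is enough. The plain product kernel would not make (u, v) and
  (- u, - v) repel each other although they are the same plane, hence the symmetrised kernel. The
  antipodal term that this adds is of size n^2 against n^4 near the diagonal: it shows in the
  dimension and disappears from the limit. The integrals in \<open>C\<^sub>4\<close> are cut at 1
  because the corner around s = t = 1 is chosen as x, y < 1. The domain x, y \<ge> 0 outside the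
  unit square then splits into one quadrant and two mirror-image strips.\<close>

definition reflection :: "'a::real_inner \<Rightarrow> 'a \<Rightarrow> 'a" where
  "reflection a x = x - (2 * (x \<bullet> a) / (a \<bullet> a)) *\<^sub>R a"

lemma orthogonal_transformation_reflection: "orthogonal_transformation (reflection a)"
  unfolding orthogonal_transformation_def
proof
  show "linear (reflection a)"
    by (rule linearI) (simp_all add: reflection_def inner_simps algebra_simps add_divide_distrib)
  show "\<forall>v w. reflection a v \<bullet> reflection a w = v \<bullet> w"
    \<comment> \<open>Division by zero makes \<open>reflection 0\<close> the identity, which is
      orthogonal too.\<close>
    by (cases "a = 0") (auto simp: reflection_def inner_simps field_simps inner_commute)
qed

lemma reflection_inner: "reflection a x \<bullet> y = x \<bullet> reflection a y"
  by (simp add: reflection_def inner_simps inner_commute algebra_simps)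

text \<open>For vectors of equal length, \<open>x - y\<close> is normal to the mirror between them.
  These reflections are the only orthogonal maps to which the invariance of the sphere measure is
  applied below.\<close>

lemma reflection_swap:
  assumes "norm x = norm y" shows "reflection (x - y) x = y"
proof (cases "x = y")
  case False
  have "(x - y) \<bullet> (x - y) = 2 * (x \<bullet> (x - y))"
    using assms by (simp add: inner_simps inner_commute norm_eq)
  moreover have "(x - y) \<bullet> (x - y) \<noteq> 0" using False by simp
  ultimately have "2 * (x \<bullet> (x - y)) / ((x - y) \<bullet> (x - y)) = 1" by (metis divide_self)
  then show ?thesis unfolding reflection_def by (simp only:) simp
qed (simp add: reflection_def)

lemma reflection_minus_commute: "reflection (x - y) = reflection (y - x)"
proof -
  have "x - y = - (y - x)" by simp
  then show ?thesis unfolding reflection_def fun_eq_iff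
      by (simp only: inner_minus_right inner_minus_left) (simp flip: scaleR_minus_right)
qed

lemma reflection_fixes: "x \<bullet> a = 0 \<Longrightarrow> reflection a x = x"
  by (simp add: reflection_def)

section \<open>The uniform measure on the sphere and its rotation invariance\<close>

lemma lborel_distr_orthogonal:
  fixes T :: "real^'n::{finite,wellorder} \<Rightarrow> real^'n::_"
  assumes T: "orthogonal_transformation T"
  shows "distr lborel borel T = lborel"
proof (rule sym, rule lborel_eqI)
  have meas [measurable]: "T \<in> borel_measurable borel"
    using T by (intro borel_measurable_continuous_onI linear_continuous_on)
       (auto simp: orthogonal_transformation_linear linear_linear)
  show "emeasure (distr lborel borel T) (box l u) = ennreal (\<Prod>b\<in>Basis. (u - l) \<bullet> b)"
    if "\<And>b. b \<in> Basis \<Longrightarrow> l \<bullet> b \<le> u \<bullet> b" for l u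
  proof -
    have eq: "T -` box l u = inv T ` box l u"
      using orthogonal_transformation_bij[OF T] by (simp add: bij_vimage_eq_inv_image)
    have box: "box l u \<in> lmeasurable" by simp
    have "emeasure (distr lborel borel T) (box l u) = emeasure lborel (T -` box l u)"
      by (subst emeasure_distr) auto
    also have "\<dots> = emeasure lebesgue (inv T ` box l u)"
      unfolding eq[symmetric] using measurable_sets[OF meas, of "box l u"] by simp
    also have "\<dots> = ennreal (measure lebesgue (inv T ` box l u))"
      using measurable_orthogonal_image[OF orthogonal_transformation_inv[OF T] box]
      by (intro emeasure_eq_measure2) auto
    also have "\<dots> = ennreal (measure lebesgue (box l u))"
      by (simp add: measure_orthogonal_image[OF orthogonal_transformation_inv[OF T] box])
    also have "\<dots> = ennreal (\<Prod>b\<in>Basis. (u - l) \<bullet> b)"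
      using that by (simp add: measure_lborel_box_eq)
    finally show ?thesis .
  qed
qed simp

text \<open>The uniform measure on the sphere as the radial projection of the uniform measure on the
  ball, so that rotation invariance is inherited from Lebesgue measure. The value at the origin only
  keeps the map inside the sphere; it concerns a null set.\<close>

definition sphere_measure :: "(real^3) measure" where
  "sphere_measure = distr (uniform_measure lborel (ball 0 1)) (restrict_space borel (sphere 0 1))
     (\<lambda>x. if x = 0 then axis 1 1 else x /\<^sub>R norm x)"

lemma space_sphere_measure [simp]: "space sphere_measure = sphere 0 1"
  by (simp add: sphere_measure_def space_restrict_space)

lemma sets_sphere_measure [measurable_cong]: "sets sphere_measure
    = sets (restrict_space borel (sphere 0 1))"
  by (simp add: sphere_measure_def)

lemma radial_measurable [measurable]:
  "(\<lambda>x::real^3. if x = 0 then axis 1 1 else x /\<^sub>R norm x)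
      \<in> measurable borel (restrict_space borel (sphere 0 1))"
  by (rule measurable_restrict_space2) (auto simp: dist_norm)

lemma emeasure_unit_ball: "emeasure lborel (ball 0 1 :: (real^3) set) \<noteq> 0" "emeasure lborel (ball 0
    1 :: (real^3) set) \<noteq> \<infinity>"
proof -
  show "emeasure lborel (ball 0 1 :: (real^3) set) \<noteq> 0"
    using open_not_negligible[of "ball 0 1 :: (real^3) set"] by (auto simp: negligible_iff_emeasure0)
  show "emeasure lborel (ball 0 1 :: (real^3) set) \<noteq> \<infinity>"
    using emeasure_bounded_finite[OF bounded_ball] by (simp add: less_top)
qed

interpretation sphere: prob_space sphere_measure
proof -
  interpret U: prob_space "uniform_measure lborel (ball 0 1 :: (real^3) set)"
    by (rule prob_space_uniform_measure[OF emeasure_unit_ball])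
  show "prob_space sphere_measure"
    unfolding sphere_measure_def by (rule U.prob_space_distr) measurable
qed

lemma measure_sphere [simp]: "measure sphere_measure (sphere 0 1) = 1"
  using sphere.prob_space by simp

lemma sphere_measurable:
  fixes f :: "real^3 \<Rightarrow> 'b::topological_space"
  assumes "continuous_on UNIV f" shows "f \<in> borel_measurable sphere_measure"
proof -
  have [measurable]: "f \<in> borel_measurable borel" by (rule borel_measurable_continuous_onI[OF assms])
  have "f \<in> borel_measurable (restrict_space borel (sphere 0 1))" by (intro measurable_restrict_space1) simp
  then show ?thesis by (simp cong: measurable_cong_sets add: sets_sphere_measure)
qed

lemma sphere_integrable:
  fixes f :: "real^3 \<Rightarrow> real"
  assumes "continuous_on UNIV f" shows "integrable sphere_measure f"
proof -
  have "compact (f ` sphere 0 1)"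
    by (intro compact_continuous_image continuous_on_subset[OF assms]) auto
  then obtain B where "\<forall>x\<in>sphere 0 1. norm (f x) \<le> B"
    by (auto dest!: compact_imp_bounded simp: bounded_iff)
  then show ?thesis by (intro sphere.integrable_const_bound[of _ B] sphere_measurable[OF assms]) auto
qed

text \<open>\<open>T\<close> preserves the uniform measure on the ball, and off the origin it
  commutes with the radial projection because it is linear and keeps norms.\<close>

lemma sphere_integral_orthogonal:
  fixes f :: "real^3 \<Rightarrow> real"
  assumes T: "orthogonal_transformation T" and f: "continuous_on UNIV f"
  shows "(\<integral>w. f (T w) \<partial>sphere_measure) = (\<integral>w. f w \<partial>sphere_measure)"
proof -
  let ?h = "\<lambda>x::real^3. if x = 0 then axis 1 1 else x /\<^sub>R norm x"
  let ?U = "uniform_measure lborel (ball 0 1 :: (real^3) set)"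
  have lin: "linear T" using T by (rule orthogonal_transformation_linear)
  have contT: "continuous_on UNIV T" using lin by (intro linear_continuous_on) (simp add: linear_linear)
  have [measurable]: "T \<in> borel_measurable borel" by (rule borel_measurable_continuous_onI[OF contT])
  have [measurable]: "f \<in> borel_measurable borel" by (rule borel_measurable_continuous_onI[OF f])
  have fT: "continuous_on UNIV (\<lambda>x. f (T x))" using continuous_on_compose2[OF f contT] by auto
  have distr: "distr ?U borel T = ?U"
  proof (rule measure_eqI)
    fix A assume "A \<in> sets (distr ?U borel T)"
    then have [measurable]: "A \<in> sets borel" by simp
    have "ball 0 1 \<inter> T -` A = T -` (ball 0 1 \<inter> A)" by (auto simp: orthogonal_transformation_norm[OF T])
    then have "emeasure lborel (ball 0 1 \<inter> T -` A) = emeasure (distr lborel borel T) (ball 0 1 \<inter> A)"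
      by (subst emeasure_distr) auto
    then show "emeasure (distr ?U borel T) A = emeasure ?U A"
      unfolding lborel_distr_orthogonal[OF T]
      using measurable_sets[of T borel borel A] by (subst emeasure_distr) (auto simp:
          emeasure_uniform_measure)
  qed simp
  have h_comm: "?h (T x) = T (?h x)" if "x \<noteq> 0" for x
  proof -
    have "T x \<noteq> 0" using that orthogonal_transformation_norm[OF T, of x] by auto
    then show ?thesis using that by (simp add: linear_scale[OF lin] orthogonal_transformation_norm[OF T])
  qed
  have "(\<integral>w. f (T w) \<partial>sphere_measure) = (\<integral>x. f (T (?h x)) \<partial>?U)"
    unfolding sphere_measure_def using sphere_measurable[OF fT]
    by (intro integral_distr) (auto cong: measurable_cong_sets simp: sets_sphere_measure)
  also have "\<dots> = (\<integral>x. f (?h (T x)) \<partial>?U)"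
  proof (rule integral_cong_AE)
    have "AE x in lborel. x \<noteq> (0 :: real^3)" by (rule AE_lborel_singleton)
    then have "AE x in ?U. x \<noteq> 0"
      by (intro AE_uniform_measureI) auto
    then show "AE x in ?U. f (T (?h x)) = f (?h (T x))"
      by eventually_elim (use h_comm in force)
  qed measurable
  also have "\<dots> = (\<integral>x. f (?h x) \<partial>(distr ?U borel T))"
    by (intro integral_distr[symmetric]) measurable
  also have "\<dots> = (\<integral>w. f w \<partial>sphere_measure)"
    unfolding distr unfolding sphere_measure_def using sphere_measurable[OF f]
    by (intro integral_distr[symmetric]) (auto cong: measurable_cong_sets simp: sets_sphere_measure)
  finally show ?thesis .
qed

text \<open>The reflection along \<open>z - y\<close> exchanges \<open>y\<close> and
  \<open>z\<close>, and it fixes \<open>v\<close> because \<open>v\<close> is orthogonal to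
  \<open>z - y\<close>.\<close>

lemma sphere_integral_swap:
  fixes F :: "real \<Rightarrow> real \<Rightarrow> real"
  assumes F: "continuous_on UNIV (\<lambda>(x, y). F x y)" and "norm y = norm z" "v \<bullet> y = 0" "v \<bullet> z = 0"
  shows "(\<integral>w. F (w \<bullet> v) (w \<bullet> y) \<partial>sphere_measure) = (\<integral>w. F (w \<bullet> v) (w \<bullet> z) \<partial>sphere_measure)"
proof -
  define T where "T = reflection (z - y)"
  have T: "orthogonal_transformation T" unfolding T_def by (rule orthogonal_transformation_reflection)
  have "continuous_on UNIV (\<lambda>w::real^3. (\<lambda>(x, y). F x y) (w \<bullet> v, w \<bullet> y))"
    by (rule continuous_on_compose2[OF F]) (auto intro!: continuous_intros)
  then have c: "continuous_on UNIV (\<lambda>w. F (w \<bullet> v) (w \<bullet> y))" by simp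
  have "(\<integral>w. F (w \<bullet> v) (w \<bullet> y) \<partial>sphere_measure) = (\<integral>w. F (T w \<bullet> v) (T w \<bullet> y) \<partial>sphere_measure)"
    by (rule sphere_integral_orthogonal[OF T c, symmetric])
  moreover have "reflection (z - y) y = z"
    using reflection_swap[of y z] assms(2) by (simp add: reflection_minus_commute[of z y])
  then have "T w \<bullet> v = w \<bullet> v" "T w \<bullet> y = w \<bullet> z" for w
    unfolding T_def reflection_inner using assms by (auto simp: reflection_fixes inner_diff_right)
  ultimately show ?thesis by simp
qed

lemma sphere_orthonormal_parseval:
  fixes w :: "real^3"
  assumes "norm v = 1" "norm e = 1" "norm f = 1" "v \<bullet> e = 0" "v \<bullet> f = 0" "e \<bullet> f = 0"
  shows "(w \<bullet> v)\<^sup>2 + (w \<bullet> e)\<^sup>2 + (w \<bullet> f)\<^sup>2 = (norm w)\<^sup>2"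
proof -
  have "pairwise orthogonal {v, e, f}"
    using assms by (auto simp: pairwise_def orthogonal_def inner_commute)
  moreover have "v \<noteq> e" "v \<noteq> f" "e \<noteq> f" using assms by (auto simp: dot_square_norm)
  ultimately have "(norm w)\<^sup>2 = (\<Sum>b\<in>{v, e, f}. (w \<bullet> b)\<^sup>2)"
  proof -
    have ind: "independent {v, e, f}"
      using assms by (intro pairwise_orthogonal_independent \<open>pairwise orthogonal {v, e, f}\<close>) auto
    have "card {v, e, f} = 3" using \<open>v \<noteq> e\<close> \<open>v \<noteq> f\<close> \<open>e \<noteq> f\<close> by simp
    then have "UNIV \<subseteq> span {v, e, f}"
      by (intro card_ge_dim_independent ind) auto
    then have "w \<in> span {v, e, f}" by auto
    then obtain a b c where "w - a *\<^sub>R v - b *\<^sub>R e - c *\<^sub>R f = 0"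
      unfolding span_insert by auto
    then have w: "w = a *\<^sub>R v + b *\<^sub>R e + c *\<^sub>R f" by (simp add: algebra_simps)
    have "v \<bullet> v = 1" "e \<bullet> e = 1" "f \<bullet> f = 1" using assms by (simp_all add: dot_square_norm)
    then have "w \<bullet> v = a" "w \<bullet> e = b" "w \<bullet> f = c" "w \<bullet> w = a\<^sup>2 + b\<^sup>2 + c\<^sup>2"
      using assms by (simp_all add: w inner_simps inner_commute power2_eq_square)
    then show ?thesis using \<open>v \<noteq> e\<close> \<open>v \<noteq> f\<close> \<open>e \<noteq> f\<close> by (simp add: power2_norm_eq_inner)
  qed
  then show ?thesis using \<open>v \<noteq> e\<close> \<open>v \<noteq> f\<close> \<open>e \<noteq> f\<close> by simp
qed

text \<open>Both sides are the coefficient of \<open>t\<^sup>2\<close> in the mean of \<open>G (w \<bullet> v) (w \<bullet> (e + t f))\<^sup>2\<^sup>j\<close>,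
  which equals \<open>(1 + t\<^sup>2)\<^sup>j\<close> times its value at \<open>t = 0\<close> by rotation invariance.\<close>

lemma sphere_integral_shift:
  fixes G :: "real \<Rightarrow> real"
  assumes G: "continuous_on UNIV G" and ef: "norm e = 1" "norm f = 1" "e \<bullet> f = 0" "v \<bullet> e = 0" "v \<bullet> f = 0"
  shows "(2 * real j + 1) * (\<integral>w. G (w \<bullet> v) * (w \<bullet> e) ^ (2 * j) * (w \<bullet> f)\<^sup>2 \<partial>sphere_measure)
     = (\<integral>w. G (w \<bullet> v) * (w \<bullet> e) ^ (2 * j + 2) \<partial>sphere_measure)"
proof -
  \<comment> \<open>With \<open>J\<close> at least 1 the power \<open>2 * J\<close> is at least 2,
    so the coefficient of \<open>t\<^sup>2\<close> is among those compared.\<close>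
  define J where "J = Suc j"
  have cG: "continuous_on UNIV (\<lambda>w::real^3. G (w \<bullet> v))"
    by (rule continuous_on_compose2[OF G]) (auto intro!: continuous_intros)
  define D where "D = (\<integral>w. G (w \<bullet> v) * (w \<bullet> e) ^ (2 * J) \<partial>sphere_measure)"
  define A where "A l = real ((2 * J) choose l) * (\<integral>w. G (w \<bullet> v) * ((w \<bullet> f) ^ l * (w \<bullet> e) ^ (2 * J
      - l)) \<partial>sphere_measure)" for l
  define B where "B l = (if even l then real (J choose (l div 2)) * D else 0)" for l
  have "(\<Sum>l\<le>2*J. A l * t ^ l) = (\<Sum>l\<le>2*J. B l * t ^ l)" for t
  proof -
    have int: "integrable sphere_measure (\<lambda>w. G (w \<bullet> v) * ((w \<bullet> f) ^ l * (w \<bullet> e) ^ (2 * J - l)))" for l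
      by (intro sphere_integrable continuous_intros cG)
    have "(\<Sum>l\<le>2*J. A l * t ^ l) = (\<Sum>l\<le>2*J. (\<integral>w. real ((2 * J) choose l) * t ^ l * (G (w \<bullet> v)
        * ((w \<bullet> f) ^ l * (w \<bullet> e) ^ (2 * J - l))) \<partial>sphere_measure))"
      by (intro sum.cong refl) (unfold A_def integral_mult_right_zero, simp)
    also have "\<dots> = (\<integral>w. (\<Sum>l\<le>2*J. real ((2 * J) choose l) * t ^ l * (G (w \<bullet> v) * ((w \<bullet> f) ^ l
        * (w \<bullet> e) ^ (2 * J - l)))) \<partial>sphere_measure)"
      using int by (intro Bochner_Integration.integral_sum[symmetric]) auto
    also have "\<dots> = (\<integral>w. G (w \<bullet> v) * (w \<bullet> (e + t *\<^sub>R f)) ^ (2 * J) \<partial>sphere_measure)"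
    proof (rule Bochner_Integration.integral_cong[OF refl])
      fix w
      have "w \<bullet> (e + t *\<^sub>R f) = t * (w \<bullet> f) + w \<bullet> e" by (simp add: inner_simps)
      then show "(\<Sum>l\<le>2*J. real ((2 * J) choose l) * t ^ l * (G (w \<bullet> v) * ((w \<bullet> f) ^ l * (w \<bullet> e) ^ (2
          * J - l)))) = G (w \<bullet> v) * (w \<bullet> (e + t *\<^sub>R f)) ^ (2 * J)"
        by (simp only: binomial_ring sum_distrib_left power_mult_distrib) (simp add: algebra_simps)
    qed
    also have "\<dots> = (\<integral>w. G (w \<bullet> v) * (w \<bullet> (sqrt (1 + t\<^sup>2) *\<^sub>R e)) ^ (2 * J) \<partial>sphere_measure)"
    proof (rule sphere_integral_swap[where F = "\<lambda>x y. G x * y ^ (2 * J)"])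
      show "continuous_on UNIV (\<lambda>(x, y). G x * y ^ (2 * J))"
        unfolding case_prod_beta by (intro continuous_intros continuous_on_compose2[OF G]) auto
      have "e \<bullet> e = 1" "f \<bullet> f = 1" using ef by (simp_all add: dot_square_norm)
      then have "(e + t *\<^sub>R f) \<bullet> (e + t *\<^sub>R f) = 1 + t\<^sup>2"
        using ef by (simp add: inner_simps inner_commute power2_eq_square)
      then show "norm (e + t *\<^sub>R f) = norm (sqrt (1 + t\<^sup>2) *\<^sub>R e)"
        using ef by (simp add: norm_eq_sqrt_inner)
    qed (use ef in \<open>auto simp: inner_simps\<close>)
    also have "\<dots> = (\<integral>w. (1 + t\<^sup>2) ^ J * (G (w \<bullet> v) * (w \<bullet> e) ^ (2 * J)) \<partial>sphere_measure)"
    proof (rule Bochner_Integration.integral_cong[OF refl])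
      have "sqrt (1 + t\<^sup>2) ^ (2 * J) = (1 + t\<^sup>2) ^ J" by (simp add: power_mult)
      then show "G (w \<bullet> v) * (w \<bullet> (sqrt (1 + t\<^sup>2) *\<^sub>R e)) ^ (2 * J) = (1 + t\<^sup>2) ^ J * (G (w \<bullet> v)
          * (w \<bullet> e) ^ (2 * J))" for w
        by (simp only: inner_scaleR_right power_mult_distrib mult_ac)
    qed
    also have "\<dots> = (t\<^sup>2 + 1) ^ J * D" by (simp add: D_def add.commute)
    also have "\<dots> = (\<Sum>k\<le>J. real (J choose k) * t ^ (2 * k) * D)"
      by (simp add: binomial_ring sum_distrib_right power_mult)
    also have "\<dots> = (\<Sum>l\<in>(\<lambda>k. 2 * k) ` {..J}. B l * t ^ l)"
      by (subst sum.reindex) (auto simp: inj_on_def B_def algebra_simps)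
    also have "\<dots> = (\<Sum>l\<le>2*J. B l * t ^ l)"
      by (rule sum.mono_neutral_left) (auto simp: B_def elim!: evenE)
    finally show ?thesis .
  qed
  then have "A 2 = B 2" using polyfun_eq_coeffs[of A "2 * J" B] by (auto simp: J_def)
  moreover have "real ((2 * J) choose 2) = real J * (2 * real J - 1)"
    by (simp add: J_def binomial_gbinomial gbinomial_prod_rev numeral_2_eq_2 field_simps)
  ultimately have "real J * ((2 * real J - 1) * (\<integral>w. G (w \<bullet> v) * ((w \<bullet> f) ^ 2 * (w \<bullet> e) ^ (2 * J
      - 2)) \<partial>sphere_measure)) = real J * D"
    by (simp add: A_def B_def mult.assoc)
  then have "(2 * real J - 1) * (\<integral>w. G (w \<bullet> v) * ((w \<bullet> f) ^ 2 * (w \<bullet> e) ^ (2 * J - 2)) \<partial>sphere_measure) = D"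
    by (simp add: J_def)
  then show ?thesis by (simp add: D_def J_def algebra_simps)
qed

text \<open>On the sphere \<open>1 - (w \<bullet> v)\<^sup>2\<close> is the sum of the squares of
  the \<open>e\<close> and \<open>f\<close> coordinates. By \<open>sphere_integral_shift\<close> the
  \<open>f\<close> term is 1 / (2 j + 1) times the \<open>e\<close> term, which leaves the factor (2
  j + 2) / (2 j + 1).\<close>

lemma sphere_integral_even_power_step:
  fixes G :: "real \<Rightarrow> real"
  assumes G: "continuous_on UNIV G" and vef: "norm v = 1" "norm e = 1" "norm f = 1" "v \<bullet> e
      = 0" "v \<bullet> f = 0" "e \<bullet> f = 0"
  shows "(2 * real j + 2) * (\<integral>w. G (w \<bullet> v) * (w \<bullet> e) ^ (2 * j + 2) \<partial>sphere_measure)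
     = (2 * real j + 1) * (\<integral>w. G (w \<bullet> v) * (1 - (w \<bullet> v)\<^sup>2) * (w \<bullet> e) ^ (2 * j) \<partial>sphere_measure)"
proof -
  have cG: "continuous_on UNIV (\<lambda>w::real^3. G (w \<bullet> v))"
    by (rule continuous_on_compose2[OF G]) (auto intro!: continuous_intros)
  let ?A = "\<lambda>w. G (w \<bullet> v) * (w \<bullet> e) ^ (2 * j + 2)"
  let ?B = "\<lambda>w. G (w \<bullet> v) * (w \<bullet> e) ^ (2 * j) * (w \<bullet> f)\<^sup>2"
  have "(\<integral>w. G (w \<bullet> v) * (1 - (w \<bullet> v)\<^sup>2) * (w \<bullet> e) ^ (2 * j) \<partial>sphere_measure)
      = (\<integral>w. ?A w + ?B w \<partial>sphere_measure)"
  proof (rule Bochner_Integration.integral_cong[OF refl])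
    fix w assume "w \<in> space sphere_measure"
    then have "norm w = 1" by simp
    then have eq: "1 - (w \<bullet> v)\<^sup>2 = (w \<bullet> e)\<^sup>2 + (w \<bullet> f)\<^sup>2"
      using sphere_orthonormal_parseval[OF vef, of w] by simp
    show "G (w \<bullet> v) * (1 - (w \<bullet> v)\<^sup>2) * (w \<bullet> e) ^ (2 * j) = ?A w + ?B w"
      unfolding eq by (simp add: algebra_simps power2_eq_square)
  qed
  also have "\<dots> = (\<integral>w. ?A w \<partial>sphere_measure) + (\<integral>w. ?B w \<partial>sphere_measure)"
    by (intro Bochner_Integration.integral_add sphere_integrable continuous_intros cG)
  finally show ?thesis
    using sphere_integral_shift[OF G vef(2,3,6,4,5), of j] by (simp add: algebra_simps)
qed

lemma orthonormal_completion:
  fixes v e :: "real^3"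
  assumes "norm v = 1" "norm e = 1" "v \<bullet> e = 0"
  obtains f where "norm f = 1" "v \<bullet> f = 0" "e \<bullet> f = 0"
proof
  have "(norm (cross3 v e))\<^sup>2 = 1" using norm_cross_dot[of v e] assms by simp
  then show "norm (cross3 v e) = 1" by (metis norm_ge_zero one_power2 power2_eq_iff_nonneg zero_le_one)
qed (simp_all add: dot_cross_self)

lemma sphere_integral_odd_power:
  fixes G :: "real \<Rightarrow> real"
  assumes G: "continuous_on UNIV G" and "v \<bullet> e = 0" "odd i"
  shows "(\<integral>w. G (w \<bullet> v) * (w \<bullet> e) ^ i \<partial>sphere_measure) = 0"
proof -
  have "(\<integral>w. G (w \<bullet> v) * (w \<bullet> e) ^ i \<partial>sphere_measure) = (\<integral>w. G (w \<bullet> v) * (w \<bullet> (- e)) ^ i \<partial>sphere_measure)"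
  proof (rule sphere_integral_swap[where F = "\<lambda>x y. G x * y ^ i"])
    show "continuous_on UNIV (\<lambda>(x, y). G x * y ^ i)"
      unfolding case_prod_beta by (intro continuous_intros continuous_on_compose2[OF G]) auto
  qed (use assms in auto)
  also have "\<dots> = - (\<integral>w. G (w \<bullet> v) * (w \<bullet> e) ^ i \<partial>sphere_measure)"
    using \<open>odd i\<close> by simp
  finally show ?thesis by simp
qed

lemma sphere_integral_even_power:
  fixes v e :: "real^3"
  assumes "norm v = 1" "norm e = 1" "v \<bullet> e = 0"
  shows "\<exists>C. \<forall>G. continuous_on UNIV G \<longrightarrow> (\<integral>w. G (w \<bullet> v) * (w \<bullet> e) ^ (2 * j) \<partial>sphere_measure)
     = C * (\<integral>w. G (w \<bullet> v) * (1 - (w \<bullet> v)\<^sup>2) ^ j \<partial>sphere_measure)"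
proof (induction j)
  case 0
  show ?case by (rule exI[of _ 1]) simp
next
  case (Suc j)
  then obtain C where C: "\<And>G. continuous_on UNIV G \<Longrightarrow> (\<integral>w. G (w \<bullet> v) * (w \<bullet> e) ^ (2 * j) \<partial>sphere_measure)
     = C * (\<integral>w. G (w \<bullet> v) * (1 - (w \<bullet> v)\<^sup>2) ^ j \<partial>sphere_measure)" by blast
  obtain f where f: "norm f = 1" "v \<bullet> f = 0" "e \<bullet> f = 0" using orthonormal_completion assms by blast
  show ?case
  proof (intro exI allI impI)
    fix G :: "real \<Rightarrow> real" assume G: "continuous_on UNIV G"
    have "(\<integral>w. G (w \<bullet> v) * (w \<bullet> e) ^ (2 * Suc j) \<partial>sphere_measure)
      = (2 * real j + 1) / (2 * real j + 2) * (\<integral>w. G (w \<bullet> v) * (1 - (w \<bullet> v)\<^sup>2) * (w \<bullet> e) ^ (2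
          * j) \<partial>sphere_measure)"
      using sphere_integral_even_power_step[OF G assms(1,2) f(1) assms(3) f(2,3), of j]
          by (simp add: field_simps)
    also have "\<dots> = (2 * real j + 1) / (2 * real j + 2) * (C * (\<integral>w. (G (w \<bullet> v) * (1 - (w \<bullet> v)\<^sup>2))
        * (1 - (w \<bullet> v)\<^sup>2) ^ j \<partial>sphere_measure))"
      by (subst C[of "\<lambda>x. G x * (1 - x\<^sup>2)"]) (auto intro!: continuous_intros G)
    finally show "(\<integral>w. G (w \<bullet> v) * (w \<bullet> e) ^ (2 * Suc j) \<partial>sphere_measure)
      = ((2 * real j + 1) / (2 * real j + 2) * C) * (\<integral>w. G (w \<bullet> v) * (1
          - (w \<bullet> v)\<^sup>2) ^ Suc j \<partial>sphere_measure)"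
      by (simp add: mult.assoc)
  qed
qed

lemma orthogonal_unit_exists:
  fixes v :: "real^3"
  obtains e where "norm e = 1" "v \<bullet> e = 0"
proof -
  obtain y :: "real^3" where "y \<noteq> 0" "orthogonal v y"
    using orthogonal_to_vector_exists[of v] by (auto simp: orthogonal_commute)
  then show ?thesis using that[of "y /\<^sub>R norm y"] by (simp add: orthogonal_def)
qed

text \<open>The mixed moment of \<open>(w \<bullet> v) ^ (2 * j)\<close> and
  \<open>(w \<bullet> e)\<^sup>2\<close> is evaluated twice, with \<open>v\<close> as the axis and
  with the roles of \<open>v\<close> and \<open>e\<close> exchanged. Eliminating it gives the
  recursion m(j + 1) = m(j) (2 j + 1) / (2 j + 3) for the even moments.\<close>

lemma sphere_moment:
  fixes v :: "real^3"
  assumes v: "norm v = 1"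
  shows "(\<integral>w. (w \<bullet> v) ^ i \<partial>sphere_measure) = (if even i then 1 / (real i + 1) else 0)"
proof (cases "even i")
  case False
  then show ?thesis using sphere_integral_odd_power[of "\<lambda>_. 1" 0 v i] by simp
next
  case True
  have "(\<integral>w. (w \<bullet> v) ^ (2 * j) \<partial>sphere_measure) = 1 / (2 * real j + 1)" for j
  proof (induction j)
    case (Suc j)
    obtain e where e: "norm e = 1" "v \<bullet> e = 0" using orthogonal_unit_exists by blast
    obtain f where f: "norm f = 1" "v \<bullet> f = 0" "e \<bullet> f = 0" using orthonormal_completion v e by blast
    have "2 * (\<integral>w. (w \<bullet> v) ^ (2 * j) * (w \<bullet> e)\<^sup>2 \<partial>sphere_measure)
        = (\<integral>w. (w \<bullet> v) ^ (2 * j) * (1 - (w \<bullet> v)\<^sup>2) \<partial>sphere_measure)"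
      using sphere_integral_even_power_step[of "\<lambda>x. x ^ (2 * j)" v e f 0] e f v
          by (simp add: continuous_intros power2_eq_square)
    also have "\<dots> = (\<integral>w. (w \<bullet> v) ^ (2 * j) - (w \<bullet> v) ^ (2 * Suc j) \<partial>sphere_measure)"
      by (simp add: algebra_simps power2_eq_square)
    also have "\<dots> = (\<integral>w. (w \<bullet> v) ^ (2 * j) \<partial>sphere_measure) - (\<integral>w. (w \<bullet> v) ^ (2 * Suc j) \<partial>sphere_measure)"
      by (intro Bochner_Integration.integral_diff sphere_integrable continuous_intros)
    finally have 1: "2 * (\<integral>w. (w \<bullet> v) ^ (2 * j) * (w \<bullet> e)\<^sup>2 \<partial>sphere_measure) = 1 / (2 * real j + 1)
        - (\<integral>w. (w \<bullet> v) ^ (2 * Suc j) \<partial>sphere_measure)"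
      using Suc by simp
    have 2: "(2 * real j + 1) * (\<integral>w. (w \<bullet> v) ^ (2 * j) * (w \<bullet> e)\<^sup>2 \<partial>sphere_measure)
        = (\<integral>w. (w \<bullet> v) ^ (2 * Suc j) \<partial>sphere_measure)"
      using sphere_integral_shift[of "\<lambda>_. 1" v e 0 j] v e by (simp add: inner_commute)
    from 1 2 show ?case by (simp add: field_simps)
  qed simp
  then show ?thesis using True by (auto elim!: evenE)
qed

section \<open>The law of the height of a random point of the sphere\<close>

definition interval_measure_pm1 :: "real measure" where
  "interval_measure_pm1 = density lborel (\<lambda>x. ennreal (indicator {-1..1} x / 2))"

lemma integral_interval_measure_pm1:
  assumes [measurable]: "f \<in> borel_measurable borel"
  shows "(\<integral>x. f x \<partial>interval_measure_pm1) = (\<integral>x. f x * indicator {-1..1} x \<partial>lborel) / (2::real)"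
  unfolding interval_measure_pm1_def by (subst integral_density) (auto simp: mult.commute)

interpretation interval: prob_space interval_measure_pm1
proof
  have "emeasure interval_measure_pm1 (space interval_measure_pm1)
      = (\<integral>\<^sup>+x. ennreal (indicator {-1..1::real} x / 2) \<partial>lborel)"
    unfolding interval_measure_pm1_def by (subst emeasure_density) auto
  also have "\<dots> = (\<integral>\<^sup>+x. ennreal (1/2) * indicator {-1..1::real} x \<partial>lborel)"
    by (intro nn_integral_cong) (auto split: split_indicator)
  also have "\<dots> = ennreal (1/2) * ennreal 2" by (subst nn_integral_cmult_indicator) auto
  also have "\<dots> = 1" by (subst ennreal_mult[symmetric]) auto
  finally show "emeasure interval_measure_pm1 (space interval_measure_pm1) = 1" .
qed

lemma interval_AE: "AE x in interval_measure_pm1. x \<in> {-1..1}"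
  unfolding interval_measure_pm1_def by (subst AE_density) (auto split: split_indicator)

lemma sets_interval [simp, measurable_cong]: "sets interval_measure_pm1 = sets borel"
  and space_interval [simp]: "space interval_measure_pm1 = UNIV"
  by (simp_all add: interval_measure_pm1_def)

lemma interval_integrable:
  assumes "continuous_on UNIV (f :: real \<Rightarrow> real)" shows "integrable interval_measure_pm1 f"
proof -
  have "compact (f ` {-1..1})" by (intro compact_continuous_image continuous_on_subset[OF assms]) auto
  then obtain B where "\<forall>x\<in>{-1..1}. norm (f x) \<le> B" by (auto dest!: compact_imp_bounded simp: bounded_iff)
  then show ?thesis using borel_measurable_continuous_onI[OF assms] interval_AE
    by (intro interval.integrable_const_bound[of _ B]) auto
qed

lemma interval_moment: "(\<integral>x. x ^ i \<partial>interval_measure_pm1) = (if even i then 1 / (real i + 1) else 0)"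
proof -
  have "2 / (2 + real i * 2) = 1 / (real i + 1)" by (simp add: field_simps)
  then show ?thesis by (subst integral_interval_measure_pm1) (auto simp: integral_power)
qed

text \<open>Archimedes' hat-box theorem: the height is uniformly distributed. The moments agree, so
  the two means agree on polynomials, and Weierstrass approximation on [-1, 1] extends this to
  continuous functions.\<close>

theorem sphere_integral_height:
  fixes v :: "real^3" and F :: "real \<Rightarrow> real"
  assumes v: "norm v = 1" and F: "continuous_on UNIV F"
  shows "(\<integral>w. F (w \<bullet> v) \<partial>sphere_measure) = (\<integral>x. F x \<partial>interval_measure_pm1)"
proof -
  have cont: "continuous_on UNIV (\<lambda>w::real^3. G (w \<bullet> v))" if "continuous_on UNIV G" for G :: "real \<Rightarrow> real"
    by (rule continuous_on_compose2[OF that]) (auto intro!: continuous_intros)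
  have "\<bar>(\<integral>w. F (w \<bullet> v) \<partial>sphere_measure) - (\<integral>x. F x \<partial>interval_measure_pm1)\<bar> \<le> 2 * \<epsilon>" if \<epsilon>: "\<epsilon> > 0" for \<epsilon>
  proof -
    obtain p where p: "real_polynomial_function p" and close: "\<And>x. x \<in> {-1..1} \<Longrightarrow> \<bar>F x - p x\<bar> < \<epsilon>"
      using Stone_Weierstrass_real_polynomial_function[OF compact_Icc continuous_on_subset[OF F
          subset_UNIV] \<epsilon>] by blast
    obtain a m where pm: "p = (\<lambda>x. \<Sum>i\<le>(m::nat). a i * x ^ i)"
        using p real_polynomial_function_iff_sum by metis
    have cp: "continuous_on UNIV p" unfolding pm by (intro continuous_intros)
    have "(\<integral>w. p (w \<bullet> v) \<partial>sphere_measure) = (\<integral>x. p x \<partial>interval_measure_pm1)"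
    proof -
      have "(\<integral>w. p (w \<bullet> v) \<partial>sphere_measure) = (\<Sum>i\<le>m. (\<integral>w. a i * (w \<bullet> v) ^ i \<partial>sphere_measure))"
        unfolding pm by (intro Bochner_Integration.integral_sum sphere_integrable continuous_intros)
      also have "\<dots> = (\<Sum>i\<le>m. (\<integral>x. a i * x ^ i \<partial>interval_measure_pm1))"
        by (simp add: sphere_moment[OF v] interval_moment)
      also have "\<dots> = (\<integral>x. p x \<partial>interval_measure_pm1)"
        unfolding pm by (intro Bochner_Integration.integral_sum[symmetric] interval_integrable
            continuous_intros)
      finally show ?thesis .
    qed
    moreover have "\<bar>(\<integral>w. F (w \<bullet> v) \<partial>sphere_measure) - (\<integral>w. p (w \<bullet> v) \<partial>sphere_measure)\<bar> \<le> \<epsilon>"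
    proof -
      have "\<bar>\<integral>w. F (w \<bullet> v) - p (w \<bullet> v) \<partial>sphere_measure\<bar> \<le> (\<integral>w. \<bar>F (w \<bullet> v) - p (w \<bullet> v)\<bar> \<partial>sphere_measure)"
        by (rule integral_abs_bound)
      also have "\<dots> \<le> (\<integral>w. \<epsilon> \<partial>sphere_measure)"
      proof (rule integral_mono_AE)
        show "integrable sphere_measure (\<lambda>w. \<bar>F (w \<bullet> v) - p (w \<bullet> v)\<bar>)"
          by (intro sphere_integrable continuous_intros cont F cp)
        show "AE w in sphere_measure. \<bar>F (w \<bullet> v) - p (w \<bullet> v)\<bar> \<le> \<epsilon>"
        proof (rule AE_I2)
          fix w assume "w \<in> space sphere_measure"
          then have "w \<bullet> v \<in> {-1..1}" using Cauchy_Schwarz_ineq2[of w v] v by (simp add: abs_le_iff)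
          then show "\<bar>F (w \<bullet> v) - p (w \<bullet> v)\<bar> \<le> \<epsilon>" using close by force
        qed
      qed simp
      finally show ?thesis
        by (subst (asm) Bochner_Integration.integral_diff) (auto intro!: sphere_integrable cont F cp
            simp: sphere.prob_space)
    qed
    moreover have "\<bar>(\<integral>x. F x \<partial>interval_measure_pm1) - (\<integral>x. p x \<partial>interval_measure_pm1)\<bar> \<le> \<epsilon>"
    proof -
      have "\<bar>\<integral>x. F x - p x \<partial>interval_measure_pm1\<bar> \<le> (\<integral>x. \<bar>F x - p x\<bar> \<partial>interval_measure_pm1)"
        by (rule integral_abs_bound)
      also have "\<dots> \<le> (\<integral>x. \<epsilon> \<partial>interval_measure_pm1)"
      proof (rule integral_mono_AE)
        show "integrable interval_measure_pm1 (\<lambda>x. \<bar>F x - p x\<bar>)"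
          by (intro interval_integrable continuous_intros F cp)
        show "AE x in interval_measure_pm1. \<bar>F x - p x\<bar> \<le> \<epsilon>"
          using interval_AE by eventually_elim (use close in force)
      qed simp
      finally show ?thesis
        using interval.prob_space by (subst (asm) Bochner_Integration.integral_diff) (auto intro!:
            interval_integrable F cp)
    qed
    ultimately show ?thesis by linarith
  qed
  \<comment> \<open>With a quarter of the difference as \<epsilon>, the bound says that the
    difference is at most half of itself.\<close>
  from this[of "\<bar>(\<integral>w. F (w \<bullet> v) \<partial>sphere_measure) - (\<integral>x. F x \<partial>interval_measure_pm1)\<bar> / 4"] show ?thesis
    by (cases "(\<integral>w. F (w \<bullet> v) \<partial>sphere_measure) = (\<integral>x. F x \<partial>interval_measure_pm1)") auto
qed

section \<open>Zonal reproducing kernels\<close>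

text \<open>The sum is, up to sign, the d-th finite difference of \<open>p\<close> at 0: it
  annihilates degrees below \<open>d\<close> and turns the leading term into a factorial. The
  induction writes p = c + x r, absorbs the factor j into the binomial coefficient and shifts
  \<open>r\<close> by one.\<close>

lemma alternating_binomial_poly_sum:
  fixes p :: "real poly"
  assumes "degree p \<le> d"
  shows "(\<Sum>j\<le>d. (- 1) ^ j * real (d choose j) * poly p (real j)) = (- 1) ^ d * fact d * coeff p d"
  using assms
proof (induction d arbitrary: p)
  case 0
  then show ?case by (auto elim: degree_eq_zeroE)
next
  case (Suc d)
  obtain c r where p: "p = pCons c r" by (cases p)
  have deg: "degree r \<le> d" using Suc.prems p by (auto split: if_splits)
  let ?r = "pcompose r [:1, 1:]"
  have co: "coeff ?r d = coeff r d"
  proof (cases "degree r = d")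
    case True
    then have "coeff ?r d = lead_coeff ?r" by (simp add: degree_pcompose)
    also have "\<dots> = lead_coeff r" by (subst lead_coeff_comp) auto
    finally show ?thesis using True by simp
  next
    case False
    then have "degree r < d" "degree ?r < d" using deg by (auto simp: degree_pcompose)
    then show ?thesis by (simp add: coeff_eq_0)
  qed
  have absorb: "real (Suc d choose Suc j) * real (Suc j) = real (Suc d) * real (d choose j)" for j
    using Suc_times_binomial_eq[of d j] by (metis mult.commute of_nat_mult)
  have "(\<Sum>j\<le>Suc d. (- 1) ^ j * real (Suc d choose j) * poly p (real j)) =
     c * (\<Sum>j\<le>Suc d. (- 1) ^ j * real (Suc d choose j)) + (\<Sum>j\<le>Suc d. (- 1) ^ j
         * (real (Suc d choose j) * real j) * poly r (real j))"
    by (simp add: p sum_distrib_left sum.distrib[symmetric] algebra_simps del: sum.atMost_Suc)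
  also have "(\<Sum>j\<le>Suc d. (- 1) ^ j * real (Suc d choose j)) = (0::real)"
    using choose_alternating_sum[of "Suc d", where 'a = real] by simp
  also have "(\<Sum>j\<le>Suc d. (- 1) ^ j * (real (Suc d choose j) * real j) * poly r (real j)) =
      (\<Sum>j\<le>d. (- 1) ^ Suc j * (real (Suc d choose Suc j) * real (Suc j)) * poly r (real (Suc j)))"
    by (subst sum.atMost_Suc_shift) simp
  also have "\<dots> = - real (Suc d) * (\<Sum>j\<le>d. (- 1) ^ j * real (d choose j) * poly ?r (real j))"
    unfolding absorb by (simp add: sum_distrib_left sum_negf[symmetric] poly_pcompose algebra_simps)
  also have "\<dots> = - real (Suc d) * ((- 1) ^ d * fact d * coeff r d)"
    using Suc.IH[of ?r] deg co by (simp add: degree_pcompose)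
  also have "\<dots> = (- 1) ^ Suc d * fact (Suc d) * coeff p (Suc d)" by (simp add: p algebra_simps)
  finally show ?case by (simp only: mult_zero_right add_0_left)
qed

text \<open>Up to sign, \<open>jac_a n\<close> and \<open>jac_b n\<close> are the coefficients of the kernel of the harmonics of degrees
  below \<open>n\<close>, the Jacobi polynomial \<open>n P\<^sup>(\<^sup>1\<^sup>,\<^sup>0\<^sup>)\<close> of degree \<open>n - 1\<close>, in powers of \<open>(1 - s) / 2\<close> and of
  \<open>(1 + s) / 2\<close>.\<close>

definition jac_b :: "nat \<Rightarrow> nat \<Rightarrow> real" where
  "jac_b n j = real n * (\<Prod>i=1..j. (real n)\<^sup>2 - (real i)\<^sup>2) / (fact j * fact j)"

definition jac_a :: "nat \<Rightarrow> nat \<Rightarrow> real" where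
  "jac_a n j = (real n)\<^sup>2 * (\<Prod>i=1..j. (real n)\<^sup>2 - (real i)\<^sup>2) / (fact j * fact (j + 1))"

lemma jac_a_eq: "jac_a n j = jac_b n j * real n / real (j + 1)"
  by (simp add: jac_a_def jac_b_def power2_eq_square field_simps)

text \<open>In the definition of \<open>jac_b\<close> the index \<open>j\<close> is the length of a
  product. Here it enters through a binomial coefficient and a polynomial of degree \<open>n\<close>
  in \<open>j\<close>, so that alternating sums over \<open>j\<close> become finite
  differences.\<close>

lemma jac_b_eq:
  assumes "j < n"
  shows "jac_b n j * fact (n - 1) = real ((n - 1) choose j) * (\<Prod>i=1..n. real j + real i)"
  using assms
proof (induction j)
  case 0
  have "(\<Prod>i=1..n. real i) = fact n" by (simp add: fact_prod)
  also have "\<dots> = real n * fact (n - 1)" using 0 by (simp add: fact_reduce)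
  finally show ?case by (simp add: jac_b_def)
next
  case (Suc j)
  obtain m where n: "n = Suc m" using Suc.prems by (cases n) auto
  have step: "jac_b n (Suc j) = jac_b n j * ((real n - real (Suc j)) * (real n + real (Suc j)))
      / (real (Suc j) * real (Suc j))"
    by (simp add: jac_b_def field_simps power2_eq_square)
  have ch: "real (m choose Suc j) * real (Suc j) = real (m choose j) * (real n - real (Suc j))"
  proof -
    have "Suc j * (m choose Suc j) = (m - j) * (m choose j)"
      using binomial_absorption[of j m] binomial_absorb_comp[of m j] by (simp add: mult.commute)
    then have "real (Suc j) * real (m choose Suc j) = real (m - j) * real (m choose j)"
      by (metis of_nat_mult)
    then show ?thesis using Suc.prems n by (simp add: of_nat_diff mult.commute)
  qed
  have pr: "(\<Prod>i=1..n. real (Suc j) + real i) * real (Suc j) = (\<Prod>i=1..n. real j + real i) * (real n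
      + real (Suc j))"
  proof -
    have "(\<Prod>i=1..n. real (Suc j) + real i) * real (Suc j) = (\<Prod>i=1..Suc n. real j + real i)" for n
      by (induction n) (auto simp: algebra_simps)
    then show ?thesis by (simp add: algebra_simps)
  qed
  have "jac_b n (Suc j) * fact (n - 1) = (jac_b n j * fact (n - 1)) * ((real n - real (Suc j))
      * (real n + real (Suc j))) / (real (Suc j) * real (Suc j))"
    by (simp add: step)
  also have "\<dots> = (real (m choose j) * (real n - real (Suc j))) * ((\<Prod>i=1..n. real j + real i)
      * (real n + real (Suc j))) / (real (Suc j) * real (Suc j))"
    using Suc n by (simp add: mult_ac)
  also have "\<dots> = real (m choose Suc j) * (\<Prod>i=1..n. real (Suc j) + real i)"
    unfolding ch[symmetric] pr[symmetric] by simp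
  finally show ?case using n by simp
qed

lemma degree_prod_linear: "finite I \<Longrightarrow> degree (\<Prod>i\<in>I. [:real i, 1:]) = card I
    \<and> lead_coeff (\<Prod>i\<in>I. [:real i, 1:]) = 1"
  by (subst degree_prod_eq_sum_degree) (auto simp: lead_coeff_prod)

text \<open>As m + 1 \<le> n, the denominator cancels one factor of the rising product. What remains
  is monic of degree n - 1 in j, and its difference of order n - 1 does not depend on which factor
  was cancelled.\<close>

lemma jac_b_sum:
  assumes "m < n"
  shows "(\<Sum>j<n. (- 1) ^ j * jac_b n j / real (j + m + 1)) = (- 1) ^ (n - 1)"
proof -
  define P where "P = (\<Prod>i\<in>{1..n} - {m + 1}. [:real i, 1:])"
  have card: "card ({1..n} - {m + 1}) = n - 1" using assms by simp
  have deg: "degree P = n - 1" "coeff P (n - 1) = 1"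
    using degree_prod_linear[of "{1..n} - {m + 1}"] card unfolding P_def by auto
  have poly: "(\<Prod>i=1..n. real j + real i) / real (j + m + 1) = poly P (real j)" for j
  proof -
    have "(\<Prod>i=1..n. real j + real i) = (real j + real (m + 1)) * (\<Prod>i\<in>{1..n} - {m + 1}. real j + real i)"
      using assms by (intro prod.remove) auto
    then show ?thesis by (simp add: P_def poly_prod add.commute add.left_commute)
  qed
  have "(\<Sum>j<n. (- 1) ^ j * jac_b n j / real (j + m + 1)) * fact (n - 1)
     = (\<Sum>j<n. (- 1) ^ j * real ((n - 1) choose j) * poly P (real j))"
    unfolding sum_distrib_right
  proof (rule sum.cong[OF refl])
    fix j assume "j \<in> {..<n}"
    then have "jac_b n j * fact (n - 1) / real (j + m + 1) = real ((n - 1) choose j) * poly P (real j)"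
      by (simp only: jac_b_eq lessThan_iff flip: poly) simp
    moreover have "(- 1) ^ j * jac_b n j / real (j + m + 1) * fact (n - 1) = (- 1) ^ j * (jac_b n j
        * fact (n - 1) / real (j + m + 1))"
      by simp
    ultimately show "(- 1) ^ j * jac_b n j / real (j + m + 1) * fact (n - 1) = (- 1) ^ j * real ((n
        - 1) choose j) * poly P (real j)"
      by (simp only: mult.assoc)
  qed
  also have "\<dots> = (\<Sum>j\<le>n - 1. (- 1) ^ j * real ((n - 1) choose j) * poly P (real j))"
    by (rule sum.cong) (use assms in auto)
  also have "\<dots> = (- 1) ^ (n - 1) * fact (n - 1)"
    using alternating_binomial_poly_sum[of P "n - 1"] deg by simp
  finally show ?thesis by simp
qed

text \<open>For m > 0 a partial fraction of 1 / ((j + 1) (j + m + 1)) gives the difference of two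
  equal \<open>jac_b\<close> sums. For m = 0 the pole at j = -1 is double: one factor cancels, and
  the rest is divided by j + 1 with remainder. The quotient \<open>R\<close> has degree below n - 1
  and is annihilated; the remainder leaves a plain alternating binomial sum.\<close>

lemma jac_a_sum:
  assumes "m < n"
  shows "(\<Sum>j<n. (- 1) ^ j * jac_a n j / real (j + m + 1)) = (if m = 0 then 1 else 0)"
proof (cases "m = 0")
  case False
  have "(\<Sum>j<n. (- 1) ^ j * jac_a n j / real (j + m + 1)) =
    (\<Sum>j<n. (real n / real m) * ((- 1) ^ j * jac_b n j / real (j + 0 + 1) - (- 1) ^ j * jac_b n j
        / real (j + m + 1)))"
    by (rule sum.cong[OF refl]) (use False in \<open>simp add: jac_a_eq field_simps\<close>)
  also have "\<dots> = (real n / real m) * ((\<Sum>j<n. (- 1) ^ j * jac_b n j / real (j + 0 + 1))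
      - (\<Sum>j<n. (- 1) ^ j * jac_b n j / real (j + m + 1)))"
    unfolding sum_distrib_left[symmetric] sum_subtractf ..
  also have "\<dots> = 0" using assms by (subst jac_b_sum, simp, subst jac_b_sum) auto
  finally show ?thesis using False by simp
next
  case True
  define P where "P = (\<Prod>i\<in>{2..n}. [:real i, 1:])"
  have deg: "degree P = n - 1" using degree_prod_linear[of "{2..n}"] unfolding P_def by simp
  have Pm1: "poly P (- 1) = fact (n - 1)"
  proof -
    have "poly P (- 1) = (\<Prod>i=2..n. real (i - 1))" unfolding P_def poly_prod
      by (rule prod.cong) (auto simp: of_nat_diff)
    also have "\<dots> = (\<Prod>i=1..n-1. real i)"
      by (rule prod.reindex_bij_witness[of _ Suc "\<lambda>i. i - 1"]) auto
    finally show ?thesis by (simp add: fact_prod)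
  qed
  have "[:- (- 1), 1:] dvd P - [:poly P (- 1):]" by (subst poly_eq_0_iff_dvd[symmetric]) simp
  then obtain R where R: "P - [:poly P (- 1):] = [:1, 1:] * R" by (auto elim!: dvdE)
  have "degree (P - [:poly P (- 1):]) \<le> n - 1" using deg by (intro degree_diff_le) auto
  moreover have "degree ([:1, 1:] * R) = 1 + degree R" if "R \<noteq> 0"
    using that by (subst degree_mult_eq) auto
  ultimately have degR: "R = 0 \<or> degree R < n - 1" unfolding R by linarith
  have poly: "(\<Prod>i=1..n. real j + real i) / (real (j + 1) * real (j + 1)) = poly R (real j) + fact (n
      - 1) / real (j + 1)" for j
  proof -
    have "(\<Prod>i=1..n. real j + real i) = (real j + 1) * (\<Prod>i=2..n. real j + real i)"
      using assms prod.atLeast_Suc_atMost[of 1 n "\<lambda>i. real j + real i"] by (simp add: numeral_2_eq_2)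
    also have "(\<Prod>i=2..n. real j + real i) = poly P (real j)" by (simp add: P_def poly_prod add.commute)
    also have "poly P (real j) = (real j + 1) * poly R (real j) + fact (n - 1)"
      using arg_cong[OF R, of "\<lambda>p. poly p (real j)"] Pm1 by (simp add: algebra_simps)
    finally show ?thesis by (simp add: field_simps add_nonneg_eq_0_iff)
  qed
  have absorb: "real ((n - 1) choose j) / real (j + 1) = real (n choose Suc j) / real n" for j
  proof -
    have n: "Suc (n - 1) = n" using assms by simp
    have "Suc j * (n choose Suc j) = n * ((n - 1) choose j)"
      using Suc_times_binomial_eq[of "n - 1" j] unfolding n by (simp only: mult.commute)
    from arg_cong[OF this, of real] have "real (Suc j) * real (n choose Suc j) = real n * real ((n
        - 1) choose j)"
      by (simp only: of_nat_mult)
    then show ?thesis using assms by (simp add: field_simps)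
  qed
  have "(\<Sum>j<n. (- 1) ^ j * jac_a n j / real (j + m + 1)) * fact (n - 1)
     = (\<Sum>j<n. real n * ((- 1) ^ j * real ((n - 1) choose j) * poly R (real j)) + fact (n - 1)
         * ((- 1) ^ j * real (n choose Suc j)))"
    unfolding sum_distrib_right
  proof (rule sum.cong[OF refl])
    fix j assume "j \<in> {..<n}"
    then have j: "j < n" by simp
    have "jac_a n j * fact (n - 1) / real (j + m + 1) = real n * (jac_b n j * fact (n - 1))
        / (real (j + 1) * real (j + 1))"
      using True by (simp add: jac_a_eq)
    also have "\<dots> = real n * real ((n - 1) choose j) * ((\<Prod>i=1..n. real j + real i) / (real (j + 1)
        * real (j + 1)))"
      unfolding jac_b_eq[OF j] by simp
    also have "\<dots> = real n * real ((n - 1) choose j) * poly R (real j) + real n * (real ((n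
        - 1) choose j) / real (j + 1)) * fact (n - 1)"
      unfolding poly by (simp add: algebra_simps)
    also have "\<dots> = real n * real ((n - 1) choose j) * poly R (real j) + real (n choose Suc j)
        * fact (n - 1)"
      unfolding absorb using assms by simp
    finally have "(- 1) ^ j * (jac_a n j * fact (n - 1) / real (j + m + 1)) = (- 1) ^ j * (real n
        * real ((n - 1) choose j) * poly R (real j) + real (n choose Suc j) * fact (n - 1))"
      by (simp only:)
    then show "(- 1) ^ j * jac_a n j / real (j + m + 1) * fact (n - 1) = real n * ((- 1) ^ j
        * real ((n - 1) choose j) * poly R (real j)) + fact (n - 1) * ((- 1) ^ j * real (n choose Suc j))"
      by (simp add: algebra_simps)
  qed
  also have "\<dots> = real n * (\<Sum>j<n. (- 1) ^ j * real ((n - 1) choose j) * poly R (real j)) + fact (n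
      - 1) * (\<Sum>j<n. (- 1) ^ j * real (n choose Suc j))"
    by (simp add: sum.distrib sum_distrib_left)
  also have "(\<Sum>j<n. (- 1) ^ j * real ((n - 1) choose j) * poly R (real j)) = 0"
  proof -
    have "(\<Sum>j<n. (- 1) ^ j * real ((n - 1) choose j) * poly R (real j)) = (\<Sum>j\<le>n - 1. (- 1) ^ j
        * real ((n - 1) choose j) * poly R (real j))"
      by (rule sum.cong) (use assms in auto)
    also have "\<dots> = (- 1) ^ (n - 1) * fact (n - 1) * coeff R (n - 1)"
      using degR by (intro alternating_binomial_poly_sum) auto
    also have "coeff R (n - 1) = 0" using degR by (auto intro: coeff_eq_0)
    finally show ?thesis by simp
  qed
  also have "(\<Sum>j<n. (- 1) ^ j * real (n choose Suc j)) = 1"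
  proof -
    have "0 = (\<Sum>j\<le>n. (- 1) ^ j * real (n choose j))"
      using choose_alternating_sum[of n, where 'a = real] assms by simp
    also have "\<dots> = 1 + (\<Sum>j<n. (- 1) ^ Suc j * real (n choose Suc j))"
      by (subst sum.atMost_shift) simp
    finally show ?thesis by (simp add: sum_negf)
  qed
  finally show ?thesis using True by simp
qed

section \<open>The zonal kernel on the interval and its two expansions\<close>

lemma interval_integral_half_power:
  assumes "\<bar>c\<bar> = 1"
  shows "(\<integral>x. ((1 + c * x) / 2) ^ m \<partial>interval_measure_pm1) = 1 / (real m + 1)"
proof -
  define F where "F x = c * ((1 + c * x) / 2) ^ Suc m * 2 / (real m + 1)" for x
  have cc: "c * c = 1" using assms by (metis abs_mult_self_eq mult_1)
  have "(\<integral>x. ((1 + c * x) / 2) ^ m * indicator {-1..1} x \<partial>lborel) = F 1 - F (- 1)"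
  proof (rule integral_FTC_Icc_real)
    show "(F has_real_derivative ((1 + c * x) / 2) ^ m) (at x)" for x
    proof -
      have "(F has_real_derivative c * (real (Suc m) * (c / 2 * ((1 + c * x) / 2) ^ m)) * 2
          / (real m + 1)) (at x)"
        unfolding F_def by (rule derivative_eq_intros refl | simp)+
      moreover have "c * (real (Suc m) * (c / 2 * Y)) * 2 / (real m + 1) = (c * c) * Y" for Y
        by (simp add: field_simps)
      ultimately show ?thesis using cc by simp
    qed
  qed (auto intro!: continuous_intros)
  also have "F 1 - F (- 1) = 2 * (1 / (real m + 1))"
  proof -
    from assms have "c = 1 \<or> c = - 1" by (auto simp: abs_if split: if_splits)
    then show ?thesis by (auto simp: F_def)
  qed
  finally have "(\<integral>x. ((1 + c * x) / 2) ^ m * indicator {-1..1} x \<partial>lborel) / 2 = 1 / (real m + 1)"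
    by linarith
  moreover have "(\<integral>x. ((1 + c * x) / 2) ^ m \<partial>interval_measure_pm1) = (\<integral>x. ((1 + c * x) / 2) ^ m
      * indicator {-1..1} x \<partial>lborel) / 2"
    by (rule integral_interval_measure_pm1) auto
  ultimately show ?thesis by (simp only:)
qed

text \<open>In terms of Legendre polynomials this is the sum of (2 l + 1) P_l over l < n. It is
  expanded around s = 1, where the limit is taken.\<close>

definition zonal_kernel :: "nat \<Rightarrow> real \<Rightarrow> real" where
  "zonal_kernel n s = (\<Sum>j<n. (- 1) ^ j * jac_a n j * ((1 - s) / 2) ^ j)"

text \<open>The same polynomial expanded around s = -1. In this form it is visible that the kernel
  has size n at the antipode, against n^2 at s = 1.\<close>

definition zonal_kernel' :: "nat \<Rightarrow> real \<Rightarrow> real" where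
  "zonal_kernel' n s = (- 1) ^ (n - 1) * (\<Sum>j<n. (- 1) ^ j * jac_b n j * ((1 + s) / 2) ^ j)"

lemma zonal_kernel_continuous [continuous_intros]:
  "continuous_on A f \<Longrightarrow> continuous_on A (\<lambda>x. zonal_kernel n (f x))"
  "continuous_on A f \<Longrightarrow> continuous_on A (\<lambda>x. zonal_kernel' n (f x))"
  unfolding zonal_kernel_def zonal_kernel'_def by (intro continuous_intros; simp)+

text \<open>The hypothesis \<open>mom\<close> is the claim for the basis ((1 + \<sigma> x) / 2)^m,
  whose moments are reciprocals of integers; the rest is linearity. The sign \<sigma> covers both
  expansions: the value at 1 is 1 for \<sigma> = 1, and 0^m for \<sigma> = -1, which is 1 for m =
  0.\<close>

lemma interval_integral_poly_reproduce:
  fixes c :: "nat \<Rightarrow> real" and q :: "real poly"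
  assumes s: "\<bar>\<sigma>\<bar> = 1" and q: "degree q < n"
    and mom: "\<And>m. m < n \<Longrightarrow> (\<Sum>j<n. c j / real (j + m + 1)) = ((1 + \<sigma>) / 2) ^ m"
  shows "(\<integral>x. (\<Sum>j<n. c j * ((1 + \<sigma> * x) / 2) ^ j) * poly q x \<partial>interval_measure_pm1) = poly q 1"
proof -
  define p where "p = pcompose q [:- \<sigma>, 2 * \<sigma>:]"
  have ss: "\<sigma> * \<sigma> = 1" using s by (metis abs_mult_self_eq mult_1)
  have deg: "degree p < n" unfolding p_def using q s by (simp add: degree_pcompose)
  have pq: "poly q x = poly p ((1 + \<sigma> * x) / 2)" for x
  proof -
    have "- \<sigma> + (1 + \<sigma> * x) / 2 * (2 * \<sigma>) = (\<sigma> * \<sigma>) * x" by (simp add: field_simps)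
    then show ?thesis using ss by (simp add: p_def poly_pcompose)
  qed
  have palt: "poly p y = (\<Sum>m<n. coeff p m * y ^ m)" for y
  proof -
    have "poly p y = (\<Sum>m\<le>degree p. coeff p m * y ^ m)" by (rule poly_altdef)
    also have "\<dots> = (\<Sum>m<n. coeff p m * y ^ m)"
      by (rule sum.mono_neutral_left) (use deg in \<open>auto simp: coeff_eq_0\<close>)
    finally show ?thesis .
  qed
  have "(\<integral>x. (\<Sum>j<n. c j * ((1 + \<sigma> * x) / 2) ^ j) * poly q x \<partial>interval_measure_pm1) =
     (\<integral>x. (\<Sum>m<n. \<Sum>j<n. coeff p m * c j * ((1 + \<sigma> * x) / 2) ^ (j + m)) \<partial>interval_measure_pm1)"
  proof -
    have "(\<Sum>j<n. c j * y ^ j) * (\<Sum>m<n. coeff p m * y ^ m) = (\<Sum>m<n. \<Sum>j<n. coeff p m * c j * y ^ (j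
        + m))" for y
      by (simp only: sum_product, subst sum.swap) (simp add: power_add mult_ac)
    then show ?thesis unfolding pq palt by (simp only:)
  qed
  also have "\<dots> = (\<Sum>m<n. \<Sum>j<n. (\<integral>x. coeff p m * c j * ((1 + \<sigma> * x) / 2) ^ (j + m) \<partial>interval_measure_pm1))"
    by (subst Bochner_Integration.integral_sum; (subst Bochner_Integration.integral_sum)?)
       (auto intro!: Bochner_Integration.integrable_sum interval_integrable continuous_intros)
  also have "\<dots> = (\<Sum>m<n. \<Sum>j<n. coeff p m * (c j / real (j + m + 1)))"
    by (simp add: interval_integral_half_power[OF s] add.commute add.left_commute)
  also have "\<dots> = (\<Sum>m<n. coeff p m * (\<Sum>j<n. c j / real (j + m + 1)))"
    by (simp add: sum_distrib_left)
  also have "\<dots> = (\<Sum>m<n. coeff p m * ((1 + \<sigma>) / 2) ^ m)"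
    by (intro sum.cong refl) (simp only: mom lessThan_iff)
  also have "\<dots> = poly q 1" by (simp add: pq palt)
  finally show ?thesis .
qed

lemma zonal_kernel_reproduce:
  assumes "degree q < n"
  shows "(\<integral>x. zonal_kernel n x * poly q x \<partial>interval_measure_pm1) = poly q 1"
proof -
  have "(\<integral>x. (\<Sum>j<n. ((- 1) ^ j * jac_a n j) * ((1 + - 1 * x) / 2) ^ j)
      * poly q x \<partial>interval_measure_pm1) = poly q 1"
    by (rule interval_integral_poly_reproduce[OF _ assms]) (simp_all only: jac_a_sum, auto)
  then show ?thesis by (simp add: zonal_kernel_def)
qed

lemma zonal_kernel'_reproduce:
  assumes "degree q < n"
  shows "(\<integral>x. zonal_kernel' n x * poly q x \<partial>interval_measure_pm1) = poly q 1"
proof -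
  have "(\<integral>x. (\<Sum>j<n. ((- 1) ^ (n - 1) * ((- 1) ^ j * jac_b n j)) * ((1 + 1 * x) / 2) ^ j)
      * poly q x \<partial>interval_measure_pm1) = poly q 1"
  proof (rule interval_integral_poly_reproduce[OF _ assms])
    fix m assume "m < n"
    have "(\<Sum>j<n. (- 1) ^ (n - 1) * ((- 1) ^ j * jac_b n j) / real (j + m + 1)) = (- 1) ^ (n - 1)
        * (\<Sum>j<n. (- 1) ^ j * jac_b n j / real (j + m + 1))"
      by (simp only: sum_distrib_left times_divide_eq_right)
    also have "\<dots> = 1" by (simp only: jac_b_sum[OF \<open>m < n\<close>] flip: power_add) simp
    finally show "(\<Sum>j<n. (- 1) ^ (n - 1) * ((- 1) ^ j * jac_b n j) / real (j + m + 1)) = ((1 + 1) / 2) ^ m"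
      by simp
  qed simp
  then show ?thesis by (simp add: zonal_kernel'_def sum_distrib_left mult.assoc)
qed

lemma zonal_kernel_poly:
  assumes "n > 0"
  obtains p where "degree p < n" "\<And>s. zonal_kernel n s = poly p s"
proof
  let ?p = "\<Sum>j<n. smult ((- 1) ^ j * jac_a n j) ([:1/2, -1/2:] ^ j)"
  show "degree ?p < n"
    using assms by (intro degree_sum_less le_less_trans[OF degree_smult_le] le_less_trans[OF
        degree_power_le]) auto
  show "zonal_kernel n s = poly ?p s" for s
    by (simp add: zonal_kernel_def poly_sum poly_power diff_divide_distrib)
qed

lemma zonal_kernel'_poly:
  assumes "n > 0"
  obtains p where "degree p < n" "\<And>s. zonal_kernel' n s = poly p s"
proof
  let ?p = "smult ((- 1) ^ (n - 1)) (\<Sum>j<n. smult ((- 1) ^ j * jac_b n j) ([:1/2, 1/2:] ^ j))"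
  show "degree ?p < n"
    using assms by (intro le_less_trans[OF degree_smult_le] degree_sum_less le_less_trans[OF
        degree_power_le]) auto
  show "zonal_kernel' n s = poly ?p s" for s
    by (simp add: zonal_kernel'_def poly_sum poly_power add_divide_distrib)
qed

text \<open>Both sides are polynomials of degree below \<open>n\<close> that reproduce the value at
  1, so their difference is orthogonal to itself and vanishes almost everywhere, which for a
  polynomial means identically.\<close>

lemma zonal_kernel_eq:
  assumes "n > 0" shows "zonal_kernel n s = zonal_kernel' n s"
proof -
  obtain p where p: "degree p < n" "\<And>s. zonal_kernel n s = poly p s" using zonal_kernel_poly assms by blast
  obtain p' where p': "degree p' < n" "\<And>s. zonal_kernel' n s = poly p' s"
      using zonal_kernel'_poly assms by blast
  define d where "d = p - p'"
  have deg: "degree d < n" unfolding d_def using p p' by (intro degree_diff_less)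
  have int: "integrable interval_measure_pm1 (\<lambda>x. poly f x * poly g x)" for f g
    by (intro interval_integrable continuous_intros)
  have "(\<integral>x. poly d x * poly d x \<partial>interval_measure_pm1) = (\<integral>x. poly p x * poly d x - poly p' x
      * poly d x \<partial>interval_measure_pm1)"
    by (simp add: d_def algebra_simps)
  also have "\<dots> = (\<integral>x. poly p x * poly d x \<partial>interval_measure_pm1) - (\<integral>x. poly p' x
      * poly d x \<partial>interval_measure_pm1)"
    by (rule Bochner_Integration.integral_diff[OF int int])
  also have "\<dots> = 0"
    using zonal_kernel_reproduce[OF deg] zonal_kernel'_reproduce[OF deg] by (simp add: p p')
  finally have "AE x in interval_measure_pm1. poly d x * poly d x = 0"
    by (subst (asm) integral_nonneg_eq_0_iff_AE[OF int]) auto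
  have "d = 0"
  proof (rule ccontr)
    assume "d \<noteq> 0"
    then have "finite {x. poly d x = 0}" by (rule poly_roots_finite)
    then have "AE x in lborel. x \<notin> {x. poly d x = 0}"
      by (intro AE_not_in finite_imp_null_set_lborel)
    then have "AE x in interval_measure_pm1. poly d x \<noteq> 0"
      unfolding interval_measure_pm1_def by (subst AE_density) (auto elim: eventually_mono)
    with \<open>AE x in interval_measure_pm1. poly d x * poly d x = 0\<close> have "AE x in interval_measure_pm1. False"
      by eventually_elim simp
    then show False by simp
  qed
  then show ?thesis using p p' by (simp add: d_def)
qed

text \<open>Expand \<open>w \<bullet> u\<close> along \<open>v\<close> and \<open>v\<close>-perpendicular directions: all but the leading term carry a factor
  \<open>(1 - (w \<bullet> v)\<^sup>2)\<^sup>j\<close>, which vanishes at height 1, the point of evaluation.\<close>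

lemma sphere_zonal_power:
  fixes u v :: "real^3"
  assumes v: "norm v = 1" and m: "m < n"
  shows "(\<integral>w. zonal_kernel n (w \<bullet> v) * (w \<bullet> u) ^ m \<partial>sphere_measure) = (u \<bullet> v) ^ m"
proof -
  let ?k = "zonal_kernel n"
  define c where "c = u \<bullet> v"
  define y where "y = u - c *\<^sub>R v"
  have vy: "v \<bullet> y = 0" using v by (simp add: y_def c_def inner_simps inner_commute dot_square_norm)
  obtain e where e: "norm e = 1" "v \<bullet> e = 0" "y = norm y *\<^sub>R e"
  proof (cases "y = 0")
    case True
    then show ?thesis using orthogonal_unit_exists[of v] that by auto
  next
    case False
    then show ?thesis using that[of "y /\<^sub>R norm y"] vy by simp
  qed
  define r where "r = norm y"
  have wu: "w \<bullet> u = r * (w \<bullet> e) + c * (w \<bullet> v)" for w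
  proof -
    have "u = r *\<^sub>R e + c *\<^sub>R v" using e(3) by (simp add: y_def r_def)
    then show ?thesis by (simp add: inner_simps)
  qed
  have cont: "continuous_on UNIV (\<lambda>x. ?k x * (c * x) ^ l)" for l by (intro continuous_intros)
  define J where "J i = (\<integral>w. ?k (w \<bullet> v) * (c * (w \<bullet> v)) ^ (m - i) * (w \<bullet> e) ^ i \<partial>sphere_measure)" for i
  have J0: "J 0 = c ^ m"
  proof -
    have "J 0 = (\<integral>x. ?k x * (c * x) ^ m \<partial>interval_measure_pm1)"
      unfolding J_def using sphere_integral_height[OF v cont[of m]] by simp
    also have "\<dots> = (\<integral>x. ?k x * poly ([:0, c:] ^ m) x \<partial>interval_measure_pm1)"
      by (simp add: poly_power mult.commute)
    also have "\<dots> = poly ([:0, c:] ^ m) 1"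
      by (rule zonal_kernel_reproduce[OF le_less_trans[OF degree_power_le]]) (use m in auto)
    finally show ?thesis by (simp add: poly_power)
  qed
  have Ji: "J i = 0" if i: "0 < i" "i \<le> m" for i
  proof (cases "odd i")
    case True
    then show ?thesis unfolding J_def
      using sphere_integral_odd_power[OF cont[of "m - i"] e(2) True] by simp
  next
    case False
    then obtain j where j: "i = 2 * j" by blast
    obtain C where C: "\<And>G. continuous_on UNIV G \<Longrightarrow> (\<integral>w. G (w \<bullet> v) * (w \<bullet> e) ^ (2 * j) \<partial>sphere_measure)
     = C * (\<integral>w. G (w \<bullet> v) * (1 - (w \<bullet> v)\<^sup>2) ^ j \<partial>sphere_measure)"
      using sphere_integral_even_power[OF v e(1,2), of j] by blast
    define q where "q = [:0, c:] ^ (m - i) * [:1, 0, -1:] ^ j"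
    \<comment> \<open>Replacing \<open>(w \<bullet> e) ^ i\<close> by a power of 1 - x^2 preserves
      the total degree, since i = 2 j; so \<open>q\<close> has degree at most
      \<open>m\<close>.\<close>
    have degq: "degree q < n"
    proof -
      have "degree q \<le> degree ([:0, c:] ^ (m - i)) + degree ([:1, 0, -1:] ^ j :: real poly)"
        unfolding q_def by (rule degree_mult_le)
      also have "\<dots> \<le> 1 * (m - i) + 2 * j"
        by (intro add_mono order_trans[OF degree_power_le] mult_right_mono) auto
      also have "\<dots> < n" using i m j by simp
      finally show ?thesis .
    qed
    have "J i = C * (\<integral>w. ?k (w \<bullet> v) * (c * (w \<bullet> v)) ^ (m - i) * (1 - (w \<bullet> v)\<^sup>2) ^ j \<partial>sphere_measure)"
      unfolding J_def using C[OF cont[of "m - i"]] j by simp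
    also have "(\<integral>w. ?k (w \<bullet> v) * (c * (w \<bullet> v)) ^ (m - i) * (1 - (w \<bullet> v)\<^sup>2) ^ j \<partial>sphere_measure)
        = (\<integral>x. ?k x * (c * x) ^ (m - i) * (1 - x\<^sup>2) ^ j \<partial>interval_measure_pm1)"
      by (rule sphere_integral_height[OF v]) (intro continuous_intros)
    also have "\<dots> = (\<integral>x. ?k x * poly q x \<partial>interval_measure_pm1)"
      by (simp add: q_def poly_power algebra_simps power2_eq_square)
    also have "\<dots> = poly q 1" by (rule zonal_kernel_reproduce[OF degq])
    also have "\<dots> = 0" using j i by (simp add: q_def poly_power)
    finally show ?thesis by simp
  qed
  have "(\<integral>w. ?k (w \<bullet> v) * (w \<bullet> u) ^ m \<partial>sphere_measure) =
     (\<integral>w. (\<Sum>i\<le>m. (real (m choose i) * r ^ i) * (?k (w \<bullet> v) * (c * (w \<bullet> v)) ^ (m - i)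
         * (w \<bullet> e) ^ i)) \<partial>sphere_measure)"
    by (rule Bochner_Integration.integral_cong[OF refl])
       (simp only: wu binomial_ring sum_distrib_left power_mult_distrib mult_ac)
  also have "\<dots> = (\<Sum>i\<le>m. (real (m choose i) * r ^ i) * J i)"
    unfolding J_def
    by (subst Bochner_Integration.integral_sum) (auto intro!: sphere_integrable continuous_intros)
  also have "\<dots> = (\<Sum>i\<in>{0}. (real (m choose i) * r ^ i) * J i)"
    by (rule sum.mono_neutral_right) (auto simp: Ji)
  finally show ?thesis by (simp add: J0 c_def)
qed

theorem sphere_zonal_reproduce:
  fixes u v :: "real^3"
  assumes v: "norm v = 1" and n: "n > 0"
  shows "(\<integral>w. zonal_kernel n (w \<bullet> v) * zonal_kernel n (w \<bullet> u) \<partial>sphere_measure) = zonal_kernel n (u \<bullet> v)"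
proof -
  obtain p where p: "degree p < n" "\<And>s. zonal_kernel n s = poly p s" using zonal_kernel_poly n by blast
  have "(\<integral>w. zonal_kernel n (w \<bullet> v) * zonal_kernel n (w \<bullet> u) \<partial>sphere_measure) =
     (\<integral>w. (\<Sum>i\<le>degree p. coeff p i * (zonal_kernel n (w \<bullet> v) * (w \<bullet> u) ^ i)) \<partial>sphere_measure)"
    unfolding p(2)[of "_ \<bullet> u"] by (simp add: poly_altdef sum_distrib_left mult_ac)
  also have "\<dots> = (\<Sum>i\<le>degree p. coeff p i * (\<integral>w. zonal_kernel n (w \<bullet> v) * (w \<bullet> u) ^ i \<partial>sphere_measure))"
    by (subst Bochner_Integration.integral_sum) (auto intro!: sphere_integrable continuous_intros)
  also have "\<dots> = (\<Sum>i\<le>degree p. coeff p i * (u \<bullet> v) ^ i)"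
    using p(1) by (intro sum.cong refl) (simp add: sphere_zonal_power[OF v])
  also have "\<dots> = zonal_kernel n (u \<bullet> v)" by (simp add: p(2) poly_altdef)
  finally show ?thesis .
qed

section \<open>Determinantal energy bounds\<close>

text \<open>The kernel of an orthogonal projection: symmetric, idempotent, with the trace
  \<open>N\<close> as its rank. Boundedness makes every integral below exist on a probability
  space.\<close>

definition reproducing_kernel :: "'a measure \<Rightarrow> ('a \<Rightarrow> 'a \<Rightarrow> real) \<Rightarrow> real \<Rightarrow> bool" where
  "reproducing_kernel M K N \<longleftrightarrow>
     (\<lambda>(x, y). K x y) \<in> borel_measurable (M \<Otimes>\<^sub>M M) \<and>
     (\<exists>c. \<forall>x\<in>space M. \<forall>y\<in>space M. \<bar>K x y\<bar> \<le> c) \<and>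
     (\<forall>x\<in>space M. \<forall>y\<in>space M. K x y = K y x \<and> (\<integral>w. K x w * K w y \<partial>M) = K x y) \<and>
     (\<integral>x. K x x \<partial>M) = N"

definition det2 :: "('a \<Rightarrow> 'a \<Rightarrow> real) \<Rightarrow> 'a \<Rightarrow> 'a \<Rightarrow> real" where
  "det2 K x y = K x x * K y y - (K x y)\<^sup>2"

text \<open>The 3 by 3 determinant of a symmetric kernel, expanded along the row of
  \<open>a\<close>.\<close>

definition det3 :: "('a \<Rightarrow> 'a \<Rightarrow> real) \<Rightarrow> 'a \<Rightarrow> 'a \<Rightarrow> 'a \<Rightarrow> real" where
  "det3 K a x y = K a a * det2 K x y - (K a x)\<^sup>2 * K y y - (K a y)\<^sup>2 * K x x + 2 * K a x * K x y * K a y"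

lemma measurable_case_prod_compose:
  assumes "(\<lambda>(x, y). K x y) \<in> borel_measurable (M \<Otimes>\<^sub>M M)" "f \<in> measurable L M" "g \<in> measurable L M"
  shows "(\<lambda>z. K (f z) (g z)) \<in> borel_measurable L"
  using measurable_compose[OF measurable_Pair[OF assms(2,3)] assms(1)] by simp

text \<open>A Schur complement: it removes the projection onto the function \<open>K a\<close>,
  whose squared norm is \<open>K a a\<close>. What is left projects onto the functions of the range
  that vanish at \<open>a\<close>, of rank one less.\<close>

definition condition_kernel :: "('a \<Rightarrow> 'a \<Rightarrow> real) \<Rightarrow> 'a \<Rightarrow> 'a \<Rightarrow> 'a \<Rightarrow> real" where
  "condition_kernel K a x y = K x y - K x a * K a y / K a a"

context prob_space
begin

lemma integrable_bounded:
  fixes f :: "'a \<Rightarrow> real"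
  assumes "f \<in> borel_measurable M" "\<And>x. x \<in> space M \<Longrightarrow> \<bar>f x\<bar> \<le> c"
  shows "integrable M f"
  using assms by (intro integrable_const_bound[of _ c]) auto

context
  fixes K :: "'a \<Rightarrow> 'a \<Rightarrow> real" and N :: real
  assumes K: "reproducing_kernel M K N"
begin

lemma kernel_measurable:
  assumes "f \<in> measurable L M" "g \<in> measurable L M"
  shows "(\<lambda>z. K (f z) (g z)) \<in> borel_measurable L"
  using K assms by (auto simp: reproducing_kernel_def intro: measurable_case_prod_compose)

lemma kernel_bound: obtains c where "c \<ge> 0" "\<And>x y. x \<in> space M \<Longrightarrow> y \<in> space M \<Longrightarrow> \<bar>K x y\<bar> \<le> c"
proof -
  obtain c where "\<forall>x\<in>space M. \<forall>y\<in>space M. \<bar>K x y\<bar> \<le> c" using K unfolding reproducing_kernel_def by auto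
  then show ?thesis using that[of "max c 0"] by fastforce
qed

lemma kernel_sym: "x \<in> space M \<Longrightarrow> y \<in> space M \<Longrightarrow> K x y = K y x"
  using K unfolding reproducing_kernel_def by blast

lemma kernel_repro: "x \<in> space M \<Longrightarrow> y \<in> space M \<Longrightarrow> (\<integral>w. K x w * K y w \<partial>M) = K x y"
proof -
  assume xy: "x \<in> space M" "y \<in> space M"
  have "(\<integral>w. K x w * K y w \<partial>M) = (\<integral>w. K x w * K w y \<partial>M)"
    by (rule Bochner_Integration.integral_cong) (use xy kernel_sym in auto)
  then show ?thesis using xy K unfolding reproducing_kernel_def by auto
qed

lemma kernel_integrable:
  assumes xy: "x \<in> space M" "y \<in> space M"
  shows "integrable M (\<lambda>w. K x w * K y w)"
proof -
  obtain c where c: "c \<ge> 0" "\<And>x y. x \<in> space M \<Longrightarrow> y \<in> space M \<Longrightarrow> \<bar>K x y\<bar> \<le> c"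
    using kernel_bound by blast
  show ?thesis
  proof (rule integrable_bounded[of _ "c * c"])
    show "(\<lambda>w. K x w * K y w) \<in> borel_measurable M"
      using xy by (intro borel_measurable_times kernel_measurable) auto
    show "\<bar>K x w * K y w\<bar> \<le> c * c" if "w \<in> space M" for w
      unfolding abs_mult using c xy that by (intro mult_mono) auto
  qed
qed

lemma kernel_diag_integrable: "integrable M (\<lambda>a. K a a)"
proof -
  obtain c where c: "\<And>x y. x \<in> space M \<Longrightarrow> y \<in> space M \<Longrightarrow> \<bar>K x y\<bar> \<le> c"
    using kernel_bound by metis
  show ?thesis
  proof (rule integrable_bounded[of _ c])
    show "(\<lambda>a. K a a) \<in> borel_measurable M" by (rule kernel_measurable) simp_all
    show "\<bar>K x x\<bar> \<le> c" if "x \<in> space M" for x using c[OF that that] .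
  qed
qed

lemma kernel_diag_nonneg: "x \<in> space M \<Longrightarrow> K x x \<ge> 0"
  by (subst kernel_repro[symmetric]) auto

text \<open>By reproduction \<open>K x x\<close> is the squared norm of \<open>K x\<close>, so
  \<open>K x\<close> vanishes almost everywhere, and reproducing once more gives every
  value.\<close>

lemma kernel_diag_zero:
  assumes "x \<in> space M" "y \<in> space M" "K x x = 0"
  shows "K x y = 0"
proof -
  have "(\<integral>w. K x w * K x w \<partial>M) = 0" using kernel_repro[of x x] assms by simp
  then have "AE w in M. K x w * K x w = 0"
    using integral_nonneg_eq_0_iff_AE[OF kernel_integrable[OF assms(1,1)]] by simp
  then have "AE w in M. K x w * K y w = 0" by eventually_elim auto
  then have "(\<integral>w. K x w * K y w \<partial>M) = (\<integral>w. 0 \<partial>M)"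
    by (intro integral_cong_AE) (use assms kernel_integrable in auto)
  then show ?thesis using kernel_repro assms by simp
qed

text \<open>The Cauchy-Schwarz inequality for the functions \<open>K x\<close> and
  \<open>K y\<close>, obtained from the integral of one square; this square loses its content when
  \<open>K x x\<close> is 0, hence the separate case.\<close>

lemma det2_nonneg:
  assumes x: "x \<in> space M" and y: "y \<in> space M"
  shows "det2 K x y \<ge> 0"
proof (cases "K x x = 0")
  case True
  then show ?thesis using kernel_diag_zero[OF x y] by (simp add: det2_def)
next
  case False
  have "0 \<le> (\<integral>w. (K x x * K y w - K x y * K x w)\<^sup>2 \<partial>M)" by simp
  also have "\<dots> = (\<integral>w. (K x x)\<^sup>2 * (K y w * K y w) - 2 * K x x * K x y * (K x w * K y w) + (K x y)\<^sup>2
      * (K x w * K x w) \<partial>M)"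
    by (simp add: power2_eq_square algebra_simps)
  also have "\<dots> = (K x x)\<^sup>2 * K y y - 2 * K x x * K x y * K x y + (K x y)\<^sup>2 * K x x"
    using x y by (simp add: kernel_repro kernel_integrable)
  also have "\<dots> = K x x * det2 K x y" by (simp add: det2_def power2_eq_square algebra_simps)
  finally show ?thesis using False kernel_diag_nonneg[OF x] by (simp add: zero_le_mult_iff)
qed

lemma det2_bound: obtains c where "c \<ge> 0" "\<And>x y. x \<in> space M \<Longrightarrow> y \<in> space M \<Longrightarrow> \<bar>det2 K x y\<bar> \<le> c"
proof -
  obtain c where c: "c \<ge> 0" "\<And>x y. x \<in> space M \<Longrightarrow> y \<in> space M \<Longrightarrow> \<bar>K x y\<bar> \<le> c"
    using kernel_bound by blast
  have "\<bar>det2 K x y\<bar> \<le> c * c" if "x \<in> space M" "y \<in> space M" for x y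
  proof -
    have "det2 K x y \<le> K x x * K y y" by (simp add: det2_def)
    also have "\<dots> \<le> c * c" using c(1) c(2)[of x x] c(2)[of y y] that kernel_diag_nonneg
      by (intro mult_mono) auto
    finally show ?thesis using det2_nonneg[OF that] by simp
  qed
  then show ?thesis using that[of "c * c"] c(1) by simp
qed

lemma det2_measurable:
  assumes "f \<in> measurable L M" "g \<in> measurable L M"
  shows "(\<lambda>z. det2 K (f z) (g z)) \<in> borel_measurable L"
  unfolding det2_def using assms
  by (intro borel_measurable_diff borel_measurable_times borel_measurable_power kernel_measurable)

lemma det3_measurable:
  assumes "f \<in> measurable L M" "g \<in> measurable L M" "h \<in> measurable L M"
  shows "(\<lambda>z. det3 K (f z) (g z) (h z)) \<in> borel_measurable L"
  unfolding det3_def using assms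
  by (intro borel_measurable_diff borel_measurable_add borel_measurable_times borel_measurable_power
      kernel_measurable det2_measurable borel_measurable_const)

lemma det2_sym: "x \<in> space M \<Longrightarrow> y \<in> space M \<Longrightarrow> det2 K x y = det2 K y x"
  by (simp add: det2_def kernel_sym mult.commute)

text \<open>Consistency of the correlation functions: integrating one point out of a determinant of
  order k + 1 leaves N - k times the determinant of order k. The induction on the number of points
  needs only k = 1 and, next, k = 2.\<close>

lemma integral_det2:
  assumes x: "x \<in> space M"
  shows "(\<integral>a. det2 K a x \<partial>M) = (N - 1) * K x x"
proof -
  note i = kernel_diag_integrable
  have "(\<integral>a. det2 K a x \<partial>M) = (\<integral>a. K a a * K x x - K x a * K x a \<partial>M)"
    by (rule Bochner_Integration.integral_cong) (use x kernel_sym in \<open>auto simp: det2_def power2_eq_square\<close>)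
  also have "\<dots> = N * K x x - K x x"
    using x i K by (simp add: kernel_integrable kernel_repro reproducing_kernel_def)
  finally show ?thesis by (simp add: algebra_simps)
qed

lemma integral_det3:
  assumes x: "x \<in> space M" and y: "y \<in> space M"
  shows "(\<integral>a. det3 K a x y \<partial>M) = (N - 2) * det2 K x y"
proof -
  note i = kernel_diag_integrable
  have "(\<integral>a. det3 K a x y \<partial>M) = (\<integral>a. K a a * det2 K x y - K x a * K x a * K y y - K y a * K y a * K x x
      + K x a * K y a * (2 * K x y) \<partial>M)"
    by (rule Bochner_Integration.integral_cong)
       (use x y kernel_sym in \<open>auto simp: det3_def power2_eq_square\<close>)
  also have "\<dots> = N * det2 K x y - K x x * K y y - K y y * K x x + K x y * (2 * K x y)"
    using x y i K by (simp add: kernel_integrable kernel_repro reproducing_kernel_def)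
  finally show ?thesis by (simp add: algebra_simps det2_def power2_eq_square)
qed

text \<open>The determinant identity for Schur complements. Multiplying by \<open>K a a\<close>
  instead of dividing keeps the formulas meaningful where the density vanishes.\<close>

lemma condition_kernel_det2:
  assumes "a \<in> space M" "x \<in> space M" "y \<in> space M" "K a a \<noteq> 0"
  shows "K a a * det2 (condition_kernel K a) x y = det3 K a x y"
  using assms(4) kernel_sym[OF assms(2,1)] kernel_sym[OF assms(3,1)] kernel_sym[OF assms(2,3)]
  by (simp add: det2_def det3_def condition_kernel_def field_simps power2_eq_square)

lemma condition_kernel_diag:
  assumes "a \<in> space M" "x \<in> space M" "K a a \<noteq> 0"
  shows "K a a * condition_kernel K a x x = det2 K a x"
  using assms(3) kernel_sym[OF assms(2,1)]
  by (simp add: det2_def condition_kernel_def field_simps power2_eq_square)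

lemma reproducing_condition_kernel:
  assumes a: "a \<in> space M" and nz: "K a a \<noteq> 0"
  shows "reproducing_kernel M (condition_kernel K a) (N - 1)"
  unfolding reproducing_kernel_def
proof (intro conjI ballI)
  show "(\<lambda>(x, y). condition_kernel K a x y) \<in> borel_measurable (M \<Otimes>\<^sub>M M)"
    unfolding condition_kernel_def case_prod_beta using a
    by (intro borel_measurable_diff borel_measurable_times borel_measurable_divide kernel_measurable) auto
  obtain c where c: "c \<ge> 0" "\<And>x y. x \<in> space M \<Longrightarrow> y \<in> space M \<Longrightarrow> \<bar>K x y\<bar> \<le> c"
    using kernel_bound by blast
  show "\<exists>c. \<forall>x\<in>space M. \<forall>y\<in>space M. \<bar>condition_kernel K a x y\<bar> \<le> c"
  proof (intro exI ballI)
    fix x y assume xy: "x \<in> space M" "y \<in> space M"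
    have "\<bar>condition_kernel K a x y\<bar> \<le> \<bar>K x y\<bar> + \<bar>K x a\<bar> * \<bar>K a y\<bar> / \<bar>K a a\<bar>"
      unfolding condition_kernel_def by (simp flip: abs_mult abs_divide)
    also have "\<dots> \<le> c + c * c / \<bar>K a a\<bar>"
      using xy a c nz by (intro add_mono divide_right_mono mult_mono) auto
    finally show "\<bar>condition_kernel K a x y\<bar> \<le> c + c * c / \<bar>K a a\<bar>" .
  qed
  show "condition_kernel K a x y = condition_kernel K a y x" if "x \<in> space M" "y \<in> space M" for x y
    using that a by (simp add: condition_kernel_def kernel_sym)
  show "(\<integral>w. condition_kernel K a x w * condition_kernel K a w y \<partial>M) = condition_kernel K a x y"
    if x: "x \<in> space M" and y: "y \<in> space M" for x y
  proof -
    have "(\<integral>w. condition_kernel K a x w * condition_kernel K a w y \<partial>M) =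
        (\<integral>w. K x w * K y w - K a w * K y w * (K x a / K a a) - K x w * K a w * (K a y / K a a)
          + K a w * K a w * (K x a * K a y / (K a a)\<^sup>2) \<partial>M)"
      by (rule Bochner_Integration.integral_cong)
         (use x y a nz kernel_sym in \<open>auto simp: condition_kernel_def field_simps power2_eq_square\<close>)
    also have "\<dots> = K x y - K a y * (K x a / K a a) - K x a * (K a y / K a a) + K a a * (K x a
        * K a y / (K a a)\<^sup>2)"
      using x y a by (simp add: kernel_integrable kernel_repro)
    also have "\<dots> = condition_kernel K a x y"
      using nz by (simp add: condition_kernel_def field_simps power2_eq_square)
    finally show ?thesis .
  qed
  have "K a a * (\<integral>x. condition_kernel K a x x \<partial>M) = (\<integral>x. det2 K x a \<partial>M)"
    unfolding integral_mult_right_zero[symmetric]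
    by (rule Bochner_Integration.integral_cong) (use a nz in \<open>auto simp: condition_kernel_diag det2_sym\<close>)
  then show "(\<integral>x. condition_kernel K a x x \<partial>M) = N - 1"
    using integral_det2[OF a] nz by simp
qed

end

end

text \<open>The points are chosen one by one: given the first point, the remaining ones form a determinantal
  process for the conditioned kernel, so that averaging over the first point reproduces the two-point
  intensities. This avoids determinants of size N.\<close>

theorem (in prob_space) determinantal_energy_bound:
  fixes W :: "'a \<Rightarrow> 'a \<Rightarrow> real"
  assumes W [measurable]: "(\<lambda>(x, y). W x y) \<in> borel_measurable (M \<Otimes>\<^sub>M M)"
    and W_nonneg: "\<And>x y. W x y \<ge> 0" and W_le: "\<And>x y. W x y \<le> C"
    and W_sym: "\<And>x y. W x y = W y x"
  shows "reproducing_kernel M K (real N) \<Longrightarrow> V \<in> borel_measurable M \<Longrightarrow> (\<And>x. 0 \<le> V x) \<Longrightarrow> (\<And>x. V x \<le> D) \<Longrightarrow>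
    \<exists>p. (\<forall>i<N. p i \<in> space M) \<and>
      (\<Sum>i<N. V (p i)) + (\<Sum>i<N. \<Sum>j\<in>{..<N} - {i}. W (p i) (p j)) \<le>
      (\<integral>x. V x * K x x \<partial>M) + (\<integral>z. W (fst z) (snd z) * det2 K (fst z) (snd z) \<partial>(M \<Otimes>\<^sub>M M))"
proof (induction N arbitrary: K V D)
  case 0
  have "0 \<le> (\<integral>x. V x * K x x \<partial>M)"
    by (intro integral_nonneg_AE AE_I2 mult_nonneg_nonneg 0 kernel_diag_nonneg[OF 0(1)])
  moreover have "0 \<le> (\<integral>z. W (fst z) (snd z) * det2 K (fst z) (snd z) \<partial>(M \<Otimes>\<^sub>M M))"
    by (intro integral_nonneg_AE AE_I2 mult_nonneg_nonneg W_nonneg det2_nonneg[OF 0(1)]) (auto simp: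
        space_pair_measure)
  ultimately show ?case by simp
next
  case (Suc N)
  note K = Suc.prems(1)
  note [measurable] = Suc.prems(2)
  interpret P: pair_prob_space M M ..
  interpret Q: pair_prob_space M "M \<Otimes>\<^sub>M M" ..
  note [measurable (raw)] = kernel_measurable[OF K] det2_measurable[OF K] det3_measurable[OF K]
      measurable_case_prod_compose[OF W]
  obtain c where c: "c \<ge> 0" "\<And>x y. x \<in> space M \<Longrightarrow> y \<in> space M \<Longrightarrow> \<bar>K x y\<bar> \<le> c"
    using kernel_bound[OF K] by blast
  obtain d where d: "d \<ge> 0" "\<And>x y. x \<in> space M \<Longrightarrow> y \<in> space M \<Longrightarrow> \<bar>det2 K x y\<bar> \<le> d"
    using det2_bound[OF K] by blast
  have C0: "C \<ge> 0" and D0: "D \<ge> 0" using W_nonneg[of undefined undefined] W_le[of undefined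
      undefined] Suc.prems(3,4)[of undefined] by linarith+
  define R where "R = (\<integral>x. V x * K x x \<partial>M) + (\<integral>z. W (fst z) (snd z) * det2 K (fst z) (snd z) \<partial>(M \<Otimes>\<^sub>M M))"
  \<comment> \<open>The interaction with the chosen point \<open>a\<close> becomes part of the
    external potential of the remaining points. The factor 2 is there because the energy counts
    ordered pairs.\<close>
  define V' where "V' a x = V x + 2 * W a x" for a x
  \<comment> \<open>This is \<open>K a a\<close> times the mean total energy once \<open>a\<close>
    is chosen, written with \<open>det2\<close> and \<open>det3\<close> so that nothing is divided
    by \<open>K a a\<close>.\<close>
  define \<Phi> where "\<Phi> a = K a a * V a + (\<integral>x. V' a x * det2 K a x \<partial>M)
     + (\<integral>z. W (fst z) (snd z) * det3 K a (fst z) (snd z) \<partial>(M \<Otimes>\<^sub>M M))" for a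
  have det3_bound: "\<bar>det3 K a x y\<bar> \<le> c * d + 4 * c^3" if "a \<in> space M" "x \<in> space M" "y \<in> space M" for a x y
  proof -
    have "\<bar>K a a * det2 K x y\<bar> \<le> c * d" unfolding abs_mult using that c d by (intro mult_mono) auto
    moreover have "\<bar>K p q * K r s * K t u\<bar> \<le> c * c * c"
      if "p \<in> space M" "q \<in> space M" "r \<in> space M" "s \<in> space M" "t \<in> space M" "u \<in> space M" for p q r s t u
      unfolding abs_mult using that c by (intro mult_mono) auto
    then have "\<bar>K a x * K a x * K y y\<bar> \<le> c * c * c" "\<bar>K a y * K a y * K x x\<bar> \<le> c * c * c" "\<bar>K a x
        * K x y * K a y\<bar> \<le> c * c * c"
      using that by auto
    moreover have "det3 K a x y = K a a * det2 K x y - K a x * K a x * K y y - K a y * K a y * K x x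
        + 2 * (K a x * K x y * K a y)"
      "c * d + 4 * c ^ 3 = c * d + 4 * (c * c * c)"
      by (simp_all add: det3_def power2_eq_square power3_eq_cube)
    ultimately show ?thesis by linarith
  qed
  have I1: "integrable M (\<lambda>a. K a a * V a)"
  proof (rule integrable_bounded[of _ "c * D"])
    show "\<bar>K a a * V a\<bar> \<le> c * D" if "a \<in> space M" for a unfolding abs_mult
      using c that Suc.prems(3,4) by (intro mult_mono) auto
  qed measurable
  have I2: "integrable (M \<Otimes>\<^sub>M M) (\<lambda>z. V (snd z) * det2 K (fst z) (snd z))"
  proof (rule P.P.integrable_bounded[of _ "D * d"])
    show "\<bar>V (snd z) * det2 K (fst z) (snd z)\<bar> \<le> D * d" if "z \<in> space (M \<Otimes>\<^sub>M M)" for z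
      unfolding abs_mult using d that Suc.prems(3,4) D0 by (intro mult_mono) (auto simp: space_pair_measure)
  qed measurable
  have I3: "integrable (M \<Otimes>\<^sub>M M) (\<lambda>z. W (fst z) (snd z) * det2 K (fst z) (snd z))"
  proof (rule P.P.integrable_bounded[of _ "C * d"])
    show "\<bar>W (fst z) (snd z) * det2 K (fst z) (snd z)\<bar> \<le> C * d" if "z \<in> space (M \<Otimes>\<^sub>M M)" for z
      unfolding abs_mult using d that W_nonneg W_le C0 by (intro mult_mono) (auto simp: space_pair_measure)
  qed measurable
  have I4: "integrable (M \<Otimes>\<^sub>M (M \<Otimes>\<^sub>M M)) (\<lambda>z. W (fst (snd z)) (snd (snd z))
      * det3 K (fst z) (fst (snd z)) (snd (snd z)))"
  proof (rule Q.P.integrable_bounded[of _ "C * (c * d + 4 * c^3)"])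
    show "\<bar>W (fst (snd z)) (snd (snd z)) * det3 K (fst z) (fst (snd z)) (snd (snd z))\<bar> \<le> C * (c * d
        + 4 * c^3)"
      if "z \<in> space (M \<Otimes>\<^sub>M (M \<Otimes>\<^sub>M M))" for z
      unfolding abs_mult using c d that W_nonneg W_le C0 det3_bound
          by (intro mult_mono) (auto simp: space_pair_measure)
  qed measurable
  have I23: "integrable (M \<Otimes>\<^sub>M M) (\<lambda>z. V' (fst z) (snd z) * det2 K (fst z) (snd z))"
    using Bochner_Integration.integrable_add[OF I2 integrable_mult_right[OF I3, of 2]]
        by (simp add: V'_def algebra_simps)
  have J23: "integrable M (\<lambda>a. \<integral>x. V' a x * det2 K a x \<partial>M)"
    using P.integrable_fst'[OF I23] by simp
  have J4: "integrable M (\<lambda>a. \<integral>z. W (fst z) (snd z) * det3 K a (fst z) (snd z) \<partial>(M \<Otimes>\<^sub>M M))"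
    using Q.integrable_fst'[OF I4] by simp
  have \<Phi>_int: "integrable M \<Phi>" unfolding \<Phi>_def by (intro Bochner_Integration.integrable_add I1 J23 J4)
  have E2: "(\<integral>a. (\<integral>x. V' a x * det2 K a x \<partial>M) \<partial>M) = real N * (\<integral>x. V x * K x x \<partial>M)
       + 2 * (\<integral>z. W (fst z) (snd z) * det2 K (fst z) (snd z) \<partial>(M \<Otimes>\<^sub>M M))"
  proof -
    have "(\<integral>a. (\<integral>x. V' a x * det2 K a x \<partial>M) \<partial>M) = (\<integral>z. V' (fst z) (snd z)
        * det2 K (fst z) (snd z) \<partial>(M \<Otimes>\<^sub>M M))"
      using P.integral_fst'[OF I23] by simp
    also have "\<dots> = (\<integral>z. V (snd z) * det2 K (fst z) (snd z) + 2 * (W (fst z) (snd z)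
        * det2 K (fst z) (snd z)) \<partial>(M \<Otimes>\<^sub>M M))"
      by (simp add: V'_def algebra_simps)
    also have "\<dots> = (\<integral>z. V (snd z) * det2 K (fst z) (snd z) \<partial>(M \<Otimes>\<^sub>M M)) + 2 * (\<integral>z. W (fst z) (snd z)
        * det2 K (fst z) (snd z) \<partial>(M \<Otimes>\<^sub>M M))"
      using I2 I3 by simp
    also have "(\<integral>z. V (snd z) * det2 K (fst z) (snd z) \<partial>(M \<Otimes>\<^sub>M M)) = (\<integral>x. (\<integral>a. V x * det2 K a x \<partial>M) \<partial>M)"
      using P.integral_snd[of "\<lambda>a x. V x * det2 K a x"] I2 by (simp add: case_prod_beta')
    also have "\<dots> = (\<integral>x. real N * (V x * K x x) \<partial>M)"
      by (rule Bochner_Integration.integral_cong) (auto simp: integral_det2[OF K])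
    also have "\<dots> = real N * (\<integral>x. V x * K x x \<partial>M)" by simp
    finally show ?thesis .
  qed
  have E3: "(\<integral>a. (\<integral>z. W (fst z) (snd z) * det3 K a (fst z) (snd z) \<partial>(M \<Otimes>\<^sub>M M)) \<partial>M)
     = (real N - 1) * (\<integral>z. W (fst z) (snd z) * det2 K (fst z) (snd z) \<partial>(M \<Otimes>\<^sub>M M))"
  proof -
    have "(\<integral>a. (\<integral>z. W (fst z) (snd z) * det3 K a (fst z) (snd z) \<partial>(M \<Otimes>\<^sub>M M)) \<partial>M)
      = (\<integral>z. (\<integral>a. W (fst z) (snd z) * det3 K a (fst z) (snd z) \<partial>M) \<partial>(M \<Otimes>\<^sub>M M))"
      using Q.Fubini_integral[of "\<lambda>a z. W (fst z) (snd z) * det3 K a (fst z) (snd z)"] I4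
          by (simp add: case_prod_beta')
    also have "\<dots> = (\<integral>z. (real N - 1) * (W (fst z) (snd z) * det2 K (fst z) (snd z)) \<partial>(M \<Otimes>\<^sub>M M))"
      by (rule Bochner_Integration.integral_cong) (auto simp: integral_det3[OF K] space_pair_measure)
    finally show ?thesis by simp
  qed
  \<comment> \<open>The potential term is counted 1 + N times and the interaction term 2 + (N - 1)
    times, so both carry the same factor N + 1.\<close>
  have avg: "(\<integral>a. \<Phi> a \<partial>M) = real (Suc N) * R"
    unfolding \<Phi>_def using I1 J23 J4 by (simp add: E2 E3 R_def algebra_simps)
  have trace: "(\<integral>a. K a a \<partial>M) = real (Suc N)" using K unfolding reproducing_kernel_def by simp
  have IK: "integrable M (\<lambda>a. K a a)" by (rule kernel_diag_integrable[OF K])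
  \<comment> \<open>The functions \<Phi> and \<open>K a a * R\<close> have equal integrals and both
    vanish where \<open>K a a\<close> does. If \<Phi> were larger at all other points,
    \<open>K a a\<close> would be zero almost everywhere, against its integral N + 1.\<close>
  have "\<exists>a\<in>space M. K a a \<noteq> 0 \<and> \<Phi> a \<le> K a a * R"
  proof (rule ccontr)
    assume "\<not> ?thesis"
    then have gt: "\<Phi> a > K a a * R" if "a \<in> space M" "K a a \<noteq> 0" for a using that by force
    have zero: "\<Phi> a = 0" if "a \<in> space M" "K a a = 0" for a
    proof -
      have k0: "K a x = 0" if "x \<in> space M" for x using kernel_diag_zero[OF K] that \<open>a
          \<in> space M\<close> \<open>K a a = 0\<close> by blast
      have "(\<integral>x. V' a x * det2 K a x \<partial>M) = (\<integral>x. 0 \<partial>M)"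
        by (rule Bochner_Integration.integral_cong) (auto simp: det2_def k0 that)
      moreover have "(\<integral>z. W (fst z) (snd z) * det3 K a (fst z) (snd z) \<partial>(M \<Otimes>\<^sub>M M)) = (\<integral>z. 0 \<partial>(M \<Otimes>\<^sub>M M))"
        by (rule Bochner_Integration.integral_cong) (auto simp: det3_def k0 that space_pair_measure)
      ultimately show ?thesis by (simp add: \<Phi>_def that)
    qed
    have nn: "\<Phi> a - K a a * R \<ge> 0" if "a \<in> space M" for a
      using gt[OF that] zero[OF that] by (cases "K a a = 0") auto
    have "(\<integral>a. \<Phi> a - K a a * R \<partial>M) = 0"
      using avg trace IK \<Phi>_int by simp
    then have "AE a in M. \<Phi> a - K a a * R = 0"
      by (subst (asm) integral_nonneg_eq_0_iff_AE) (use nn IK \<Phi>_int in auto)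
    then have "AE a in M. K a a = 0" using AE_space
      by eventually_elim (use gt in force)
    then have "(\<integral>a. K a a \<partial>M) = (\<integral>a. 0 \<partial>M)" by (intro integral_cong_AE) (use IK in auto)
    then show False using trace by simp
  qed
  then obtain a where a: "a \<in> space M" "K a a \<noteq> 0" "\<Phi> a \<le> K a a * R" by blast
  have Kpos: "K a a > 0" using a kernel_diag_nonneg[OF K a(1)] by simp
  have "\<exists>p. (\<forall>i<N. p i \<in> space M) \<and>
      (\<Sum>i<N. V' a (p i)) + (\<Sum>i<N. \<Sum>j\<in>{..<N} - {i}. W (p i) (p j)) \<le>
      (\<integral>x. V' a x * condition_kernel K a x x \<partial>M)
      + (\<integral>z. W (fst z) (snd z) * det2 (condition_kernel K a) (fst z) (snd z) \<partial>(M \<Otimes>\<^sub>M M))"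
  proof (rule Suc.IH)
    show "reproducing_kernel M (condition_kernel K a) (real N)"
      using reproducing_condition_kernel[OF K a(1,2)] by simp
    show "V' a \<in> borel_measurable M" unfolding V'_def using a(1) by measurable
    show "0 \<le> V' a x" "V' a x \<le> D + 2 * C" for x
      using Suc.prems(3,4)[of x] W_nonneg[of a x] W_le[of a x] by (auto simp: V'_def)
  qed
  then obtain p where p: "\<forall>i<N. p i \<in> space M"
    and le: "(\<Sum>i<N. V' a (p i)) + (\<Sum>i<N. \<Sum>j\<in>{..<N} - {i}. W (p i) (p j)) \<le>
      (\<integral>x. V' a x * condition_kernel K a x x \<partial>M)
      + (\<integral>z. W (fst z) (snd z) * det2 (condition_kernel K a) (fst z) (snd z) \<partial>(M \<Otimes>\<^sub>M M))" by blast
  have e1: "K a a * (\<integral>x. V' a x * condition_kernel K a x x \<partial>M) = (\<integral>x. V' a x * det2 K a x \<partial>M)"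
    unfolding integral_mult_right_zero[symmetric]
    by (rule Bochner_Integration.integral_cong) (auto simp: a simp flip: condition_kernel_diag[OF K
        a(1) _ a(2)])
  have e2: "K a a * (\<integral>z. W (fst z) (snd z) * det2 (condition_kernel K a) (fst z) (snd z) \<partial>(M \<Otimes>\<^sub>M M))
      = (\<integral>z. W (fst z) (snd z) * det3 K a (fst z) (snd z) \<partial>(M \<Otimes>\<^sub>M M))"
    unfolding integral_mult_right_zero[symmetric]
    by (rule Bochner_Integration.integral_cong)
       (auto simp: a space_pair_measure simp flip: condition_kernel_det2[OF K a(1) _ _ a(2)])
  have "K a a * (V a + ((\<Sum>i<N. V' a (p i)) + (\<Sum>i<N. \<Sum>j\<in>{..<N} - {i}. W (p i) (p j)))) \<le> \<Phi> a"
    using mult_left_mono[OF le, of "K a a"] Kpos by (simp add: \<Phi>_def e1 e2 distrib_left)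
  with a(3) have "K a a * (V a + ((\<Sum>i<N. V' a (p i)) + (\<Sum>i<N. \<Sum>j\<in>{..<N} - {i}. W (p i) (p j)))) \<le> K a a * R"
    by linarith
  then have fin: "V a + ((\<Sum>i<N. V' a (p i)) + (\<Sum>i<N. \<Sum>j\<in>{..<N} - {i}. W (p i) (p j))) \<le> R"
    using Kpos by simp
  define q where "q i = (case i of 0 \<Rightarrow> a | Suc k \<Rightarrow> p k)" for i
  have q0: "q 0 = a" and qS: "q (Suc k) = p k" for k by (auto simp: q_def)
  have sumq: "(\<Sum>j\<in>{..<Suc N} - {i}. f j) = (if i = 0 then 0 else f 0) + (\<Sum>j\<in>{..<N} - {k. Suc k
      = i}. f (Suc j))"
    for f :: "nat \<Rightarrow> real" and i
  proof -
    have eq: "{..<Suc N} - {i} = (if i = 0 then {} else {0}) \<union> Suc ` ({..<N} - {k. Suc k = i})"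
      by (auto simp: image_iff less_Suc_eq_0_disj)
    then show ?thesis by (subst eq, subst sum.union_disjoint) (auto simp: sum.reindex)
  qed
  have "(\<Sum>i<Suc N. V (q i)) + (\<Sum>i<Suc N. \<Sum>j\<in>{..<Suc N} - {i}. W (q i) (q j)) =
     V a + (\<Sum>i<N. V (p i)) + (\<Sum>i<N. W a (p i)) + (\<Sum>i<N. W a (p i)) + (\<Sum>i<N. \<Sum>j\<in>{..<N} - {i}. W (p i) (p j))"
    unfolding sumq unfolding sum.lessThan_Suc_shift
    by (simp add: q0 qS sum.distrib W_sym[of _ a] Collect_conv_if)
  also have "\<dots> = V a + ((\<Sum>i<N. V' a (p i)) + (\<Sum>i<N. \<Sum>j\<in>{..<N} - {i}. W (p i) (p j)))"
    by (simp add: V'_def sum.distrib flip: sum_distrib_left)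
  finally have "(\<Sum>i<Suc N. V (q i)) + (\<Sum>i<Suc N. \<Sum>j\<in>{..<Suc N} - {i}. W (q i) (q j)) \<le> R" using fin by simp
  moreover have "\<forall>i<Suc N. q i \<in> space M" using p a by (auto simp: q_def split: nat.split)
  ultimately show ?case unfolding R_def by blast
qed

section \<open>Chordal distance via quaternions\<close>

definition frobenius :: "real ^ 'n ^ 'm \<Rightarrow> real" where
  "frobenius M = trace (transpose M ** M)"

lemma frobenius_mult_orthogonal:
  fixes M :: "real ^ 'n ^ 'n"
  assumes "orthogonal_matrix U" "orthogonal_matrix V"
  shows "frobenius (U ** M ** V) = frobenius M"
proof -
  have "frobenius (U ** M ** V) = trace (transpose V ** (transpose M ** (transpose U ** U) ** M ** V))"
    by (simp add: frobenius_def matrix_transpose_mul matrix_mul_assoc)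
  also have "\<dots> = trace ((transpose M ** (transpose U ** U) ** M ** V) ** transpose V)"
    by (rule trace_mul_sym)
  also have "\<dots> = trace (transpose M ** (transpose U ** U) ** M ** (V ** transpose V))"
    by (simp add: matrix_mul_assoc)
  also have "\<dots> = frobenius M" using assms by (simp add: frobenius_def orthogonal_matrix_def)
  finally show ?thesis .
qed

lemma det_sq_mult_orthogonal:
  fixes M :: "real ^ 'n ^ 'n"
  assumes "orthogonal_matrix U" "orthogonal_matrix V"
  shows "(det (U ** M ** V))\<^sup>2 = (det M)\<^sup>2"
proof -
  have "(det U)\<^sup>2 = 1" "(det V)\<^sup>2 = 1" using det_orthogonal_matrix assms by fastforce+
  then show ?thesis by (simp add: det_mul power_mult_distrib)
qed

text \<open>The squared Frobenius norm and the squared determinant do not change under orthogonal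
  factors, and they are the elementary symmetric functions of the two squared singular values, which
  they therefore determine.\<close>

lemma singular_values_invariants:
  fixes M :: "real ^ 2 ^ 2"
  assumes "singular_values M (vector [a, b])"
  shows "frobenius M = a\<^sup>2 + b\<^sup>2" "(det M)\<^sup>2 = a\<^sup>2 * b\<^sup>2" "a \<ge> 0" "b \<ge> 0"
proof -
  obtain U V where UV: "orthogonal_matrix U" "orthogonal_matrix V" "M
      = U ** diag_mat (vector [a, b]) ** transpose V"
    using assms unfolding singular_values_def by blast
  have V: "orthogonal_matrix (transpose V)" using UV by (simp add: orthogonal_matrix_transpose)
  show "frobenius M = a\<^sup>2 + b\<^sup>2"
    unfolding UV(3) frobenius_mult_orthogonal[OF UV(1) V]
    by (simp add: frobenius_def trace_def sum_2 matrix_matrix_mult_def transpose_def diag_mat_def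
        power2_eq_square)
  show "(det M)\<^sup>2 = a\<^sup>2 * b\<^sup>2"
    unfolding UV(3) det_sq_mult_orthogonal[OF UV(1) V]
    by (simp add: det_2 diag_mat_def power_mult_distrib)
  show "a \<ge> 0" "b \<ge> 0" using assms unfolding singular_values_def by (auto simp: forall_2)
qed

definition rot2 :: "real \<Rightarrow> real ^ 2 ^ 2" where
  "rot2 t = vector [vector [cos t, - sin t], vector [sin t, cos t]]"

lemma orthogonal_rot2: "orthogonal_matrix (rot2 t)"
  unfolding orthogonal_matrix
  by (simp add: rot2_def vec_eq_iff forall_2 matrix_matrix_mult_def transpose_def sum_2 mat_def
      flip: power2_eq_square)

text \<open>Identify \<open>\<real>\<^sup>2\<close> with the complex numbers: a real matrix acts as \<open>z \<mapsto> \<alpha> z + \<beta> cnj z\<close>,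
  and its singular values are \<open>\<bar>\<alpha>\<bar> + \<bar>\<beta>\<bar>\<close> and \<open>\<bar>\<bar>\<alpha>\<bar> - \<bar>\<beta>\<bar>\<bar>\<close>.\<close>

lemma singular_values_exist:
  fixes M :: "real ^ 2 ^ 2"
  obtains a b where "a \<ge> b" "singular_values M (vector [a, b])"
proof -
  define \<alpha> where "\<alpha> = Complex ((M$1$1 + M$2$2) / 2) ((M$2$1 - M$1$2) / 2)"
  define \<beta> where "\<beta> = Complex ((M$1$1 - M$2$2) / 2) ((M$2$1 + M$1$2) / 2)"
  define p q where "p = Arg \<alpha>" and "q = Arg \<beta>"
  define \<mu> \<nu> where "\<mu> = (p + q) / 2" and "\<nu> = (p - q) / 2"
  define s1 s2 where "s1 = cmod \<alpha> + cmod \<beta>" and "s2 = cmod \<alpha> - cmod \<beta>"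
  \<comment> \<open>The entry \<bar>\<alpha>\<bar> - \<bar>\<beta>\<bar> may be negative; its sign
    is moved into the orthogonal factor \<open>D\<close>.\<close>
  define d where "d = (if s2 \<ge> 0 then 1 else - 1 :: real)"
  define D :: "real ^ 2 ^ 2" where "D = diag_mat (vector [1, d])"
  have dd: "d * d = 1" "d * \<bar>s2\<bar> = s2" by (auto simp: d_def)
  have D: "orthogonal_matrix D"
    unfolding orthogonal_matrix D_def using dd
    by (simp add: vec_eq_iff forall_2 matrix_matrix_mult_def transpose_def sum_2 mat_def diag_mat_def)
  have p: "p = \<mu> + \<nu>" and q: "q = \<mu> - \<nu>" by (simp_all add: \<mu>_def \<nu>_def field_simps)
  have "Re \<alpha> = cmod \<alpha> * cos p" "Im \<alpha> = cmod \<alpha> * sin p" "Re \<beta> = cmod \<beta> * cos q" "Im \<beta> = cmod \<beta> * sin q"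
    using rcis_cmod_Arg[of \<alpha>] rcis_cmod_Arg[of \<beta>] by (metis Re_rcis Im_rcis p_def q_def)+
  then have e: "M$1$1 + M$2$2 = (s1 + s2) * cos p" "M$2$1 - M$1$2 = (s1 + s2) * sin p"
     "M$1$1 - M$2$2 = (s1 - s2) * cos q" "M$2$1 + M$1$2 = (s1 - s2) * sin q"
    by (simp_all add: \<alpha>_def \<beta>_def s1_def s2_def)
  have m: "M$1$1 = cos \<mu> * s1 * cos \<nu> - sin \<mu> * s2 * sin \<nu>"
      "M$1$2 = - cos \<mu> * s1 * sin \<nu> - sin \<mu> * s2 * cos \<nu>"
      "M$2$1 = sin \<mu> * s1 * cos \<nu> + cos \<mu> * s2 * sin \<nu>"
      "M$2$2 = - sin \<mu> * s1 * sin \<nu> + cos \<mu> * s2 * cos \<nu>"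
    using e unfolding p q cos_add cos_diff sin_add sin_diff by (simp_all add: algebra_simps)
  have "M = rot2 \<mu> ** diag_mat (vector [s1, \<bar>s2\<bar>]) ** (D ** rot2 \<nu>)"
    using dd(2)
    by (simp add: vec_eq_iff forall_2 matrix_matrix_mult_def sum_2 diag_mat_def D_def rot2_def m mult.assoc)
       (simp add: mult.assoc[symmetric] mult.commute[of "\<bar>s2\<bar>" d])
  then have "M = rot2 \<mu> ** diag_mat (vector [s1, \<bar>s2\<bar>]) ** transpose (transpose (D ** rot2 \<nu>))" by simp
  moreover have "orthogonal_matrix (transpose (D ** rot2 \<nu>))"
    by (simp add: orthogonal_matrix_transpose orthogonal_matrix_mul D orthogonal_rot2)
  ultimately have "singular_values M (vector [s1, \<bar>s2\<bar>])"
    unfolding singular_values_def using orthogonal_rot2[of \<mu>]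
    by (intro conjI exI[of _ "rot2 \<mu>"] exI[of _ "transpose (D ** rot2 \<nu>)"]) (simp_all add: forall_2 s1_def)
  moreover have "s1 \<ge> \<bar>s2\<bar>" by (simp add: s1_def s2_def abs_if)
  ultimately show ?thesis using that by blast
qed

section \<open>Orthonormal frames and principal angles\<close>

lemma matrix_vector_adjoint: "(A *v x) \<bullet> y = x \<bullet> (transpose A *v y)" for A :: "real ^ 'n ^ 'm"
  by (metis dot_lmul_matrix inner_commute transpose_matrix_vector)

lemma orthonormal_columns_norm:
  fixes B :: "real ^ 'n ^ 'm"
  assumes "transpose B ** B = mat 1" shows "norm (B *v x) = norm x"
proof -
  have "(B *v x) \<bullet> (B *v x) = x \<bullet> x"
    by (simp only: matrix_vector_adjoint matrix_vector_mul_assoc assms matrix_vector_mul_lid)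
  then show ?thesis by (simp add: norm_eq)
qed

lemma orthonormal_columns_transpose_norm:
  fixes A :: "real ^ 'n ^ 'm"
  assumes "transpose A ** A = mat 1" shows "norm (transpose A *v y) \<le> norm y"
proof -
  have "(norm (transpose A *v y))\<^sup>2 = (A *v (transpose A *v y)) \<bullet> y"
    by (simp only: matrix_vector_adjoint power2_norm_eq_inner)
  also have "\<dots> \<le> norm (A *v (transpose A *v y)) * norm y" by (rule norm_cauchy_schwarz)
  also have "\<dots> = norm (transpose A *v y) * norm y" by (simp only: orthonormal_columns_norm[OF assms])
  finally have "norm (transpose A *v y) * norm (transpose A *v y) \<le> norm (transpose A *v y) * norm y"
    by (simp only: power2_eq_square)
  then show ?thesis
    by (cases "norm (transpose A *v y) = 0") (auto simp del: transpose_matrix_vector dest: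
        mult_left_le_imp_le)
qed

lemma singular_values_le_1:
  fixes M :: "real ^ 2 ^ 2"
  assumes sv: "singular_values M (vector [a, b])" and M: "\<And>x. norm (M *v x) \<le> norm x"
  shows "a \<le> 1" "b \<le> 1"
proof -
  obtain U V where UV: "orthogonal_matrix U" "orthogonal_matrix V" "M
      = U ** diag_mat (vector [a, b]) ** transpose V"
    using sv unfolding singular_values_def by blast
  have "norm (diag_mat (vector [a, b]) *v x) \<le> norm x" for x :: "real ^ 2"
  proof -
    have "transpose V *v (V *v x) = x"
      using UV(2) by (simp add: matrix_vector_mul_assoc orthogonal_matrix_def)
    then have "M *v (V *v x) = U *v (diag_mat (vector [a, b]) *v x)"
      unfolding UV(3) by (simp flip: matrix_vector_mul_assoc)
    then show ?thesis
      using M[of "V *v x"] UV(1,2) by (simp add: orthonormal_columns_norm orthogonal_matrix)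
  qed
  from this[of "axis 1 1"] this[of "axis 2 1"] show "a \<le> 1" "b \<le> 1"
    by (simp_all add: diag_mat_def matrix_vector_mult_def norm_vec_def L2_set_def sum_2 axis_def)
qed

text \<open>\<open>A ** transpose A\<close> is the orthogonal projection onto \<open>P\<close> and
  so fixes the columns of any other frame of \<open>P\<close>. This makes principal angles
  independent of the frames.\<close>

lemma orthonormal_frame_change:
  assumes "orthonormal_frame A P" "orthonormal_frame A' P"
  shows "orthogonal_matrix (transpose A ** A')" "A' = A ** (transpose A ** A')"
proof -
  have A: "transpose A ** A = mat 1" "span (columns A) = P" and A': "transpose A' ** A'
      = mat 1" "span (columns A') = P"
    using assms by (auto simp: orthonormal_frame_def)
  have col: "column j N = N *v axis j 1" for j and N :: "real ^ 2 ^ 4"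
    by (simp add: matrix_vector_mul_component column_def vec_eq_iff inner_axis row_def)
  have "span (columns A) \<subseteq> {y. A *v (transpose A *v y) = y}"
  proof (rule span_minimal)
    show "columns A \<subseteq> {y. A *v (transpose A *v y) = y}"
    proof
      fix x assume "x \<in> columns A"
      then obtain j where "x = A *v axis j 1" by (auto simp: columns_def col)
      then have "A *v (transpose A *v x) = (A ** (transpose A ** A)) *v axis j 1"
        by (simp only: matrix_vector_mul_assoc matrix_mul_assoc)
      then show "x \<in> {y. A *v (transpose A *v y) = y}" using A \<open>x = _\<close> by simp
    qed
    show "subspace {y. A *v (transpose A *v y) = y}"
      unfolding subspace_def by (simp add: matrix_vector_right_distrib matrix_vector_mult_scaleR
          del: transpose_matrix_vector)
  qed
  then have fixA: "A *v (transpose A *v y) = y" if "y \<in> span (columns A)" for y using that by blast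
  have "A ** (transpose A ** A') = A'"
  proof (rule matrix_eq[THEN iffD2], rule allI)
    fix x
    have "A' *v x \<in> span (columns A')" by (rule matrix_vector_mult_in_columnspace)
    then have "A *v (transpose A *v (A' *v x)) = A' *v x" by (intro fixA) (simp add: A A')
    then show "(A ** (transpose A ** A')) *v x = A' *v x"
        by (simp add: matrix_vector_mul_assoc matrix_mul_assoc)
  qed
  then show *: "A' = A ** (transpose A ** A')" by simp
  have "transpose (transpose A ** A') ** (transpose A ** A') = transpose A' ** (A ** (transpose A ** A'))"
    by (simp add: matrix_transpose_mul matrix_mul_assoc)
  then show "orthogonal_matrix (transpose A ** A')"
    unfolding orthogonal_matrix using * A' by simp
qed

lemma sum_prod_unique:
  fixes x y x' y' :: real
  assumes "x + y = x' + y'" "x * y = x' * y'" "x \<ge> y" "x' \<ge> y'"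
  shows "x = x' \<and> y = y'"
proof -
  have "(x - x') * (x - y') = 0" using assms by (simp add: algebra_simps) (metis add.commute distrib_left)
  then show ?thesis using assms by auto
qed

text \<open>Two sines squared are 2 minus two cosines squared, and the latter add up to a Frobenius
  norm. The main work is the definite description in \<open>principal_angles\<close>: existence
  comes from a singular value decomposition, uniqueness from the invariants and the
  ordering.\<close>

theorem chordal_dist_frobenius:
  assumes A: "orthonormal_frame A P" and B: "orthonormal_frame B Q"
  shows "chordal_dist P Q = sqrt (2 - frobenius (transpose A ** B))"
proof -
  let ?M = "transpose A ** B"
  obtain a b where ab: "a \<ge> b" "singular_values ?M (vector [a, b])" by (rule singular_values_exist)
  have AA: "transpose A ** A = mat 1" "transpose B ** B = mat 1" using A B
      by (auto simp: orthonormal_frame_def)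
  have contr: "norm (?M *v x) \<le> norm x" for x
    using orthonormal_columns_transpose_norm[OF AA(1), of "B *v x"] orthonormal_columns_norm[OF AA(2), of x]
    by (simp add: matrix_vector_mul_assoc)
  note inv = singular_values_invariants[OF ab(2)]
  note le1 = singular_values_le_1[OF ab(2) contr]
  have "principal_angles P Q = (arccos a, arccos b)"
    unfolding principal_angles_def
  proof (rule the_equality)
    have "singular_values ?M (vector [cos (arccos a), cos (arccos b)])"
      using ab inv le1 by simp
    then show "case (arccos a, arccos b) of (\<theta>\<^sub>1, \<theta>\<^sub>2) \<Rightarrow> 0 \<le> \<theta>\<^sub>1 \<and> \<theta>\<^sub>1 \<le> \<theta>\<^sub>2 \<and> \<theta>\<^sub>2 \<le> pi / 2 \<and>
     (\<exists>A B. orthonormal_frame A P \<and> orthonormal_frame B Q \<and>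
        singular_values (transpose A ** B) (vector [cos \<theta>\<^sub>1, cos \<theta>\<^sub>2]))"
      using A B ab inv le1 arccos_le_pi2[of b] by (auto simp: arccos_lbound arccos_le_mono)
  next
    fix \<theta> assume "case \<theta> of (\<theta>\<^sub>1, \<theta>\<^sub>2) \<Rightarrow> 0 \<le> \<theta>\<^sub>1 \<and> \<theta>\<^sub>1 \<le> \<theta>\<^sub>2 \<and> \<theta>\<^sub>2 \<le> pi / 2 \<and>
     (\<exists>A B. orthonormal_frame A P \<and> orthonormal_frame B Q \<and>
        singular_values (transpose A ** B) (vector [cos \<theta>\<^sub>1, cos \<theta>\<^sub>2]))"
    then obtain t u A' B' where \<theta>: "\<theta> = (t, u)" and tu: "0 \<le> t" "t \<le> u" "u \<le> pi / 2"
      and A': "orthonormal_frame A' P" and B': "orthonormal_frame B' Q"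
      and sv: "singular_values (transpose A' ** B') (vector [cos t, cos u])"
      by (auto split: prod.splits)
    define R S where "R = transpose A ** A'" and "S = transpose B ** B'"
    have RS: "orthogonal_matrix R" "orthogonal_matrix S" "A' = A ** R" "B' = B ** S"
      using orthonormal_frame_change[OF A A'] orthonormal_frame_change[OF B B'] by (auto simp: R_def S_def)
    have M': "transpose A' ** B' = transpose R ** ?M ** S"
      unfolding RS(3,4) by (simp add: matrix_transpose_mul matrix_mul_assoc)
    have RT: "orthogonal_matrix (transpose R)" using RS by (simp add: orthogonal_matrix_transpose)
    note inv' = singular_values_invariants[OF sv]
    have "a\<^sup>2 + b\<^sup>2 = (cos t)\<^sup>2 + (cos u)\<^sup>2" "a\<^sup>2 * b\<^sup>2 = (cos t)\<^sup>2 * (cos u)\<^sup>2"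
      using inv(1,2) inv'(1,2) unfolding M' frobenius_mult_orthogonal[OF RT RS(2)]
          det_sq_mult_orthogonal[OF RT RS(2)] by auto
    moreover have "cos u \<le> cos t" using tu by (intro cos_monotone_0_pi_le) auto
    ultimately have "a\<^sup>2 = (cos t)\<^sup>2 \<and> b\<^sup>2 = (cos u)\<^sup>2"
      using ab(1) inv(3,4) inv'(3,4) by (intro sum_prod_unique power_mono) auto
    then have "a = cos t" "b = cos u" using inv(3,4) inv'(3,4) by (auto simp: power2_eq_iff_nonneg)
    then show "\<theta> = (arccos a, arccos b)" using \<theta> tu by (simp add: arccos_cos)
  qed
  then have "chordal_dist P Q = sqrt ((sin (arccos a))\<^sup>2 + (sin (arccos b))\<^sup>2)"
    by (simp add: chordal_dist_def)
  also have "\<dots> = sqrt (2 - frobenius ?M)"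
    using inv le1 by (simp add: sin_squared_eq)
  finally show ?thesis .
qed

text \<open>For a symmetric involution \<open>S\<close>, (1 + S) / 2 is the orthogonal projection
  onto the fixed space. Its trace is the dimension, and trace 0 of \<open>S\<close> makes this
  2.\<close>

lemma involution_frame:
  fixes S :: "real ^ 4 ^ 4"
  assumes sym: "transpose S = S" and inv: "S ** S = mat 1" and tr: "trace S = 0"
  obtains A P where "orthonormal_frame A P" "A ** transpose A = (1/2) *\<^sub>R (mat 1 + S)" "P \<in> Gr24"
proof -
  define H where "H = (1/2) *\<^sub>R (mat 1 + S)"
  have sc: "(c *\<^sub>R X) *v x = c *\<^sub>R (X *v x)" for c :: real and X :: "real ^ 4 ^ 4" and x
    by (simp add: scaleR_matrix_vector_assoc)
  have Hv: "H *v x = (1/2) *\<^sub>R (x + S *v x)" for x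
    by (simp add: H_def sc matrix_vector_mult_add_rdistrib)
  have SS: "S *v (S *v x) = x" for x by (simp add: matrix_vector_mul_assoc inv)
  have symi: "(S *v x) \<bullet> y = x \<bullet> (S *v y)" for x y
    by (simp only: matrix_vector_adjoint sym)
  define P where "P = range (\<lambda>x. H *v x)"
  have subP: "subspace P" unfolding P_def by (intro linear_subspace_image) auto
  have fixP: "S *v y = y" if "y \<in> P" for y
    using that by (auto simp: P_def Hv matrix_vector_right_distrib matrix_vector_mult_scaleR SS add.commute)
  obtain B where B: "B \<subseteq> P" "pairwise orthogonal B" "\<And>x. x \<in> B \<Longrightarrow> norm x = 1" "independent B" "card B
      = dim P" "span B = P"
    using orthonormal_basis_subspace[OF subP] by metis
  have finB: "finite B" using B(4) by (rule independent_imp_finite)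
  have HB: "H *v x = (\<Sum>b\<in>B. (x \<bullet> b) *\<^sub>R b)" for x
  proof -
    have "(H *v x) \<bullet> b = x \<bullet> b" if "b \<in> B" for b
    proof -
      have "S *v b = b" using that B(1) fixP by auto
      then show ?thesis by (simp add: Hv inner_add_left symi)
    qed
    moreover have "H *v x \<in> span B" by (simp add: B(6) P_def)
    then have "(\<Sum>b\<in>B. ((H *v x) \<bullet> b) *\<^sub>R b) = H *v x"
      by (intro orthonormal_basis_expand[OF B(2,3) _ finB]) auto
    ultimately show ?thesis by simp
  qed
  have entries: "H $ i $ k = (\<Sum>b\<in>B. b $ i * b $ k)" for i k
  proof -
    have "H $ i $ k = (H *v axis k 1) $ i" by (simp add: matrix_vector_mul_component inner_axis)
    also have "\<dots> = (\<Sum>b\<in>B. b $ i * b $ k)"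
      by (simp add: HB inner_axis' mult.commute)
    finally show ?thesis .
  qed
  have "trace H = 2" using tr by (simp add: H_def trace_def sum_4 mat_def add_divide_distrib[symmetric])
  moreover have "trace H = (\<Sum>b\<in>B. b \<bullet> b)"
    by (simp add: trace_def entries inner_vec_def sum.swap[of _ _ B])
  moreover have "(\<Sum>b\<in>B. b \<bullet> b) = real (card B)" using B(3) by (simp add: dot_square_norm)
  ultimately have card: "card B = 2" by simp
  then obtain b1 b2 where b: "B = {b1, b2}" "b1 \<noteq> b2" by (auto simp: card_2_iff)
  define A :: "real ^ 2 ^ 4" where "A = (\<chi> i j. if j = 1 then b1 $ i else b2 $ i)"
  have cols: "column 1 A = b1" "column 2 A = b2" by (simp_all add: column_def A_def vec_eq_iff)
  have "columns A = {b1, b2}" unfolding columns_def using cols by (auto simp: UNIV_2 setcompr_eq_image)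
  then have sp: "span (columns A) = P" using b B(6) by simp
  have "b1 \<bullet> b2 = 0" using B(2) b by (auto simp: pairwise_def orthogonal_def)
  moreover have "b1 \<bullet> b1 = 1" "b2 \<bullet> b2 = 1" using B(3) b by (auto simp: dot_square_norm)
  ultimately have "transpose A ** A = mat 1"
    by (simp add: vec_eq_iff forall_2 matrix_matrix_mult_def transpose_def A_def mat_def
        inner_vec_def mult.commute)
  with sp have "orthonormal_frame A P" by (simp add: orthonormal_frame_def)
  moreover have "A ** transpose A = H"
    using b(2) by (simp add: vec_eq_iff matrix_matrix_mult_def transpose_def A_def sum_2 entries b(1))
  moreover have "P \<in> Gr24" using subP B(5) card by (simp add: Gr24_def)
  ultimately show ?thesis using that unfolding H_def by blast
qed

text \<open>The matrix of \<open>x \<mapsto> u x v\<close> for imaginary quaternions \<open>u\<close>, \<open>v\<close>. For unit \<open>u\<close>, \<open>v\<close> it is an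
    involution, and
  its fixed space is the plane with self-dual part \<open>u\<close> and anti-self-dual part \<open>v\<close>, up to sign.\<close>

definition quat_left :: "real ^ 3 \<Rightarrow> real ^ 4 ^ 4" where
  "quat_left u = vector [vector [0, - u$1, - u$2, - u$3], vector [u$1, 0, - u$3, u$2],
     vector [u$2, u$3, 0, - u$1], vector [u$3, - u$2, u$1, 0]]"

definition quat_right :: "real ^ 3 \<Rightarrow> real ^ 4 ^ 4" where
  "quat_right v = vector [vector [0, - v$1, - v$2, - v$3], vector [v$1, 0, v$3, - v$2],
     vector [v$2, - v$3, 0, v$1], vector [v$3, v$2, - v$1, 0]]"

definition quat_sandwich :: "real ^ 3 \<Rightarrow> real ^ 3 \<Rightarrow> real ^ 4 ^ 4" where
  "quat_sandwich u v = quat_left u ** quat_right v"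

lemma vector_4':
  "(vector [a, b, c, d] :: 'a::zero ^ 4) $ 1 = a" "(vector [a, b, c, d] :: 'a ^ 4) $ 2 = b"
  "(vector [a, b, c, d] :: 'a ^ 4) $ 3 = c" "(vector [a, b, c, d] :: 'a ^ 4) $ 4 = d"
  by (simp_all add: vector_def)

lemmas quat_simps = vec_eq_iff forall_4 matrix_matrix_mult_def transpose_def sum_4 mat_def vector_4'

lemma quat_left_sq: "quat_left u ** quat_left u = - (u \<bullet> u) *\<^sub>R mat 1"
  by (simp add: quat_left_def quat_simps inner_vec_def sum_3)

lemma quat_right_sq: "quat_right u ** quat_right u = - (u \<bullet> u) *\<^sub>R mat 1"
  by (simp add: quat_right_def quat_simps inner_vec_def sum_3)

lemma quat_commute: "quat_left u ** quat_right v = quat_right v ** quat_left u"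
  by (simp add: quat_left_def quat_right_def quat_simps algebra_simps)

lemma quat_sandwich_eq: "quat_sandwich u v = vector
   [vector [- u$1 * v$1 - u$2 * v$2 - u$3 * v$3, u$2 * v$3 - u$3 * v$2, u$3 * v$1 - u$1 * v$3, u$1
       * v$2 - u$2 * v$1],
    vector [u$2 * v$3 - u$3 * v$2, u$2 * v$2 + u$3 * v$3 - u$1 * v$1, - u$1 * v$2 - u$2 * v$1, - u$1
        * v$3 - u$3 * v$1],
    vector [u$3 * v$1 - u$1 * v$3, - u$1 * v$2 - u$2 * v$1, u$1 * v$1 + u$3 * v$3 - u$2 * v$2, - u$2
        * v$3 - u$3 * v$2],
    vector [u$1 * v$2 - u$2 * v$1, - u$1 * v$3 - u$3 * v$1, - u$2 * v$3 - u$3 * v$2, u$1 * v$1 + u$2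
        * v$2 - u$3 * v$3]]"
  by (simp add: quat_sandwich_def quat_left_def quat_right_def quat_simps)

lemma quat_sandwich_sym: "transpose (quat_sandwich u v) = quat_sandwich u v"
  by (simp add: quat_sandwich_eq quat_simps)

lemma quat_sandwich_trace: "trace (quat_sandwich u v) = 0"
  by (simp add: quat_sandwich_eq trace_def sum_4 vector_4')

lemma quat_sandwich_inv:
  assumes "u \<bullet> u = 1" "v \<bullet> v = 1"
  shows "quat_sandwich u v ** quat_sandwich u v = mat 1"
proof -
  have "quat_sandwich u v ** quat_sandwich u v = quat_left u ** (quat_right v ** quat_left u) **
      quat_right v"
    by (simp add: quat_sandwich_def matrix_mul_assoc)
  also have "\<dots> = (quat_left u ** quat_left u) ** (quat_right v ** quat_right v)"
    by (simp add: quat_commute[symmetric] matrix_mul_assoc)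
  also have "\<dots> = mat 1"
    by (simp add: quat_left_sq quat_right_sq assms) (simp add: quat_simps)
  finally show ?thesis .
qed

lemma quat_sandwich_trace_mult:
  "trace (quat_sandwich u v ** quat_sandwich u' v') = 4 * (u \<bullet> u') * (v \<bullet> v')"
proof -
  \<comment> \<open>Naming the twelve coordinates turns the claim into a polynomial identity in
    twelve variables.\<close>
  obtain u1 u2 u3 where u: "u$1 = u1" "u$2 = u2" "u$3 = u3" by blast
  obtain v1 v2 v3 where v: "v$1 = v1" "v$2 = v2" "v$3 = v3" by blast
  obtain x1 x2 x3 where x: "u'$1 = x1" "u'$2 = x2" "u'$3 = x3" by blast
  obtain y1 y2 y3 where y: "v'$1 = y1" "v'$2 = y2" "v'$3 = y3" by blast
  show ?thesis
    unfolding quat_sandwich_eq trace_def matrix_matrix_mult_def sum_4 inner_vec_def sum_3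
    unfolding vec_lambda_beta vector_4' u v x y inner_real_def
    by algebra
qed

text \<open>The projection determines its range, so the choice is among one plane only. It depends
  on \<open>u\<close> and \<open>v\<close> only through \<open>quat_sandwich u v\<close>, so
  changing both signs gives the same plane.\<close>

definition plane_of :: "real ^ 3 \<Rightarrow> real ^ 3 \<Rightarrow> (real ^ 4) set" where
  "plane_of u v = (SOME P. P \<in> Gr24 \<and>
     (\<exists>A. orthonormal_frame A P \<and> A ** transpose A = (1/2) *\<^sub>R (mat 1 + quat_sandwich u v)))"

lemma plane_of:
  assumes "norm u = 1" "norm v = 1"
  shows "plane_of u v \<in> Gr24"
    "\<exists>A. orthonormal_frame A (plane_of u v) \<and> A ** transpose A = (1/2) *\<^sub>R (mat 1 + quat_sandwich u v)"
proof -
  have "\<exists>P. P \<in> Gr24 \<and> (\<exists>A. orthonormal_frame A P \<and> A ** transpose A = (1/2) *\<^sub>R (mat 1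
      + quat_sandwich u v))"
    using involution_frame[OF quat_sandwich_sym quat_sandwich_inv quat_sandwich_trace, of u v] assms
    by (metis dot_square_norm one_power2)
  from someI_ex[OF this, folded plane_of_def] show "plane_of u v \<in> Gr24"
    "\<exists>A. orthonormal_frame A (plane_of u v) \<and> A ** transpose A = (1/2) *\<^sub>R (mat 1 + quat_sandwich u v)"
    by auto
qed

text \<open>The Frobenius norm is the trace of the product of the two projections (1 + S) / 2 and (1
  + T) / 2. Since S and T have trace 0, this is (4 + tr(S T)) / 4, and the trace of S T
  factorises.\<close>

theorem chordal_dist_plane_of:
  assumes "norm u = 1" "norm v = 1" "norm u' = 1" "norm v' = 1"
  shows "chordal_dist (plane_of u v) (plane_of u' v') = sqrt (1 - (u \<bullet> u') * (v \<bullet> v'))"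
proof -
  obtain A where A: "orthonormal_frame A (plane_of u v)" "A ** transpose A = (1/2) *\<^sub>R (mat 1
      + quat_sandwich u v)"
    using plane_of assms by blast
  obtain B where B: "orthonormal_frame B (plane_of u' v')" "B ** transpose B = (1/2) *\<^sub>R (mat 1
      + quat_sandwich u' v')"
    using plane_of assms by blast
  let ?S = "quat_sandwich u v" let ?T = "quat_sandwich u' v'"
  have "frobenius (transpose A ** B) = trace (transpose B ** (A ** transpose A ** B))"
    by (simp add: frobenius_def matrix_transpose_mul matrix_mul_assoc)
  also have "\<dots> = trace ((A ** transpose A ** B) ** transpose B)" by (rule trace_mul_sym)
  also have "\<dots> = trace ((A ** transpose A) ** (B ** transpose B))" by (simp add: matrix_mul_assoc)
  also have "\<dots> = (1/4) * (trace (mat 1 :: real^4^4) + trace ?S + trace ?T + trace (?S ** ?T))"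
    unfolding A B trace_def by (simp add: matrix_matrix_mult_def sum_4 mat_def algebra_simps)
  also have "\<dots> = 1 + (u \<bullet> u') * (v \<bullet> v')"
    by (simp only: quat_sandwich_trace quat_sandwich_trace_mult) (simp add: trace_def mat_def)
  finally show ?thesis using chordal_dist_frobenius[OF A(1) B(1)] by simp
qed

section \<open>Random planes\<close>

lemma zonal_kernel_1: "n > 0 \<Longrightarrow> zonal_kernel n 1 = (real n)\<^sup>2"
  by (cases n) (simp_all add: zonal_kernel_def jac_a_def sum.lessThan_Suc_shift)

lemma zonal_kernel_minus_1: "n > 0 \<Longrightarrow> (zonal_kernel n (- 1))\<^sup>2 = (real n)\<^sup>2"
  by (subst zonal_kernel_eq, simp, cases n)
     (simp_all add: zonal_kernel'_def jac_b_def sum.lessThan_Suc_shift power_mult_distrib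
         minus_one_power_iff)

text \<open>The reproducing kernel, as a function of the two heights, of the span of the products of
    spherical harmonics
  of degrees below \<open>n\<close> that are invariant under \<open>(u, v) \<mapsto> (- u, - v)\<close>.\<close>

definition even_kernel :: "nat \<Rightarrow> real \<Rightarrow> real \<Rightarrow> real" where
  "even_kernel n s t = (zonal_kernel n s * zonal_kernel n t + zonal_kernel n (- s)
      * zonal_kernel n (- t)) / 2"

text \<open>The diagonal value of the even kernel: n^2 n^2 from heights 1, 1 and n n from heights
  -1, -1, averaged.\<close>

definition even_dim :: "nat \<Rightarrow> nat" where
  "even_dim n = (n ^ 4 + n ^ 2) div 2"

lemma real_even_dim: "real (even_dim n) = ((real n) ^ 4 + (real n)\<^sup>2) / 2"
proof -
  have "even (n ^ 4 + n ^ 2)" by simp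
  then have "2 * even_dim n = n ^ 4 + n ^ 2" unfolding even_dim_def by simp
  then have "2 * real (even_dim n) = real n ^ 4 + real n ^ 2"
    by (metis of_nat_add of_nat_mult of_nat_numeral of_nat_power)
  then show ?thesis by simp
qed

section \<open>The even kernel on the product of two spheres\<close>

abbreviation sphere_pair :: "((real^3) \<times> (real^3)) measure" where
  "sphere_pair \<equiv> sphere_measure \<Otimes>\<^sub>M sphere_measure"

interpretation sphere_pair: pair_prob_space sphere_measure sphere_measure ..

lemma space_sphere_pair: "space sphere_pair = sphere 0 1 \<times> sphere 0 1"
  by (simp add: space_pair_measure)

lemma sphere_pair_measurable:
  fixes F :: "(real^3) \<times> (real^3) \<Rightarrow> real"
  assumes "continuous_on UNIV F"
  shows "F \<in> borel_measurable sphere_pair"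
proof -
  have [measurable]: "(\<lambda>x. x) \<in> borel_measurable sphere_measure"
      by (rule sphere_measurable) (rule continuous_on_id)
  have [measurable]: "F \<in> borel_measurable borel" by (rule borel_measurable_continuous_onI[OF assms])
  have "(\<lambda>z. F (fst z, snd z)) \<in> borel_measurable sphere_pair" by measurable
  then show ?thesis by simp
qed

lemma sphere_pair_integrable:
  fixes F :: "(real^3) \<times> (real^3) \<Rightarrow> real"
  assumes F: "continuous_on UNIV F"
  shows "integrable sphere_pair F"
proof -
  have "compact (F ` (sphere 0 1 \<times> sphere 0 1))"
    by (intro compact_continuous_image continuous_on_subset[OF F] compact_Times) auto
  then obtain B where "\<forall>x\<in>sphere 0 1 \<times> sphere 0 1. norm (F x) \<le> B"
    by (auto dest!: compact_imp_bounded simp: bounded_iff)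
  then show ?thesis
    by (intro sphere_pair.P.integrable_const_bound[of _ B] sphere_pair_measurable[OF F]) (auto simp:
        space_sphere_pair)
qed

lemma sphere_pair_integral:
  fixes F :: "(real^3) \<times> (real^3) \<Rightarrow> real"
  assumes F: "continuous_on UNIV F"
  shows "(\<integral>z. F z \<partial>sphere_pair) = (\<integral>u. (\<integral>v. F (u, v) \<partial>sphere_measure) \<partial>sphere_measure)"
  using sphere_pair.integral_fst'[OF sphere_pair_integrable[OF F]] by simp

lemma sphere_pair_integral_product:
  fixes f g :: "real^3 \<Rightarrow> real"
  assumes f: "continuous_on UNIV f" and g: "continuous_on UNIV g"
  shows "(\<integral>z. f (fst z) * g (snd z) \<partial>sphere_pair) = (\<integral>u. f u \<partial>sphere_measure) * (\<integral>v. g v \<partial>sphere_measure)"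
proof -
  have "continuous_on UNIV (\<lambda>z::(real^3) \<times> (real^3). f (fst z) * g (snd z))"
    by (intro continuous_intros continuous_on_compose2[OF f] continuous_on_compose2[OF g]) auto
  then show ?thesis by (subst sphere_pair_integral) simp_all
qed

lemma sphere_pair_integral_heights:
  fixes F :: "real \<Rightarrow> real \<Rightarrow> real"
  assumes F: "continuous_on UNIV (\<lambda>(s, t). F s t)" and uv: "norm u = 1" "norm v = 1"
  shows "(\<integral>z. F (fst z \<bullet> u) (snd z \<bullet> v) \<partial>sphere_pair) = (\<integral>t. (\<integral>s. F s t \<partial>interval_measure_pm1)
      \<partial>interval_measure_pm1)"
proof -
  have c2: "continuous_on A (\<lambda>x. F (f x) (g x))" if "continuous_on A f" "continuous_on A g"
    for A and f g :: "'z::topological_space \<Rightarrow> real"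
    using continuous_on_compose2[OF F continuous_on_Pair[OF that]] by simp
  interpret Q: pair_prob_space sphere_measure interval_measure_pm1 ..
  have "(\<integral>z. F (fst z \<bullet> u) (snd z \<bullet> v) \<partial>sphere_pair) = (\<integral>x. (\<integral>y. F (x \<bullet> u) (y \<bullet> v) \<partial>sphere_measure)
      \<partial>sphere_measure)"
    by (subst sphere_pair_integral) (auto intro!: c2 continuous_intros)
  also have "\<dots> = (\<integral>x. (\<integral>t. F (x \<bullet> u) t \<partial>interval_measure_pm1) \<partial>sphere_measure)"
    by (intro Bochner_Integration.integral_cong refl sphere_integral_height uv c2 continuous_intros)
  also have "\<dots> = (\<integral>t. (\<integral>x. F (x \<bullet> u) t \<partial>sphere_measure) \<partial>interval_measure_pm1)"
  proof (rule Q.Fubini_integral[symmetric])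
    have "continuous_on UNIV (\<lambda>z::(real^3) \<times> real. F (fst z \<bullet> u) (snd z))" by (intro c2 continuous_intros)
    then have [measurable]: "(\<lambda>z::(real^3) \<times> real. F (fst z \<bullet> u) (snd z)) \<in> borel_measurable borel"
      by (rule borel_measurable_continuous_onI)
    have [measurable]: "(\<lambda>x. x) \<in> borel_measurable sphere_measure"
        by (rule sphere_measurable) (rule continuous_on_id)
    have "(\<lambda>z::(real^3) \<times> real. (\<lambda>z. F (fst z \<bullet> u) (snd z)) (fst z, snd z))
        \<in> borel_measurable (sphere_measure \<Otimes>\<^sub>M interval_measure_pm1)"
      by measurable
    then have m: "(\<lambda>(x, t). F (x \<bullet> u) t) \<in> borel_measurable (sphere_measure \<Otimes>\<^sub>M interval_measure_pm1)"
      by (simp add: case_prod_beta')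
    have "compact ((\<lambda>(s, t). F s t) ` ({-1..1} \<times> {-1..1}))"
      by (intro compact_continuous_image continuous_on_subset[OF F] compact_Times) auto
    then obtain B where "\<forall>x\<in>(\<lambda>(s, t). F s t) ` ({-1..1} \<times> {-1..1}). norm x \<le> B"
      by (auto dest!: compact_imp_bounded simp only: bounded_iff)
    then have B: "\<bar>F s t\<bar> \<le> B" if "s \<in> {-1..1}" "t \<in> {-1..1}" for s t using that by force
    have "AE z in sphere_measure \<Otimes>\<^sub>M interval_measure_pm1. snd z \<in> {-1..1}"
    proof (rule Q.AE_pair_measure)
      show "{z \<in> space (sphere_measure \<Otimes>\<^sub>M interval_measure_pm1). snd z \<in> {-1..1}}
          \<in> sets (sphere_measure \<Otimes>\<^sub>M interval_measure_pm1)"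
        by measurable
    qed (use interval_AE in simp)
    then have "AE z in sphere_measure \<Otimes>\<^sub>M interval_measure_pm1. norm ((\<lambda>(x, t). F (x \<bullet> u) t) z) \<le> B"
      using AE_space
    proof eventually_elim
      case (elim z)
      then have "norm (fst z) = 1" by (auto simp: space_pair_measure)
      then have "fst z \<bullet> u \<in> {-1..1}" using Cauchy_Schwarz_ineq2[of "fst z" u] uv by (simp add: abs_le_iff)
      then show ?case using B elim by (simp add: case_prod_beta)
    qed
    then show "integrable (sphere_measure \<Otimes>\<^sub>M interval_measure_pm1) (\<lambda>(x, t). F (x \<bullet> u) t)"
      by (rule Q.P.integrable_const_bound[OF _ m])
  qed
  also have "\<dots> = (\<integral>t. (\<integral>s. F s t \<partial>interval_measure_pm1) \<partial>interval_measure_pm1)"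
    by (intro Bochner_Integration.integral_cong refl sphere_integral_height uv c2 continuous_intros)
  finally show ?thesis .
qed

definition pair_kernel :: "nat \<Rightarrow> (real^3) \<times> (real^3) \<Rightarrow> (real^3) \<times> (real^3) \<Rightarrow> real" where
  "pair_kernel n p q = even_kernel n (fst p \<bullet> fst q) (snd p \<bullet> snd q)"

lemma even_kernel_continuous [continuous_intros]:
  "continuous_on A f \<Longrightarrow> continuous_on A g \<Longrightarrow> continuous_on A (\<lambda>x. even_kernel n (f x) (g x))"
  unfolding even_kernel_def by (intro continuous_intros) auto

lemma pair_measurable_of_continuous:
  fixes F :: "((real^3) \<times> (real^3)) \<times> ((real^3) \<times> (real^3)) \<Rightarrow> real"
  assumes "continuous_on UNIV F"
  shows "F \<in> borel_measurable (sphere_pair \<Otimes>\<^sub>M sphere_pair)"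
proof -
  have [measurable]: "(\<lambda>x. x) \<in> borel_measurable sphere_measure"
      by (rule sphere_measurable) (rule continuous_on_id)
  have [measurable]: "F \<in> borel_measurable borel" by (rule borel_measurable_continuous_onI[OF assms])
  have "(\<lambda>z. F ((fst (fst z), snd (fst z)), (fst (snd z), snd (snd z))))
      \<in> borel_measurable (sphere_pair \<Otimes>\<^sub>M sphere_pair)" by measurable
  then show ?thesis by simp
qed

text \<open>Reproduction on each factor evaluates the four products of the symmetrised kernels. They
  agree in pairs, since changing the sign of both arguments of an inner product has no effect, and
  this cancels one of the two factors 1 / 2.\<close>

lemma reproducing_pair_kernel:
  assumes n: "n > 0"
  shows "reproducing_kernel sphere_pair (pair_kernel n) (real (even_dim n))"
  unfolding reproducing_kernel_def
proof (intro conjI ballI)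
  let ?k = "zonal_kernel n"
  show "(\<lambda>(x, y). pair_kernel n x y) \<in> borel_measurable (sphere_pair \<Otimes>\<^sub>M sphere_pair)"
    unfolding pair_kernel_def case_prod_beta by (intro pair_measurable_of_continuous continuous_intros)
  show "\<exists>c. \<forall>x\<in>space sphere_pair. \<forall>y\<in>space sphere_pair. \<bar>pair_kernel n x y\<bar> \<le> c"
  proof -
    have "compact ((\<lambda>z. even_kernel n (fst z) (snd z)) ` ({-1..1} \<times> {-1..1}))"
      by (intro compact_continuous_image continuous_intros compact_Times) auto
    then obtain B where "\<forall>x\<in>(\<lambda>z. even_kernel n (fst z) (snd z)) ` ({-1..1} \<times> {-1..1}). norm x \<le> B"
      by (auto dest!: compact_imp_bounded simp only: bounded_iff)
    then have B: "\<bar>even_kernel n s t\<bar> \<le> B" if "s \<in> {-1..1}" "t \<in> {-1..1}" for s t using that by force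
    have "x \<bullet> y \<in> {-1..1}" if "norm x = 1" "norm y = 1" for x y :: "real^3"
      using Cauchy_Schwarz_ineq2[of x y] that by (simp add: abs_le_iff)
    then show ?thesis unfolding pair_kernel_def by (intro exI[of _ B] ballI B) (auto simp:
        space_sphere_pair)
  qed
  show "pair_kernel n x y = pair_kernel n y x" for x y by (simp add: pair_kernel_def inner_commute)
  show "(\<integral>w. pair_kernel n x w * pair_kernel n w y \<partial>sphere_pair) = pair_kernel n x y"
    if sp: "x \<in> space sphere_pair" "y \<in> space sphere_pair" for x y
  proof -
    obtain u v where x: "x = (u, v)" "norm u = 1" "norm v = 1" using sp(1)
        by (cases x) (auto simp: space_sphere_pair)
    obtain u' v' where y: "y = (u', v')" "norm u' = 1" "norm v' = 1" using sp(2)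
        by (cases y) (auto simp: space_sphere_pair)
    define I where "I a b c d = (\<integral>w. (?k (fst w \<bullet> a) * ?k (fst w \<bullet> b)) * (?k (snd w \<bullet> c)
        * ?k (snd w \<bullet> d)) \<partial>sphere_pair)" for a b c d
    have I: "I a b c d = ?k (b \<bullet> a) * ?k (d \<bullet> c)" if "norm a = 1" "norm c = 1" for a b c d
      unfolding I_def using that n
      by (subst sphere_pair_integral_product[where f = "\<lambda>u. ?k (u \<bullet> a) * ?k (u \<bullet> b)" and g
          = "\<lambda>u. ?k (u \<bullet> c) * ?k (u \<bullet> d)"])
         (auto intro!: continuous_intros simp: sphere_zonal_reproduce)
    have int: "integrable sphere_pair (\<lambda>w. (?k (fst w \<bullet> a) * ?k (fst w \<bullet> b)) * (?k (snd w \<bullet> c)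
        * ?k (snd w \<bullet> d)))" for a b c d
      by (intro sphere_pair_integrable continuous_intros)
    have "(\<integral>w. pair_kernel n x w * pair_kernel n w y \<partial>sphere_pair) =
      (\<integral>w. ((?k (fst w \<bullet> u) * ?k (fst w \<bullet> u')) * (?k (snd w \<bullet> v) * ?k (snd w \<bullet> v'))
        + (?k (fst w \<bullet> u) * ?k (fst w \<bullet> (- u'))) * (?k (snd w \<bullet> v) * ?k (snd w \<bullet> (- v')))
        + (?k (fst w \<bullet> (- u)) * ?k (fst w \<bullet> u')) * (?k (snd w \<bullet> (- v)) * ?k (snd w \<bullet> v'))
        + (?k (fst w \<bullet> (- u)) * ?k (fst w \<bullet> (- u'))) * (?k (snd w \<bullet> (- v)) * ?k (snd w \<bullet> (- v'))))
            / 4 \<partial>sphere_pair)"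
      by (rule Bochner_Integration.integral_cong[OF refl])
         (simp add: pair_kernel_def even_kernel_def x y inner_commute field_simps)
    also have "\<dots> = (I u u' v v' + I u (- u') v (- v') + I (- u) u' (- v) v'
        + I (- u) (- u') (- v) (- v')) / 4"
      unfolding I_def using int by (simp only: integral_divide_zero Bochner_Integration.integral_add
          Bochner_Integration.integrable_add)
    also have "\<dots> = pair_kernel n x y"
      using x y by (simp add: I pair_kernel_def even_kernel_def inner_commute field_simps)
    finally show ?thesis .
  qed
  have "(\<integral>x. pair_kernel n x x \<partial>sphere_pair) = (\<integral>x. real (even_dim n) \<partial>sphere_pair)"
  proof (rule Bochner_Integration.integral_cong[OF refl])
    fix x assume "x \<in> space sphere_pair"
    then have "fst x \<bullet> fst x = 1" "snd x \<bullet> snd x = 1" by (auto simp: space_sphere_pair dot_square_norm)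
    then show "pair_kernel n x x = real (even_dim n)"
      using n zonal_kernel_1[OF n] zonal_kernel_minus_1[OF n]
      by (simp add: pair_kernel_def even_kernel_def real_even_dim flip: power2_eq_square)
  qed
  then show "(\<integral>x. pair_kernel n x x \<partial>sphere_pair) = real (even_dim n)"
    using sphere_pair.P.prob_space by simp
qed

text \<open>The fourth power of the chordal distance is (1 - s t)^2. Capping by a maximum gives a
  function that is bounded, as the determinantal bound requires, and continuous on the whole
  plane.\<close>

definition cutoff_riesz :: "real \<Rightarrow> real \<Rightarrow> real \<Rightarrow> real" where
  "cutoff_riesz \<epsilon> s t = 1 / (max (1 - s * t) \<epsilon>)\<^sup>2"

definition mean_energy :: "nat \<Rightarrow> real \<Rightarrow> real" where
  "mean_energy n \<epsilon> = (\<integral>t. (\<integral>s. cutoff_riesz \<epsilon> s t * ((real (even_dim n))\<^sup>2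
      - (even_kernel n s t)\<^sup>2) \<partial>interval_measure_pm1) \<partial>interval_measure_pm1)"

text \<open>A pair at distance zero contributes \<open>1 / \<epsilon>\<^sup>2\<close> to the cut-off energy, so the last hypothesis forces the
  random planes to be distinct, and their cut-off energy to be their true one.\<close>

theorem determinantal_configuration:
  assumes n: "n > 0" and \<epsilon>: "\<epsilon> > 0" and small: "mean_energy n \<epsilon> < 1 / \<epsilon>\<^sup>2"
  shows "\<exists>S. S \<subseteq> Gr24 \<and> finite S \<and> card S = even_dim n \<and> riesz_energy 4 S \<le> mean_energy n \<epsilon>"
proof -
  let ?N = "even_dim n"
  define W where "W p q = cutoff_riesz \<epsilon> (fst p \<bullet> fst q) (snd p \<bullet> snd q)" for p q :: "(real^3) \<times> (real^3)"
  have K: "reproducing_kernel sphere_pair (pair_kernel n) (real ?N)" by (rule reproducing_pair_kernel[OF n])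
  have cW: "continuous_on A (\<lambda>x. cutoff_riesz \<epsilon> (f x) (g x))" if "continuous_on A f" "continuous_on A g"
    for A and f g :: "'z::topological_space \<Rightarrow> real"
    unfolding cutoff_riesz_def using \<epsilon> that by (intro continuous_intros) (auto simp: max_def)
  have W_nonneg: "W p q \<ge> 0" for p q by (simp add: W_def cutoff_riesz_def)
  have W_le: "W p q \<le> 1 / \<epsilon>\<^sup>2" for p q
    unfolding W_def cutoff_riesz_def using \<epsilon> by (intro divide_left_mono power_mono) auto
  interpret MM: pair_prob_space sphere_pair sphere_pair ..
  have "\<exists>p. (\<forall>i<?N. p i \<in> space sphere_pair) \<and>
      (\<Sum>i<?N. 0) + (\<Sum>i<?N. \<Sum>j\<in>{..<?N} - {i}. W (p i) (p j)) \<le>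
      (\<integral>x. 0 * pair_kernel n x x \<partial>sphere_pair) +
      (\<integral>z. W (fst z) (snd z) * det2 (pair_kernel n) (fst z) (snd z) \<partial>(sphere_pair \<Otimes>\<^sub>M sphere_pair))"
  proof (rule sphere_pair.P.determinantal_energy_bound[OF _ W_nonneg W_le _ K, where D = 0])
    show "(\<lambda>(x, y). W x y) \<in> borel_measurable (sphere_pair \<Otimes>\<^sub>M sphere_pair)"
      unfolding W_def case_prod_beta by (intro pair_measurable_of_continuous cW continuous_intros)
    show "W x y = W y x" for x y by (simp add: W_def inner_commute)
  qed auto
  then obtain p where p: "\<And>i. i < ?N \<Longrightarrow> p i \<in> space sphere_pair"
    and le: "(\<Sum>i<?N. \<Sum>j\<in>{..<?N} - {i}. W (p i) (p j)) \<le>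
      (\<integral>z. W (fst z) (snd z) * det2 (pair_kernel n) (fst z) (snd z) \<partial>(sphere_pair \<Otimes>\<^sub>M sphere_pair))"
    by auto
  define F where "F s t = cutoff_riesz \<epsilon> s t * ((real ?N)\<^sup>2 - (even_kernel n s t)\<^sup>2)" for s t
  have F: "continuous_on UNIV (\<lambda>(s, t). F s t)"
    unfolding F_def case_prod_beta by (intro continuous_intros cW)
  have WF: "W x y * det2 (pair_kernel n) x y = F (fst y \<bullet> fst x) (snd y \<bullet> snd x)"
    if "x \<in> space sphere_pair" "y \<in> space sphere_pair" for x y
  proof -
    have "pair_kernel n z z = real ?N" if "z \<in> space sphere_pair" for z
    proof -
      have "fst z \<bullet> fst z = 1" "snd z \<bullet> snd z = 1" using that
          by (auto simp: space_sphere_pair dot_square_norm)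
      then show ?thesis
        using n zonal_kernel_1[OF n] zonal_kernel_minus_1[OF n]
        by (simp add: pair_kernel_def even_kernel_def real_even_dim flip: power2_eq_square)
    qed
    then show ?thesis using that by (simp add: W_def F_def det2_def pair_kernel_def inner_commute
        power2_eq_square)
  qed
  have "(\<integral>z. W (fst z) (snd z) * det2 (pair_kernel n) (fst z) (snd z) \<partial>(sphere_pair \<Otimes>\<^sub>M sphere_pair))
      = (\<integral>z. F (fst (snd z) \<bullet> fst (fst z)) (snd (snd z) \<bullet> snd (fst z)) \<partial>(sphere_pair \<Otimes>\<^sub>M sphere_pair))"
    by (rule Bochner_Integration.integral_cong) (auto simp: WF space_pair_measure)
  also have "\<dots> = (\<integral>x. (\<integral>y. F (fst y \<bullet> fst x) (snd y \<bullet> snd x) \<partial>sphere_pair) \<partial>sphere_pair)"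
  proof -
    have cont: "continuous_on UNIV (\<lambda>z::((real^3) \<times> (real^3)) \<times> ((real^3) \<times> (real^3)). F (fst (snd
        z) \<bullet> fst (fst z)) (snd (snd z) \<bullet> snd (fst z)))"
      unfolding F_def by (intro continuous_intros cW)
    have "compact ((\<lambda>(s, t). F s t) ` ({-1..1} \<times> {-1..1}))"
      by (intro compact_continuous_image continuous_on_subset[OF F] compact_Times) auto
    then obtain B where "\<forall>x\<in>(\<lambda>(s, t). F s t) ` ({-1..1} \<times> {-1..1}). norm x \<le> B"
      by (auto dest!: compact_imp_bounded simp only: bounded_iff)
    then have B: "\<bar>F s t\<bar> \<le> B" if "s \<in> {-1..1}" "t \<in> {-1..1}" for s t using that by force
    have in1: "x \<bullet> y \<in> {-1..1}" if "norm x = 1" "norm y = 1" for x y :: "real^3"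
      using Cauchy_Schwarz_ineq2[of x y] that by (simp add: abs_le_iff)
    have "integrable (sphere_pair \<Otimes>\<^sub>M sphere_pair) (\<lambda>z. F (fst (snd z) \<bullet> fst (fst z)) (snd (snd z) \<bullet>
        snd (fst z)))"
    proof (rule MM.P.integrable_const_bound[of _ B])
      show "AE z in sphere_pair \<Otimes>\<^sub>M sphere_pair. norm (F (fst (snd z) \<bullet> fst (fst z)) (snd (snd z) \<bullet>
          snd (fst z))) \<le> B"
        by (rule AE_I2) (use B in1 in \<open>auto simp: space_pair_measure\<close>)
    qed (rule pair_measurable_of_continuous[OF cont])
    then show ?thesis using MM.integral_fst'[of "\<lambda>z. F (fst (snd z) \<bullet> fst (fst z)) (snd (snd z) \<bullet>
        snd (fst z))"] by simp
  qed
  also have "\<dots> = (\<integral>x. mean_energy n \<epsilon> \<partial>sphere_pair)"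
  proof (rule Bochner_Integration.integral_cong[OF refl])
    fix x assume "x \<in> space sphere_pair"
    then have "norm (fst x) = 1" "norm (snd x) = 1" by (auto simp: space_sphere_pair)
    then show "(\<integral>y. F (fst y \<bullet> fst x) (snd y \<bullet> snd x) \<partial>sphere_pair) = mean_energy n \<epsilon>"
      unfolding mean_energy_def F_def[symmetric] by (rule sphere_pair_integral_heights[OF F])
  qed
  also have "\<dots> = mean_energy n \<epsilon>" using sphere_pair.P.prob_space by simp
  finally have le': "(\<Sum>i<?N. \<Sum>j\<in>{..<?N} - {i}. W (p i) (p j)) \<le> mean_energy n \<epsilon>" using le by simp
  define st where "st i j = (fst (p i) \<bullet> fst (p j)) * (snd (p i) \<bullet> snd (p j))" for i j
  define \<Phi> where "\<Phi> i = plane_of (fst (p i)) (snd (p i))" for i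
  have unit: "norm (fst (p i)) = 1" "norm (snd (p i)) = 1" if "i < ?N" for i
    using p[OF that] by (auto simp: space_sphere_pair)
  have sep: "1 - st i j > \<epsilon>" if ij: "i < ?N" "j < ?N" "i \<noteq> j" for i j
  proof (rule ccontr)
    assume "\<not> ?thesis"
    then have "W (p i) (p j) = 1 / \<epsilon>\<^sup>2" by (simp add: W_def cutoff_riesz_def st_def)
    moreover have "W (p i) (p j) \<le> (\<Sum>j\<in>{..<?N} - {i}. W (p i) (p j))"
      using ij by (intro member_le_sum) (auto simp: W_nonneg)
    moreover have "\<dots> \<le> (\<Sum>i<?N. \<Sum>j\<in>{..<?N} - {i}. W (p i) (p j))"
      using ij by (intro member_le_sum[of i "{..<?N}" "\<lambda>i. \<Sum>j\<in>{..<?N}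
          - {i}. W (p i) (p j)"]) (auto intro!: sum_nonneg simp: W_nonneg)
    ultimately show False using le' small by linarith
  qed
  have dist: "chordal_dist (\<Phi> i) (\<Phi> j) = sqrt (1 - st i j)" if "i < ?N" "j < ?N" for i j
    unfolding \<Phi>_def st_def using that unit by (intro chordal_dist_plane_of) auto
  have inj: "inj_on \<Phi> {..<?N}"
  proof (rule inj_onI, rule ccontr)
    fix i j assume ij: "i \<in> {..<?N}" "j \<in> {..<?N}" "\<Phi> i = \<Phi> j" "i \<noteq> j"
    \<comment> \<open>If two indices gave one plane, the distance formula for i, i would contradict
      the one for i, j, where the separation makes it positive.\<close>
    have "chordal_dist (\<Phi> i) (\<Phi> i) = 0" using ij unit[of i] unit[of j]
        by (simp add: dist st_def dot_square_norm)
    then have "sqrt (1 - st i j) = 0" using dist[of i j] ij by simp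
    then show False using sep[of i j] ij \<epsilon> by simp
  qed
  have "riesz_energy 4 (\<Phi> ` {..<?N}) = (\<Sum>i<?N. \<Sum>j\<in>{..<?N} - {i}. W (p i) (p j))"
  proof -
    have "riesz_energy 4 (\<Phi> ` {..<?N}) = (\<Sum>i<?N. \<Sum>Q\<in>\<Phi> ` {..<?N} - {\<Phi> i}. chordal_dist (\<Phi> i) Q powr (- 4))"
      unfolding riesz_energy_def by (subst sum.reindex[OF inj]) simp
    also have "\<dots> = (\<Sum>i<?N. \<Sum>j\<in>{..<?N} - {i}. W (p i) (p j))"
    proof (rule sum.cong[OF refl])
      fix i assume i: "i \<in> {..<?N}"
      have "\<Phi> ` {..<?N} - {\<Phi> i} = \<Phi> ` ({..<?N} - {i})" using inj i by (auto simp: inj_on_def)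
      then have "(\<Sum>Q\<in>\<Phi> ` {..<?N} - {\<Phi> i}. chordal_dist (\<Phi> i) Q powr (- 4)) = (\<Sum>j\<in>{..<?N}
          - {i}. chordal_dist (\<Phi> i) (\<Phi> j) powr (- 4))"
        by (simp add: sum.reindex[OF inj_on_subset[OF inj]])
      also have "\<dots> = (\<Sum>j\<in>{..<?N} - {i}. W (p i) (p j))"
      proof (rule sum.cong[OF refl])
        fix j assume j: "j \<in> {..<?N} - {i}"
        have s: "1 - st i j > \<epsilon>" using sep i j by auto
        then have pos: "1 - st i j > 0" using \<epsilon> by simp
        have "chordal_dist (\<Phi> i) (\<Phi> j) powr (- 4) = 1 / sqrt (1 - st i j) ^ 4"
          using dist i j pos by (simp add: powr_minus powr_numeral divide_inverse)
        also have "sqrt (1 - st i j) ^ 4 = (1 - st i j)\<^sup>2"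
          using pos by (simp add: power4_eq_xxxx power2_eq_square)
        finally show "chordal_dist (\<Phi> i) (\<Phi> j) powr (- 4) = W (p i) (p j)"
          using s by (simp add: W_def cutoff_riesz_def st_def)
      qed
      finally show "(\<Sum>Q\<in>\<Phi> ` {..<?N} - {\<Phi> i}. chordal_dist (\<Phi> i) Q powr (- 4)) = (\<Sum>j\<in>{..<?N}
          - {i}. W (p i) (p j))" .
    qed
    finally show ?thesis .
  qed
  moreover have "\<Phi> ` {..<?N} \<subseteq> Gr24" using plane_of(1) unit by (auto simp: \<Phi>_def)
  ultimately show ?thesis using le' inj by (intro exI[of _ "\<Phi> ` {..<?N}"]) (auto simp: card_image)
qed

section \<open>Scaling limit of the kernel\<close>

text \<open>What remains of the product in \<open>jac_a\<close> and \<open>jac_b\<close> after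
  taking out the power \<open>n ^ (2 * j)\<close>. It is the only dependence on \<open>n\<close>
  inside the rescaled series; lying in [0, 1] for j < n and tending to 1, it serves both domination
  and limit.\<close>

definition falling_ratio :: "nat \<Rightarrow> nat \<Rightarrow> real" where
  "falling_ratio n j = (\<Prod>i=1..j. 1 - (real i / real n)\<^sup>2)"

lemma falling_ratio_bounds:
  assumes "j < n" shows "0 \<le> falling_ratio n j" "falling_ratio n j \<le> 1"
proof -
  have "0 \<le> 1 - (real i / real n)\<^sup>2 \<and> 1 - (real i / real n)\<^sup>2 \<le> 1" if "i \<in> {1..j}" for i
    using that assms by (auto simp: power_le_one)
  then show "0 \<le> falling_ratio n j" "falling_ratio n j \<le> 1"
    unfolding falling_ratio_def by (auto intro!: prod_nonneg prod_le_1)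
qed

lemma falling_ratio_tendsto: "(\<lambda>n. falling_ratio n j) \<longlonglongrightarrow> 1"
proof -
  have "(\<lambda>n. \<Prod>i=1..j. 1 - (real i / real n)\<^sup>2) \<longlonglongrightarrow> (\<Prod>i=1..j. 1 - 0\<^sup>2)"
    by (intro tendsto_intros lim_const_over_n)
  then show ?thesis by (simp add: falling_ratio_def)
qed

lemma prod_falling_ratio:
  assumes "n > 0"
  shows "(\<Prod>i=1..j. (real n)\<^sup>2 - (real i)\<^sup>2) = real n ^ (2 * j) * falling_ratio n j"
proof -
  have "(real n)\<^sup>2 - (real i)\<^sup>2 = (real n)\<^sup>2 * (1 - (real i / real n)\<^sup>2)" for i
    using assms by (simp add: field_simps power2_eq_square)
  then show ?thesis
    by (simp add: falling_ratio_def prod.distrib power_mult)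
qed

lemma half_gap_power:
  assumes "n > 0"
  shows "real n ^ (2 * j) * (x\<^sup>2 / (4 * (real n)\<^sup>2)) ^ j = (x / 2) ^ (2 * j)"
proof -
  have "(real n)\<^sup>2 * (x\<^sup>2 / (4 * (real n)\<^sup>2)) = (x / 2)\<^sup>2" using assms by (simp add: power_divide)
  then show ?thesis by (simp only: power_mult power_mult_distrib[symmetric])
qed

lemma abs_alternating_term:
  fixes c d x :: real
  assumes "c \<ge> 0" "d \<ge> 0"
  shows "\<bar>(- 1) ^ j * c * (x ^ (2 * i) / d)\<bar> = c * (x ^ (2 * i) / d)"
proof -
  have "0 \<le> c * (x ^ (2 * i) / d)" using assms by simp
  then show ?thesis by (simp only: mult.assoc abs_mult[of "(- 1) ^ j"] power_abs abs_minus_cancel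
      abs_one power_one mult_1 abs_of_nonneg)
qed

lemma zonal_kernel_scaled:
  assumes n: "n > 0"
  shows "zonal_kernel n (1 - x\<^sup>2 / (2 * (real n)\<^sup>2))
    = (real n)\<^sup>2 * (\<Sum>j<n. (- 1) ^ j * falling_ratio n j * ((x / 2) ^ (2 * j) / (fact j * fact (j + 1))))"
  unfolding zonal_kernel_def sum_distrib_left
proof (rule sum.cong[OF refl])
  fix j
  have "(1 - (1 - x\<^sup>2 / (2 * (real n)\<^sup>2))) / 2 = x\<^sup>2 / (4 * (real n)\<^sup>2)" by simp
  then have "(- 1) ^ j * jac_a n j * ((1 - (1 - x\<^sup>2 / (2 * (real n)\<^sup>2))) / 2) ^ j
      = (- 1) ^ j * ((real n)\<^sup>2 * falling_ratio n j * (real n ^ (2 * j) * (x\<^sup>2 / (4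
          * (real n)\<^sup>2)) ^ j) / (fact j * fact (j + 1)))"
    unfolding jac_a_def prod_falling_ratio[OF n] by simp
  also have "\<dots> = (real n)\<^sup>2 * ((- 1) ^ j * falling_ratio n j * ((x / 2) ^ (2 * j) / (fact j
      * fact (j + 1))))"
    unfolding half_gap_power[OF n] by simp
  finally show "(- 1) ^ j * jac_a n j * ((1 - (1 - x\<^sup>2 / (2 * (real n)\<^sup>2))) / 2) ^ j
    = (real n)\<^sup>2 * ((- 1) ^ j * falling_ratio n j * ((x / 2) ^ (2 * j) / (fact j * fact (j + 1))))" .
qed

lemma zonal_kernel_scaled':
  assumes n: "n > 0"
  shows "zonal_kernel n (- (1 - x\<^sup>2 / (2 * (real n)\<^sup>2)))
    = (- 1) ^ (n - 1) * (real n * (\<Sum>j<n. (- 1) ^ j * falling_ratio n j * ((x / 2) ^ (2 * j)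
        / (fact j * fact j))))"
proof -
  have "(\<Sum>j<n. (- 1) ^ j * jac_b n j * ((1 + - (1 - x\<^sup>2 / (2 * (real n)\<^sup>2))) / 2) ^ j)
     = real n * (\<Sum>j<n. (- 1) ^ j * falling_ratio n j * ((x / 2) ^ (2 * j) / (fact j * fact j)))"
    unfolding sum_distrib_left
  proof (rule sum.cong[OF refl])
    fix j
    have "(1 + - (1 - x\<^sup>2 / (2 * (real n)\<^sup>2))) / 2 = x\<^sup>2 / (4 * (real n)\<^sup>2)" by simp
    then have "(- 1) ^ j * jac_b n j * ((1 + - (1 - x\<^sup>2 / (2 * (real n)\<^sup>2))) / 2) ^ j
        = (- 1) ^ j * (real n * falling_ratio n j * (real n ^ (2 * j) * (x\<^sup>2 / (4
            * (real n)\<^sup>2)) ^ j) / (fact j * fact j))"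
      unfolding jac_b_def prod_falling_ratio[OF n] by simp
    also have "\<dots> = real n * ((- 1) ^ j * falling_ratio n j * ((x / 2) ^ (2 * j) / (fact j * fact j)))"
      unfolding half_gap_power[OF n] by simp
    finally show "(- 1) ^ j * jac_b n j * ((1 + - (1 - x\<^sup>2 / (2 * (real n)\<^sup>2))) / 2) ^ j
       = real n * ((- 1) ^ j * falling_ratio n j * ((x / 2) ^ (2 * j) / (fact j * fact j)))" .
  qed
  then show ?thesis unfolding zonal_kernel_eq[OF n] zonal_kernel'_def by simp
qed

text \<open>The entire function 2 J_1(x) / x, with value 1 at 0.\<close>

definition bessel_quotient :: "real \<Rightarrow> real" where
  "bessel_quotient x = (\<Sum>j. (- 1) ^ j * ((x / 2) ^ (2 * j) / (fact j * fact (j + 1))))"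

lemma even_power_over_fact_summable: "summable (\<lambda>j. (x / 2) ^ (2 * j) / (fact j :: real))"
proof -
  have "summable (\<lambda>j. ((x / 2)\<^sup>2) ^ j /\<^sub>R fact j)" by (rule summable_exp_generic)
  then show ?thesis by (simp only: power_mult[symmetric] real_scaleR_def divide_inverse mult.commute)
qed

lemma over_fact_fact_le: "(x / 2) ^ (2 * j) / (fact j * fact m) \<le> (x / 2) ^ (2 * j) / (fact j :: real)"
proof -
  have "(fact j :: real) * 1 \<le> fact j * fact m" by (intro mult_left_mono fact_ge_1) auto
  then show ?thesis by (intro divide_left_mono) (auto simp: power_mult)
qed

lemma bessel_J_1_eq: "bessel_J 1 x = x / 2 * bessel_quotient x"
proof -
  have "summable (\<lambda>j. (- 1) ^ j * ((x / 2) ^ (2 * j) / (fact j * fact (j + 1))))"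
  proof (rule summable_comparison_test[OF _ even_power_over_fact_summable[of x]], intro exI allI impI)
    show "norm ((- 1) ^ j * ((x / 2) ^ (2 * j) / (fact j * fact (j + 1)))) \<le> (x / 2) ^ (2 * j)
        / fact j" for j
      using over_fact_fact_le[of x j "j + 1"] abs_alternating_term[of 1 "fact j * fact (j + 1)" j "x
          / 2" j] by simp
  qed
  then have "x / 2 * bessel_quotient x = (\<Sum>j. x / 2 * ((- 1) ^ j * ((x / 2) ^ (2 * j) / (fact j
      * fact (j + 1)))))"
    unfolding bessel_quotient_def by (rule suminf_mult[symmetric])
  also have "\<dots> = bessel_J 1 x" unfolding bessel_J_def by (rule suminf_cong) (simp add: mult_ac)
  finally show ?thesis by simp
qed

text \<open>A Mehler-Heine limit: the coefficients converge one by one, and Tannery's theorem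
  applies with the terms of an exponential series as majorant.\<close>

lemma zonal_kernel_scaled_tendsto:
  "(\<lambda>n. zonal_kernel n (1 - x\<^sup>2 / (2 * (real n)\<^sup>2)) / (real n)\<^sup>2) \<longlonglongrightarrow> bessel_quotient x"
proof -
  define T where "T j n = (if j < n then (- 1) ^ j * falling_ratio n j * ((x / 2) ^ (2 * j)
      / (fact j * fact (j + 1))) else 0)" for j n
  have lim: "(\<lambda>n. T j n) \<longlonglongrightarrow> (- 1) ^ j * ((x / 2) ^ (2 * j) / (fact j * fact (j + 1)))" for j
  proof -
    have "(\<lambda>n. (- 1) ^ j * falling_ratio n j * ((x / 2) ^ (2 * j) / (fact j * fact (j + 1))))
        \<longlonglongrightarrow> (- 1) ^ j * 1 * ((x / 2) ^ (2 * j) / (fact j * fact (j + 1)))"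
      by (intro tendsto_mult tendsto_const falling_ratio_tendsto)
    moreover have "\<forall>\<^sub>F n in sequentially. (- 1) ^ j * falling_ratio n j * ((x / 2) ^ (2 * j)
        / (fact j * fact (j + 1))) = T j n"
      using eventually_gt_at_top[of j] by eventually_elim (simp add: T_def)
    ultimately show ?thesis by (simp add: tendsto_cong)
  qed
  have bd: "norm (T j n) \<le> (x / 2) ^ (2 * j) / fact j" for j n
  proof (cases "j < n")
    case True
    have "norm (T j n) = falling_ratio n j * ((x / 2) ^ (2 * j) / (fact j * fact (j + 1)))"
      using True falling_ratio_bounds[OF True] unfolding T_def real_norm_def
          by (simp only: if_True, intro abs_alternating_term) auto
    also have "\<dots> \<le> 1 * ((x / 2) ^ (2 * j) / (fact j * fact (j + 1)))"
      by (intro mult_right_mono falling_ratio_bounds True) (simp add: power_mult)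
    also have "\<dots> \<le> (x / 2) ^ (2 * j) / fact j" using over_fact_fact_le[of x j "j + 1"] by simp
    finally show ?thesis .
  qed (simp add: T_def power_mult)
  have "(\<lambda>n. suminf (\<lambda>j. T j n)) \<longlonglongrightarrow> bessel_quotient x"
    unfolding bessel_quotient_def
    by (rule tannerys_theorem[OF lim _ even_power_over_fact_summable[of x], THEN conjunct2, THEN
        conjunct2]) (use bd in \<open>auto intro!: always_eventually\<close>)
  moreover have "\<forall>\<^sub>F n in sequentially. suminf (\<lambda>j. T j n) = zonal_kernel n (1 - x\<^sup>2 / (2
      * (real n)\<^sup>2)) / (real n)\<^sup>2"
    using eventually_gt_at_top[of 0]
  proof eventually_elim
    case (elim n)
    have "suminf (\<lambda>j. T j n) = (\<Sum>j<n. T j n)" by (rule suminf_finite) (auto simp: T_def)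
    also have "\<dots> = (\<Sum>j<n. (- 1) ^ j * falling_ratio n j * ((x / 2) ^ (2 * j) / (fact j * fact (j + 1))))"
      by (rule sum.cong) (auto simp: T_def)
    finally show ?case using elim by (simp add: zonal_kernel_scaled)
  qed
  ultimately show ?thesis by (simp add: tendsto_cong)
qed

text \<open>The expansion around -1 is n times a sum bounded uniformly in \<open>n\<close>, and it
  is divided by n^2.\<close>

lemma zonal_kernel_antipodal_tendsto:
  "(\<lambda>n. zonal_kernel n (- (1 - x\<^sup>2 / (2 * (real n)\<^sup>2))) / (real n)\<^sup>2) \<longlonglongrightarrow> 0"
proof (rule tendsto_0_le[where K = 1])
  define E where "E = (\<Sum>j. (x / 2) ^ (2 * j) / fact j)"
  show "(\<lambda>n. E / real n) \<longlonglongrightarrow> 0" by (rule lim_const_over_n)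
  show "\<forall>\<^sub>F n in sequentially. norm (zonal_kernel n (- (1 - x\<^sup>2 / (2 * (real n)\<^sup>2))) / (real n)\<^sup>2)
      \<le> norm (E / real n) * 1"
    using eventually_gt_at_top[of 0]
  proof eventually_elim
    case (elim n)
    let ?S = "\<Sum>j<n. (- 1) ^ j * falling_ratio n j * ((x / 2) ^ (2 * j) / (fact j * fact j))"
    have "\<bar>?S\<bar> \<le> (\<Sum>j<n. (x / 2) ^ (2 * j) / fact j)"
    proof (rule order_trans[OF sum_abs sum_mono])
      fix j assume "j \<in> {..<n}"
      then have j: "j < n" by simp
      have "\<bar>(- 1) ^ j * falling_ratio n j * ((x / 2) ^ (2 * j) / (fact j * fact j))\<bar>
          = falling_ratio n j * ((x / 2) ^ (2 * j) / (fact j * fact j))"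
        using falling_ratio_bounds[OF j] by (intro abs_alternating_term) auto
      also have "\<dots> \<le> 1 * ((x / 2) ^ (2 * j) / (fact j * fact j))"
        by (intro mult_right_mono falling_ratio_bounds j) (simp add: power_mult)
      also have "\<dots> \<le> (x / 2) ^ (2 * j) / fact j" using over_fact_fact_le[of x j j] by simp
      finally show "\<bar>(- 1) ^ j * falling_ratio n j * ((x / 2) ^ (2 * j) / (fact j * fact j))\<bar> \<le> (x
          / 2) ^ (2 * j) / fact j" .
    qed
    also have "\<dots> \<le> E" unfolding E_def
      by (rule sum_le_suminf[OF even_power_over_fact_summable]) (auto simp: power_mult)
    finally have S: "\<bar>?S\<bar> \<le> E" .
    have "\<bar>zonal_kernel n (- (1 - x\<^sup>2 / (2 * (real n)\<^sup>2)))\<bar> = real n * \<bar>?S\<bar>"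
      unfolding zonal_kernel_scaled'[OF elim] by (simp add: abs_mult power_abs)
    then have "norm (zonal_kernel n (- (1 - x\<^sup>2 / (2 * (real n)\<^sup>2))) / (real n)\<^sup>2) = real n * \<bar>?S\<bar>
        / (real n)\<^sup>2"
      by (simp only: real_norm_def abs_divide abs_power2)
    also have "\<dots> = \<bar>?S\<bar> / real n" by (simp add: power2_eq_square)
    also have "\<dots> \<le> E / real n" using S by (intro divide_right_mono) auto
    also have "\<dots> \<le> norm (E / real n) * 1" by (simp add: divide_right_mono)
    finally show ?case .
  qed
qed

definition rel_kernel :: "nat \<Rightarrow> real \<Rightarrow> real \<Rightarrow> real" where
  "rel_kernel n s t = even_kernel n s t / real (even_dim n)"

lemma rel_kernel_scaled_tendsto:
  "(\<lambda>n. rel_kernel n (1 - x\<^sup>2 / (2 * (real n)\<^sup>2)) (1 - y\<^sup>2 / (2 * (real n)\<^sup>2))) \<longlonglongrightarrow> bessel_quotient x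
      * bessel_quotient y"
proof -
  let ?s = "\<lambda>n. 1 - x\<^sup>2 / (2 * (real n)\<^sup>2)" let ?t = "\<lambda>n. 1 - y\<^sup>2 / (2 * (real n)\<^sup>2)"
  have "(\<lambda>n. (zonal_kernel n (?s n) / (real n)\<^sup>2 * (zonal_kernel n (?t n) / (real n)\<^sup>2)
       + zonal_kernel n (- ?s n) / (real n)\<^sup>2 * (zonal_kernel n (- ?t n) / (real n)\<^sup>2)) / (1 + (1
           / real n)\<^sup>2))
     \<longlonglongrightarrow> (bessel_quotient x * bessel_quotient y + 0 * 0) / (1 + 0\<^sup>2)"
    by (intro tendsto_intros zonal_kernel_scaled_tendsto zonal_kernel_antipodal_tendsto
        lim_const_over_n) auto
  moreover have "\<forall>\<^sub>F n in sequentially. (zonal_kernel n (?s n) / (real n)\<^sup>2 * (zonal_kernel n (?t n)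
      / (real n)\<^sup>2)
       + zonal_kernel n (- ?s n) / (real n)\<^sup>2 * (zonal_kernel n (- ?t n) / (real n)\<^sup>2)) / (1 + (1
           / real n)\<^sup>2) = rel_kernel n (?s n) (?t n)"
    using eventually_gt_at_top[of 0]
  proof eventually_elim
    case (elim n)
    have "(a / m\<^sup>2 * (b / m\<^sup>2) + c / m\<^sup>2 * (d / m\<^sup>2)) / (1 + (1 / m)\<^sup>2) = ((a * b + c * d) / 2)
        / ((m ^ 4 + m\<^sup>2) / 2)"
      if "m > 0" for a b c d m :: real
    proof -
      have "m ^ 4 + m\<^sup>2 = (m\<^sup>2 * m\<^sup>2) * (1 + (1 / m)\<^sup>2)" using that
          by (simp add: field_simps power4_eq_xxxx power2_eq_square)
      moreover have "a / m\<^sup>2 * (b / m\<^sup>2) + c / m\<^sup>2 * (d / m\<^sup>2) = (a * b + c * d) / (m\<^sup>2 * m\<^sup>2)"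
        by (simp add: add_divide_distrib)
      moreover have "(X / 2) / (Y / 2) = X / Y" for X Y :: real by simp
      ultimately show ?thesis by (simp only: divide_divide_eq_left)
    qed
    then show ?case using elim unfolding rel_kernel_def even_kernel_def real_even_dim by auto
  qed
  ultimately show ?thesis by (simp add: tendsto_cong)
qed

text \<open>From the second term on, the absolute values are at most x^2 / 4 times a geometric
  sequence of ratio 1 / 2. The free index \<open>m\<close> allows for both factorial denominators,
  the one at s = 1 and the one at s = -1.\<close>

lemma half_power_tail_bound:
  fixes x :: real
  assumes x: "\<bar>x\<bar> \<le> 1" and n: "n > 0" and r: "\<And>j. j < n \<Longrightarrow> 0 \<le> r j \<and> r j \<le> 1" and r0: "r 0 = 1"
  shows "\<bar>(\<Sum>j<n. (- 1) ^ j * r j * ((x / 2) ^ (2 * j) / (fact j * fact (m j)))) - 1 / fact (m 0)\<bar> \<le> x\<^sup>2 / 2"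
proof -
  define f where "f j = (- 1) ^ j * r j * ((x / 2) ^ (2 * j) / (fact j * fact (m j)))" for j
  obtain k where k: "n = Suc k" using n by (cases n) auto
  have "(\<Sum>j<n. f j) - 1 / fact (m 0) = (\<Sum>j<k. f (Suc j))"
    unfolding k sum.lessThan_Suc_shift by (simp add: f_def r0)
  also have "\<bar>\<dots>\<bar> \<le> (\<Sum>j<k. x\<^sup>2 / 4 * (1 / 2) ^ j)"
  proof (rule order_trans[OF sum_abs sum_mono])
    fix j assume "j \<in> {..<k}"
    then have rj: "0 \<le> r (Suc j)" "r (Suc j) \<le> 1" using r[of "Suc j"] k by auto
    have "\<bar>f (Suc j)\<bar> = r (Suc j) * ((x / 2) ^ (2 * Suc j) / (fact (Suc j) * fact (m (Suc j))))"
      unfolding f_def using rj by (intro abs_alternating_term) (auto simp del: fact_Suc)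
    also have "\<dots> \<le> 1 * ((x / 2) ^ (2 * Suc j) / 1)"
    proof (rule mult_mono)
      have "(1::real) * 1 \<le> fact (Suc j) * fact (m (Suc j))" by (rule mult_mono) (auto simp del: fact_Suc)
      moreover have "0 \<le> (x / 2) ^ (2 * Suc j)" by (rule zero_le_even_power) simp
      ultimately show "(x / 2) ^ (2 * Suc j) / (fact (Suc j) * fact (m (Suc j))) \<le> (x / 2) ^ (2
          * Suc j) / 1"
        by (intro divide_left_mono) (auto simp del: fact_Suc power_Suc mult_Suc_right)
      show "0 \<le> (x / 2) ^ (2 * Suc j) / (fact (Suc j) * fact (m (Suc j)))"
        by (intro divide_nonneg_nonneg zero_le_even_power) (auto simp del: fact_Suc)
    qed (use rj in auto)
    also have "\<dots> = x\<^sup>2 / 4 * ((x / 2)\<^sup>2) ^ j"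
      by (simp only: power_mult power_Suc) (simp add: power_divide)
    also have "\<dots> \<le> x\<^sup>2 / 4 * (1 / 2) ^ j"
    proof -
      have "(x / 2)\<^sup>2 \<le> 1 / 2" using x by (simp add: power_divide abs_square_le_1[symmetric])
      then show ?thesis by (intro mult_left_mono power_mono) auto
    qed
    finally show "\<bar>f (Suc j)\<bar> \<le> x\<^sup>2 / 4 * (1 / 2) ^ j" .
  qed
  also have "\<dots> = x\<^sup>2 / 4 * (\<Sum>j<k. (1 / 2) ^ j)" by (simp add: sum_distrib_left)
  also have "\<dots> \<le> x\<^sup>2 / 4 * 2"
  proof -
    have "(\<Sum>j<k. (1 / 2 :: real) ^ j) = 2 - 2 * (1 / 2) ^ k" by (induction k) (auto simp: field_simps)
    then have "(\<Sum>j<k. (1 / 2 :: real) ^ j) \<le> 2" by simp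
    then show ?thesis by (intro mult_left_mono) auto
  qed
  finally show ?thesis by (simp add: f_def)
qed

lemma one_minus_product_le:
  fixes a b :: real
  assumes "\<bar>a - 1\<bar> \<le> p" "\<bar>b - 1\<bar> \<le> q" "q \<le> 1"
  shows "1 - a * b \<le> 2 * p + q"
proof -
  have "1 - a * b = (1 - a) + (1 - b) - (a - 1) * (b - 1)" by (simp add: algebra_simps)
  moreover have "- ((a - 1) * (b - 1)) \<le> p"
  proof -
    have "\<bar>(a - 1) * (b - 1)\<bar> \<le> p * 1" unfolding abs_mult using assms by (intro mult_mono) auto
    then show ?thesis by simp
  qed
  ultimately show ?thesis using assms by linarith
qed

text \<open>The normalised kernel is the mean of A x A y and B x B y with weights proportional to
  n^4 and n^2, and each of these products is within x^2 + y^2 below 1. Uniformity in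
  \<open>n\<close> is the point: this compensates the singular weight in the dominated
  convergence.\<close>

lemma one_minus_rel_kernel_le:
  assumes n: "n > 0" and xy: "\<bar>x\<bar> \<le> 1" "\<bar>y\<bar> \<le> 1"
  shows "1 - rel_kernel n (1 - x\<^sup>2 / (2 * (real n)\<^sup>2)) (1 - y\<^sup>2 / (2 * (real n)\<^sup>2)) \<le> x\<^sup>2 + y\<^sup>2"
proof -
  define A where "A x = (\<Sum>j<n. (- 1) ^ j * falling_ratio n j * ((x / 2) ^ (2 * j) / (fact j
      * fact (j + 1))))" for x
  define B where "B x = (\<Sum>j<n. (- 1) ^ j * falling_ratio n j * ((x / 2) ^ (2 * j) / (fact j
      * fact j)))" for x
  have r: "0 \<le> falling_ratio n j \<and> falling_ratio n j \<le> 1" if "j < n" for j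
      using falling_ratio_bounds[OF that] by auto
  have r0: "falling_ratio n 0 = 1" by (simp add: falling_ratio_def)
  have A: "\<bar>A z - 1\<bar> \<le> z\<^sup>2 / 2" if "\<bar>z\<bar> \<le> 1" for z
    using half_power_tail_bound[of z n "falling_ratio n" "\<lambda>j. j + 1", OF that n r r0] by (simp add: A_def)
  have B: "\<bar>B z - 1\<bar> \<le> z\<^sup>2 / 2" if "\<bar>z\<bar> \<le> 1" for z
    using half_power_tail_bound[of z n "falling_ratio n" "\<lambda>j. j", OF that n r r0] by (simp add: B_def)
  have sq: "x\<^sup>2 \<le> 1" "y\<^sup>2 \<le> 1" using xy by (auto simp: abs_square_le_1)
  have AB: "1 - A x * A y \<le> x\<^sup>2 + y\<^sup>2" "1 - B x * B y \<le> x\<^sup>2 + y\<^sup>2"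
    by (rule order_trans[OF one_minus_product_le[OF A[OF xy(1)] A[OF xy(2)]]]; use sq in simp)
       (rule order_trans[OF one_minus_product_le[OF B[OF xy(1)] B[OF xy(2)]]]; use sq in simp)
  define N where "N = real n"
  have N: "N > 0" using n by (simp add: N_def)
  have ss: "(- 1) ^ (n - 1) * b * ((- 1) ^ (n - 1) * c) = b * c" for b c :: real
  proof -
    have "(- 1) ^ (n - 1) * (- 1) ^ (n - 1) = (1::real)" by (simp add: minus_one_power_iff)
    moreover have "(- 1) ^ (n - 1) * b * ((- 1) ^ (n - 1) * c) = ((- 1) ^ (n - 1) * (- 1) ^ (n - 1))
        * (b * c)"
      by (simp only: mult_ac)
    ultimately show ?thesis by (simp only: mult_1)
  qed
  have "rel_kernel n (1 - x\<^sup>2 / (2 * (real n)\<^sup>2)) (1 - y\<^sup>2 / (2 * (real n)\<^sup>2))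
      = (N ^ 4 * (A x * A y) + N\<^sup>2 * (B x * B y)) / (N ^ 4 + N\<^sup>2)"
  proof -
    have "N\<^sup>2 * a * (N\<^sup>2 * b) = N ^ 4 * (a * b)" "N * a * (N * b) = N\<^sup>2 * (a * b)" for a b
      by (simp_all add: power4_eq_xxxx power2_eq_square)
    moreover have "(X / 2) / (Y / 2) = X / Y" for X Y :: real by simp
    moreover have "zonal_kernel n (1 - z\<^sup>2 / (2 * (real n)\<^sup>2)) = N\<^sup>2 * A z"
      "zonal_kernel n (- (1 - z\<^sup>2 / (2 * (real n)\<^sup>2))) = (- 1) ^ (n - 1) * (N * B z)" for z
      by (simp_all only: zonal_kernel_scaled[OF n] zonal_kernel_scaled'[OF n] A_def B_def N_def)
    moreover have "real (even_dim n) = (N ^ 4 + N\<^sup>2) / 2" by (simp add: real_even_dim N_def)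
    ultimately show ?thesis by (simp only: rel_kernel_def even_kernel_def ss)
  qed
  then have "1 - rel_kernel n (1 - x\<^sup>2 / (2 * (real n)\<^sup>2)) (1 - y\<^sup>2 / (2 * (real n)\<^sup>2))
      = (N ^ 4 * (1 - A x * A y) + N\<^sup>2 * (1 - B x * B y)) / (N ^ 4 + N\<^sup>2)"
  proof -
    have "N ^ 4 + N\<^sup>2 > 0" using N by (simp add: add_pos_pos)
    then have "1 - X / (N ^ 4 + N\<^sup>2) = (N ^ 4 + N\<^sup>2 - X) / (N ^ 4 + N\<^sup>2)" for X
        by (simp add: diff_divide_distrib)
    then show ?thesis unfolding \<open>_ = (N ^ 4 * (A x * A y) + N\<^sup>2 * (B x * B y)) / (N ^ 4 + N\<^sup>2)\<close>
        by (simp add: algebra_simps)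
  qed
  also have "\<dots> \<le> (N ^ 4 * (x\<^sup>2 + y\<^sup>2) + N\<^sup>2 * (x\<^sup>2 + y\<^sup>2)) / (N ^ 4 + N\<^sup>2)"
    using AB N by (intro divide_right_mono add_mono mult_left_mono) auto
  also have "\<dots> = x\<^sup>2 + y\<^sup>2"
  proof -
    have "N ^ 4 + N\<^sup>2 > 0" using N by (simp add: add_pos_pos)
    then show ?thesis by (simp flip: distrib_right)
  qed
  finally show ?thesis .
qed

text \<open>Nonnegativity of \<open>det2\<close> for two points whose inner products are the
  prescribed heights; \<open>e s\<close> is a unit vector at height \<open>s\<close> above
  \<open>e 1\<close>.\<close>

lemma rel_kernel_abs_le_1:
  assumes n: "n > 0" and st: "\<bar>s\<bar> \<le> 1" "\<bar>t\<bar> \<le> 1"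
  shows "\<bar>rel_kernel n s t\<bar> \<le> 1"
proof -
  define e where "e s = (vector [s, sqrt (1 - s\<^sup>2), 0] :: real ^ 3)" for s
  have norm_e: "norm (e s) = 1" if "\<bar>s\<bar> \<le> 1" for s
  proof -
    have "s\<^sup>2 \<le> 1" using that by (simp add: abs_square_le_1)
    then show ?thesis by (simp add: e_def norm_vec_def L2_set_def sum_3)
  qed
  have inn: "e 1 \<bullet> e s = s" for s by (simp add: e_def inner_vec_def sum_3)
  have K: "reproducing_kernel sphere_pair (pair_kernel n) (real (even_dim n))"
      by (rule reproducing_pair_kernel[OF n])
  have "0 \<le> det2 (pair_kernel n) (e 1, e 1) (e s, e t)"
    using st by (intro sphere_pair.P.det2_nonneg[OF K]) (auto simp: space_sphere_pair norm_e)
  moreover have diag: "pair_kernel n (e s, e t) (e s, e t) = real (even_dim n)" if "\<bar>s\<bar> \<le> 1" "\<bar>t\<bar>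
      \<le> 1" for s t
    using n zonal_kernel_1[OF n] zonal_kernel_minus_1[OF n] norm_e[OF that(1)] norm_e[OF that(2)]
    by (simp add: pair_kernel_def even_kernel_def real_even_dim dot_square_norm flip: power2_eq_square)
  ultimately have "(even_kernel n s t)\<^sup>2 \<le> (real (even_dim n))\<^sup>2"
    using diag[of 1 1] diag[OF st] by (simp add: det2_def pair_kernel_def inn power2_eq_square)
  then have "\<bar>even_kernel n s t\<bar> \<le> real (even_dim n)"
    using abs_le_square_iff[of "even_kernel n s t" "real (even_dim n)"] by simp
  moreover have "real (even_dim n) > 0" using n by (simp add: real_even_dim add_pos_pos)
  ultimately show ?thesis by (simp add: rel_kernel_def)
qed

section \<open>The mean energy near and away from the diagonal\<close>

lemma zonal_kernel_measurable [measurable]: "zonal_kernel n \<in> borel_measurable borel"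
  by (intro borel_measurable_continuous_onI continuous_intros)

lemma rel_kernel_measurable [measurable (raw)]:
  assumes [measurable]: "f \<in> borel_measurable M" "g \<in> borel_measurable M"
  shows "(\<lambda>z. rel_kernel n (f z) (g z)) \<in> borel_measurable M"
  unfolding rel_kernel_def even_kernel_def by measurable

lemma cutoff_riesz_measurable [measurable (raw)]:
  assumes [measurable]: "f \<in> borel_measurable M" "g \<in> borel_measurable M"
  shows "(\<lambda>z. cutoff_riesz \<epsilon> (f z) (g z)) \<in> borel_measurable M"
  unfolding cutoff_riesz_def by measurable

abbreviation lborel2 :: "(real \<times> real) measure" where "lborel2 \<equiv> lborel \<Otimes>\<^sub>M lborel"

lemma nn_integral_lborel2:
  assumes "(\<lambda>z. f (fst z) (snd z)) \<in> borel_measurable lborel2"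
  shows "(\<integral>\<^sup>+z. f (fst z) (snd z) \<partial>lborel2) = (\<integral>\<^sup>+t. (\<integral>\<^sup>+s. f s t \<partial>lborel) \<partial>lborel)"
    and "(\<integral>\<^sup>+z. f (fst z) (snd z) \<partial>lborel2) = (\<integral>\<^sup>+s. (\<integral>\<^sup>+t. f s t \<partial>lborel) \<partial>lborel)"
  using lborel_pair.nn_integral_snd[of "\<lambda>z. f (fst z) (snd z)"] lborel.nn_integral_fst[of "\<lambda>z. f
      (fst z) (snd z)" lborel] assms
  by simp_all

lemma nn_integral_interval:
  fixes f :: "real \<Rightarrow> ennreal"
  assumes [measurable]: "f \<in> borel_measurable borel"
  shows "(\<integral>\<^sup>+x. f x \<partial>interval_measure_pm1) = (\<integral>\<^sup>+x. ennreal (indicator {-1..1} x / 2) * f x \<partial>lborel)"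
  unfolding interval_measure_pm1_def by (subst nn_integral_density) auto

lemma half_ennreal: "1 / 2 * ennreal a = ennreal (a / 2)"
proof -
  have "ennreal (a / 2) = ennreal (1 / 2 * a)" by simp
  also have "\<dots> = ennreal (1 / 2) * ennreal a" by (rule ennreal_mult') simp
  also have "ennreal (1 / 2) = 1 / 2" using divide_ennreal[of 1 2] by simp
  finally show ?thesis by simp
qed

text \<open>The passage to nonnegative integrals, where Tonelli and Fatou apply without
  integrability. The factor 1 / 4 is the density of the uniform measure on the square.\<close>

lemma interval_pair_nn_integral:
  fixes F :: "real \<Rightarrow> real \<Rightarrow> real"
  assumes F: "(\<lambda>z. F (fst z) (snd z)) \<in> borel_measurable (borel \<Otimes>\<^sub>M borel)"
    and Fnn: "\<And>s t. s \<in> {-1..1} \<Longrightarrow> t \<in> {-1..1} \<Longrightarrow> 0 \<le> F s t \<and> F s t \<le> B"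
  shows "ennreal (\<integral>t. (\<integral>s. F s t \<partial>interval_measure_pm1) \<partial>interval_measure_pm1) =
    (\<integral>\<^sup>+z. ennreal (F (fst z) (snd z) / 4) * indicator ({-1..1} \<times> {-1..1}) z \<partial>lborel2)"
proof -
  let ?I = interval_measure_pm1
  have Fm [measurable (raw)]: "(\<lambda>z. F (f z) (h z)) \<in> borel_measurable M"
    if [measurable]: "f \<in> borel_measurable M" "h \<in> borel_measurable M" for M :: "'z measure" and f h
    using measurable_compose[OF _ F, of "\<lambda>z. (f z, h z)" M] by simp
  interpret II: pair_prob_space ?I ?I ..
  have ae: "AE z in ?I \<Otimes>\<^sub>M ?I. fst z \<in> {-1..1} \<and> snd z \<in> {-1..1}"
    by (intro II.AE_pair_measure) (measurable, use interval_AE in auto)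
  have int: "integrable (?I \<Otimes>\<^sub>M ?I) (\<lambda>z. F (fst z) (snd z))"
  proof (rule II.P.integrable_const_bound[of _ B])
    show "AE z in ?I \<Otimes>\<^sub>M ?I. norm (F (fst z) (snd z)) \<le> B"
      using ae by eventually_elim (use Fnn in auto)
  qed measurable
  have Fae: "AE z in ?I \<Otimes>\<^sub>M ?I. 0 \<le> F (fst z) (snd z)"
    using ae by eventually_elim (use Fnn in auto)
  have "(\<integral>t. (\<integral>s. F s t \<partial>?I) \<partial>?I) = (\<integral>z. F (fst z) (snd z) \<partial>(?I \<Otimes>\<^sub>M ?I))"
    using II.integral_snd[of F] int by (simp add: case_prod_beta')
  then have "ennreal (\<integral>t. (\<integral>s. F s t \<partial>?I) \<partial>?I) = (\<integral>\<^sup>+z. ennreal (F (fst z) (snd z)) \<partial>(?I \<Otimes>\<^sub>M ?I))"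
    by (subst nn_integral_eq_integral[OF int Fae]) simp
  also have "\<dots> = (\<integral>\<^sup>+t. (\<integral>\<^sup>+s. ennreal (F s t) \<partial>?I) \<partial>?I)"
    using II.nn_integral_snd[of "\<lambda>z. ennreal (F (fst z) (snd z))"] by simp
  also have "\<dots> = (\<integral>\<^sup>+t. ennreal (indicator {-1..1} t / 2) * (\<integral>\<^sup>+s. ennreal (indicator {-1..1} s / 2)
      * ennreal (F s t) \<partial>lborel) \<partial>lborel)"
    by (subst nn_integral_interval; (subst nn_integral_interval)?) measurable
  also have "\<dots> = (\<integral>\<^sup>+t. (\<integral>\<^sup>+s. ennreal (F s t / 4) * indicator ({-1..1} \<times> {-1..1}) (s, t) \<partial>lborel) \<partial>lborel)"
  proof (rule nn_integral_cong)
    fix t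
    have "ennreal (indicator {-1..1} t / 2) * (\<integral>\<^sup>+s. ennreal (indicator {-1..1} s / 2)
        * ennreal (F s t) \<partial>lborel)
      = (\<integral>\<^sup>+s. ennreal (indicator {-1..1} t / 2) * (ennreal (indicator {-1..1} s / 2)
          * ennreal (F s t)) \<partial>lborel)"
      by (rule nn_integral_cmult[symmetric]) measurable
    also have "\<dots> = (\<integral>\<^sup>+s. ennreal (F s t / 4) * indicator ({-1..1} \<times> {-1..1}) (s, t) \<partial>lborel)"
    proof (rule nn_integral_cong)
      fix s
      have "1 / 2 * (1 / 2 * ennreal (F s t)) = ennreal (F s t / 4)" by (simp only: half_ennreal) simp
      moreover have "ennreal (1 / 2) = 1 / 2" using half_ennreal[of 1] by simp
      ultimately show "ennreal (indicator {-1..1} t / 2) * (ennreal (indicator {-1..1} s / 2)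
          * ennreal (F s t)) = ennreal (F s t / 4) * indicator ({-1..1} \<times> {-1..1}) (s, t)"
        by (auto split: split_indicator simp del: times_divide_eq_left)
    qed
    finally show "ennreal (indicator {-1..1} t / 2) * (\<integral>\<^sup>+s. ennreal (indicator {-1..1} s / 2)
        * ennreal (F s t) \<partial>lborel) = \<dots>" .
  qed
  also have "\<dots> = (\<integral>\<^sup>+z. ennreal (F (fst z) (snd z) / 4)
      * indicator ({-1..1} \<times> {-1..1}) (fst z, snd z) \<partial>lborel2)"
    by (rule nn_integral_lborel2(1)[symmetric]) measurable
  finally show ?thesis by simp
qed

lemma mean_energy_nn_integral:
  assumes n: "n > 0" and \<epsilon>: "\<epsilon> > 0"
  shows "ennreal (mean_energy n \<epsilon> / (real (even_dim n))\<^sup>2) =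
    (\<integral>\<^sup>+z. ennreal (cutoff_riesz \<epsilon> (fst z) (snd z) * (1 - (rel_kernel n (fst z) (snd z))\<^sup>2) / 4)
       * indicator ({-1..1} \<times> {-1..1}) z \<partial>lborel2)"
proof -
  let ?N = "real (even_dim n)"
  define F where "F s t = cutoff_riesz \<epsilon> s t * (1 - (rel_kernel n s t)\<^sup>2)" for s t
  have N: "?N > 0" using n by (simp add: real_even_dim add_pos_pos)
  have Fnn: "0 \<le> F s t \<and> F s t \<le> 1 / \<epsilon>\<^sup>2" if "s \<in> {-1..1}" "t \<in> {-1..1}" for s t
  proof -
    have "\<bar>rel_kernel n s t\<bar> \<le> 1" using that by (intro rel_kernel_abs_le_1 n) auto
    then have r: "(rel_kernel n s t)\<^sup>2 \<le> 1" by (simp add: abs_square_le_1)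
    have c: "0 \<le> cutoff_riesz \<epsilon> s t" "cutoff_riesz \<epsilon> s t \<le> 1 / \<epsilon>\<^sup>2"
      unfolding cutoff_riesz_def using \<epsilon> by (auto intro!: divide_left_mono power_mono)
    have "F s t \<le> 1 / \<epsilon>\<^sup>2 * 1" unfolding F_def using r c by (intro mult_mono) auto
    then show ?thesis using r c unfolding F_def by auto
  qed
  have "cutoff_riesz \<epsilon> s t * (?N\<^sup>2 - (even_kernel n s t)\<^sup>2) = ?N\<^sup>2 * F s t" for s t
    using N by (simp add: F_def rel_kernel_def power_divide algebra_simps)
  then have "mean_energy n \<epsilon> / ?N\<^sup>2 = (\<integral>t. (\<integral>s. F s t \<partial>interval_measure_pm1) \<partial>interval_measure_pm1)"
    using N by (simp add: mean_energy_def)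
  moreover have "(\<lambda>z. F (fst z) (snd z)) \<in> borel_measurable (borel \<Otimes>\<^sub>M borel)"
    unfolding F_def by measurable
  ultimately show ?thesis using interval_pair_nn_integral[of F, OF _ Fnn] by (simp add: F_def)
qed

text \<open>The square has two singular corners, (1, 1) and (-1, -1), exchanged by the symmetry. The
  half with \<open>s\<close> nonnegative keeps only the first.\<close>

lemma nn_integral_even_reflect:
  fixes g :: "real \<Rightarrow> real \<Rightarrow> ennreal"
  assumes [measurable]: "(\<lambda>z. g (fst z) (snd z)) \<in> borel_measurable (borel \<Otimes>\<^sub>M borel)"
    and even: "\<And>s t. g (- s) (- t) = g s t"
  shows "(\<integral>\<^sup>+z. g (fst z) (snd z) * indicator ({-1..1} \<times> {-1..1}) z \<partial>lborel2)
    = 2 * (\<integral>\<^sup>+z. g (fst z) (snd z) * indicator ({0..1} \<times> {-1..1}) z \<partial>lborel2)"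
proof -
  have gm [measurable (raw)]: "(\<lambda>z. g (f z) (h z)) \<in> borel_measurable M"
    if [measurable]: "f \<in> borel_measurable M" "h \<in> borel_measurable M" for M :: "'z measure" and f h
    using measurable_compose[of "\<lambda>z. (f z, h z)" M "borel \<Otimes>\<^sub>M borel" "\<lambda>z. g (fst z) (snd z)" borel] by simp
  let ?J = "\<lambda>A. (\<integral>\<^sup>+z. g (fst z) (snd z) * indicator (A \<times> {-1..1}) z \<partial>lborel2)"
  have it: "?J A = (\<integral>\<^sup>+t. (\<integral>\<^sup>+s. g s t * (indicator A s * indicator {-1..1} t) \<partial>lborel) \<partial>lborel)"
    if [measurable]: "A \<in> sets borel" for A
    using nn_integral_lborel2(1)[of "\<lambda>s t. g s t * indicator (A \<times> {-1..1}) (s, t)"]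
    by (simp add: indicator_times)
  have "?J {-1..<0} = (\<integral>\<^sup>+t. (\<integral>\<^sup>+s. g s t * (indicator {-1..<0} s * indicator {-1..1} t) \<partial>lborel) \<partial>lborel)"
    by (rule it) simp
  also have "\<dots> = (\<integral>\<^sup>+t. (\<integral>\<^sup>+s. g (- s) t * (indicator {-1..<0} (- s)
      * indicator {-1..1} t) \<partial>lborel) \<partial>lborel)"
    by (rule nn_integral_cong, subst nn_integral_real_affine[where c = "-1" and t = 0]) auto
  also have "\<dots> = (\<integral>\<^sup>+t. (\<integral>\<^sup>+s. g (- s) (- t) * (indicator {-1..<0} (- s)
      * indicator {-1..1} (- t)) \<partial>lborel) \<partial>lborel)"
    by (subst nn_integral_real_affine[where c = "-1" and t = 0]) auto
  also have "\<dots> = (\<integral>\<^sup>+t. (\<integral>\<^sup>+s. g s t * (indicator {0<..1} s * indicator {-1..1} t) \<partial>lborel) \<partial>lborel)"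
    unfolding even by (intro nn_integral_cong) (auto split: split_indicator)
  also have "\<dots> = (\<integral>\<^sup>+t. (\<integral>\<^sup>+s. g s t * (indicator {0..1} s * indicator {-1..1} t) \<partial>lborel) \<partial>lborel)"
  proof (rule nn_integral_cong, rule nn_integral_cong_AE)
    fix t
    show "AE s in lborel. g s t * (indicator {0<..1} s * indicator {-1..1} t) = g s t
        * (indicator {0..1} s * indicator {-1..1} t)"
      using AE_lborel_singleton[of 0] by eventually_elim (auto split: split_indicator)
  qed
  also have "\<dots> = ?J {0..1}" by (rule it[symmetric]) simp
  finally have neg: "?J {-1..<0} = ?J {0..1}" .
  have "?J {-1..1} = (\<integral>\<^sup>+z. g (fst z) (snd z) * indicator ({-1..<0} \<times> {-1..1}) z + g (fst z) (snd z)
      * indicator ({0..1} \<times> {-1..1}) z \<partial>lborel2)"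
    by (intro nn_integral_cong) (auto split: split_indicator)
  also have "\<dots> = ?J {-1..<0} + ?J {0..1}" by (intro nn_integral_add) measurable
  finally show ?thesis unfolding neg by (simp add: mult_2)
qed

text \<open>Integrate over t, then over s on both sides of 1 - \<delta>. The part below gives - ln
  \<delta> + ln (2 - \<delta>). In the strip above, the factors of 1 - c^2 cancel and exactly ln 2
  is left.\<close>

lemma nn_integral_riesz_outside:
  assumes \<delta>: "0 < \<delta>" "\<delta> \<le> 1 / 2"
  shows "(\<integral>\<^sup>+z. ennreal (1 / (1 - fst z * snd z)\<^sup>2) * indicator ({0..1} \<times> {-1..1} - {1 - \<delta><..1} \<times> {1
      - \<delta><..1}) z \<partial>lborel2)
    = ennreal (- ln \<delta> + ln (2 - \<delta>) + ln 2)"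
proof -
  define c where "c = 1 - \<delta>"
  have c: "1 / 2 \<le> c" "c < 1" using \<delta> by (auto simp: c_def)
  let ?w = "\<lambda>s t :: real. ennreal (1 / (1 - s * t)\<^sup>2)"
  \<comment> \<open>The antiderivative t / (1 - s t) does not divide by \<open>s\<close>, so s = 0
    is no special case.\<close>
  have inner: "(\<integral>\<^sup>+t. ?w s t * indicator {a..b} t \<partial>lborel) = ennreal (b / (1 - s * b) - a / (1 - s * a))"
    if "a \<le> b" "\<And>t. t \<in> {a..b} \<Longrightarrow> 1 - s * t > 0" for s a b :: real
  proof (rule nn_integral_FTC_Icc)
    show "((\<lambda>t. t / (1 - s * t)) has_real_derivative 1 / (1 - s * t)\<^sup>2) (at t)" if "t \<in> {a..b}" for t
    proof -
      have "1 - s * t > 0" using that \<open>\<And>t. t \<in> {a..b} \<Longrightarrow> 1 - s * t > 0\<close> by blast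
      then show ?thesis by (auto intro!: derivative_eq_intros simp: power2_eq_square)
    qed
  qed (use that in auto)
  have "(\<integral>\<^sup>+z. ?w (fst z) (snd z) * indicator ({0..1} \<times> {-1..1} - {1 - \<delta><..1} \<times> {1
      - \<delta><..1}) (fst z, snd z) \<partial>lborel2)
     = (\<integral>\<^sup>+s. (\<integral>\<^sup>+t. ?w s t * indicator ({0..1} \<times> {-1..1} - {c<..1} \<times> {c<..1}) (s, t) \<partial>lborel) \<partial>lborel)"
    unfolding c_def by (rule nn_integral_lborel2(2)) measurable
  also have "\<dots> = (\<integral>\<^sup>+s. ennreal (1 / (1 - s) + 1 / (1 + s)) * indicator {0..c} s + ennreal (c / (1
      - c * s) + 1 / (1 + s)) * indicator {c..1} s \<partial>lborel)"
  proof (rule nn_integral_cong_AE)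
    show "AE s in lborel. (\<integral>\<^sup>+t. ?w s t * indicator ({0..1} \<times> {-1..1} - {c<..1} \<times> {c<..1}) (s, t) \<partial>lborel)
      = ennreal (1 / (1 - s) + 1 / (1 + s)) * indicator {0..c} s + ennreal (c / (1 - c * s) + 1 / (1
          + s)) * indicator {c..1} s"
      using AE_lborel_singleton[of c]
    proof eventually_elim
      case (elim s)
      consider "s \<in> {0..<c}" | "s \<in> {c<..1}" | "s \<notin> {0..1}" using elim c by force
      then show ?case
      proof cases
        case 1
        have "1 - s * t > 0" if "t \<in> {-1..1}" for t
          using mult_left_mono[of t 1 s] 1 c that by auto
        then have "(\<integral>\<^sup>+t. ?w s t * indicator {-1..1} t \<partial>lborel) = ennreal (1 / (1 - s * 1) - (-1)
            / (1 - s * (-1)))"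
          by (intro inner) auto
        moreover have "indicator ({0..1} \<times> {-1..1} - {c<..1} \<times> {c<..1}) (s, t)
            = (indicator {-1..1} t :: ennreal)" for t
          using 1 c by (auto split: split_indicator)
        ultimately show ?thesis using 1 c by (simp add: add.commute)
      next
        case 2
        have "1 - s * t > 0" if "t \<in> {-1..c}" for t
        proof -
          have "s * t \<le> s * c" using 2 c that by (intro mult_left_mono) auto
          also have "s * c \<le> 1 * c" using 2 c by (intro mult_right_mono) auto
          finally show ?thesis using c by simp
        qed
        then have "(\<integral>\<^sup>+t. ?w s t * indicator {-1..c} t \<partial>lborel) = ennreal (c / (1 - s * c) - (-1)
            / (1 - s * (-1)))"
          using c by (intro inner) auto
        moreover have "indicator ({0..1} \<times> {-1..1} - {c<..1} \<times> {c<..1}) (s, t)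
            = (indicator {-1..c} t :: ennreal)" for t
          using 2 c by (auto split: split_indicator)
        ultimately show ?thesis using 2 c by (simp add: mult.commute)
      next
        case 3
        then show ?thesis using c by (auto split: split_indicator)
      qed
    qed
  qed
  also have "\<dots> = (\<integral>\<^sup>+s. ennreal (1 / (1 - s) + 1 / (1 + s)) * indicator {0..c} s \<partial>lborel)
      + (\<integral>\<^sup>+s. ennreal (c / (1 - c * s) + 1 / (1 + s)) * indicator {c..1} s \<partial>lborel)"
    by (intro nn_integral_add) measurable
  also have "(\<integral>\<^sup>+s. ennreal (1 / (1 - s) + 1 / (1 + s)) * indicator {0..c} s \<partial>lborel)
      = ennreal ((- ln (1 - c) + ln (1 + c)) - (- ln (1 - 0) + ln (1 + 0)))"
  proof (rule nn_integral_FTC_Icc)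
    show "((\<lambda>s. - ln (1 - s) + ln (1 + s)) has_real_derivative 1 / (1 - s) + 1 / (1 + s)) (at s)"
        if "s \<in> {0..c}" for s
      using that c by (auto intro!: derivative_eq_intros)
  qed (use c in auto)
  also have "(\<integral>\<^sup>+s. ennreal (c / (1 - c * s) + 1 / (1 + s)) * indicator {c..1} s \<partial>lborel)
      = ennreal ((- ln (1 - c * 1) + ln (1 + 1)) - (- ln (1 - c * c) + ln (1 + c)))"
  proof (rule nn_integral_FTC_Icc)
    have "0 \<le> c" using c by simp
    then have pos: "1 - c * s > 0" if "s \<in> {c..1}" for s using mult_left_mono[of s 1 c] c(2) that by auto
    show "((\<lambda>s. - ln (1 - c * s) + ln (1 + s)) has_real_derivative c / (1 - c * s) + 1 / (1
        + s)) (at s)" if "s \<in> {c..1}" for s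
      using pos[OF that] that c by (auto intro!: derivative_eq_intros)
    show "0 \<le> c / (1 - c * s) + 1 / (1 + s)" if "s \<in> {c..1}" for s
      using pos[OF that] that c by simp
  qed (use c in auto)
  also have "ln (1 - c * c) = ln (1 - c) + ln (1 + c)"
  proof -
    have "1 - c * c = (1 - c) * (1 + c)" by (simp add: algebra_simps)
    then show ?thesis using c by (simp add: ln_mult)
  qed
  also have "ennreal ((- ln (1 - c) + ln (1 + c)) - (- ln (1 - 0) + ln (1 + 0))) + ennreal ((- ln (1
      - c * 1) + ln (1 + 1)) - (- (ln (1 - c) + ln (1 + c)) + ln (1 + c)))
     = ennreal (- ln \<delta> + ln (2 - \<delta>) + ln 2)"
  proof -
    have e: "1 - c * 1 = \<delta>" "1 - c = \<delta>" "1 + c = 2 - \<delta>" by (simp_all add: c_def)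
    have "ln \<delta> \<le> 0" "0 \<le> ln (2 - \<delta>)" using \<delta> by auto
    then show ?thesis unfolding e by (simp flip: ennreal_plus)
  qed
  finally show ?thesis by simp
qed

text \<open>The factor 1 / 2 is the density 1 / 4 doubled by the reflection. The width of the corner
  corresponds to x = 1 and y = 1 after rescaling.\<close>

definition core_energy :: "nat \<Rightarrow> ennreal" where
  "core_energy n = (\<integral>\<^sup>+z. ennreal (1 / (1 - fst z * snd z)\<^sup>2 * (1 - (rel_kernel n (fst z) (snd z))\<^sup>2) / 2)
     * indicator ({1 - 1 / (2 * (real n)\<^sup>2)<..1} \<times> {1 - 1 / (2 * (real n)\<^sup>2)<..1}) z \<partial>lborel2)"

text \<open>This part is subtracted from the energy, so a smaller domain still gives an upper bound:
  the half with negative \<open>t\<close>, which does not matter in the limit, is left out.\<close>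

definition outer_energy :: "nat \<Rightarrow> ennreal" where
  "outer_energy n = (\<integral>\<^sup>+z. ennreal (1 / (1 - fst z * snd z)\<^sup>2 * (rel_kernel n (fst z) (snd z))\<^sup>2 / 2)
     * indicator ({0..1} \<times> {0..1} - {1 - 1 / (2 * (real n)\<^sup>2)<..1} \<times> {1 - 1 / (2
         * (real n)\<^sup>2)<..1}) z \<partial>lborel2)"

definition log_energy :: "nat \<Rightarrow> real" where
  "log_energy n = (let \<delta> = 1 / (2 * (real n)\<^sup>2) in (- ln \<delta> + ln (2 - \<delta>) + ln 2) / 2)"

text \<open>The subtracted part stands on the left, because subtraction of extended nonnegative
  reals truncates. The right side is free of \<epsilon>, which is what allows \<epsilon> to be fixed
  afterwards.\<close>

lemma mean_energy_bound:
  assumes n: "n > 0" and \<epsilon>: "0 < \<epsilon>" "\<epsilon> \<le> 1 / (2 * (real n)\<^sup>2)"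
  shows "ennreal (mean_energy n \<epsilon> / (real (even_dim n))\<^sup>2) + outer_energy n \<le> core_energy n
      + ennreal (log_energy n)"
proof -
  define \<delta> where "\<delta> = 1 / (2 * (real n)\<^sup>2)"
  have "(real n)\<^sup>2 \<ge> 1" using n by simp
  then have \<delta>: "0 < \<delta>" "\<delta> \<le> 1 / 2" "\<epsilon> \<le> \<delta>" using n \<epsilon> by (auto simp: \<delta>_def field_simps)
  let ?C = "{1 - \<delta><..1} \<times> {1 - \<delta><..1}"
  let ?H = "{0..1::real} \<times> {-1..1::real}"
  let ?r = "\<lambda>z. (rel_kernel n (fst z) (snd z))\<^sup>2"
  let ?w = "\<lambda>z. 1 / (1 - fst z * snd z)\<^sup>2 :: real"
  let ?v = "\<lambda>z. cutoff_riesz \<epsilon> (fst z) (snd z)"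
  have neg: "rel_kernel n (- s) (- t) = rel_kernel n s t" "cutoff_riesz \<epsilon> (- s) (- t)
      = cutoff_riesz \<epsilon> s t" for s t
    by (simp_all add: rel_kernel_def even_kernel_def cutoff_riesz_def add.commute)
  have r1: "0 \<le> ?r z" "?r z \<le> 1" if "z \<in> ?H" for z
    using rel_kernel_abs_le_1[OF n, of "fst z" "snd z"] that by (auto simp: abs_square_le_1)
  have "ennreal (mean_energy n \<epsilon> / (real (even_dim n))\<^sup>2) =
    2 * (\<integral>\<^sup>+z. ennreal (?v z * (1 - ?r z) / 4) * indicator ?H z \<partial>lborel2)"
    unfolding mean_energy_nn_integral[OF n \<epsilon>(1)]
    by (rule nn_integral_even_reflect) (auto simp: neg)
  also have "\<dots> = (\<integral>\<^sup>+z. 2 * (ennreal (?v z * (1 - ?r z) / 4) * indicator ?H z) \<partial>lborel2)"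
    by (rule nn_integral_cmult[symmetric]) measurable
  also have "\<dots> = (\<integral>\<^sup>+z. ennreal (?v z * (1 - ?r z) / 2) * indicator ?H z \<partial>lborel2)"
  proof (rule nn_integral_cong)
    fix z
    have "2 * ennreal a = ennreal (2 * a)" for a by (simp add: ennreal_mult')
    then show "2 * (ennreal (?v z * (1 - ?r z) / 4) * indicator ?H z) = ennreal (?v z * (1 - ?r z)
        / 2) * indicator ?H z"
      by (simp flip: mult.assoc)
  qed
  finally have m: "ennreal (mean_energy n \<epsilon> / (real (even_dim n))\<^sup>2) + outer_energy n
    = (\<integral>\<^sup>+z. ennreal (?v z * (1 - ?r z) / 2) * indicator ?H z + ennreal (?w z * ?r z / 2)
        * indicator ({0..1} \<times> {0..1} - ?C) z \<partial>lborel2)"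
    unfolding outer_energy_def \<delta>_def[symmetric] by (subst nn_integral_add) (simp_all, measurable)
  have "ennreal (log_energy n) = (1 / 2) * ennreal (- ln \<delta> + ln (2 - \<delta>) + ln 2)"
    unfolding log_energy_def Let_def \<delta>_def[symmetric] by (rule half_ennreal[symmetric])
  also have "\<dots> = (\<integral>\<^sup>+z. (1 / 2) * (ennreal (?w z) * indicator (?H - ?C) z) \<partial>lborel2)"
    unfolding nn_integral_riesz_outside[OF \<delta>(1,2), symmetric]
        by (rule nn_integral_cmult[symmetric]) measurable
  also have "\<dots> = (\<integral>\<^sup>+z. ennreal (?w z / 2) * indicator (?H - ?C) z \<partial>lborel2)"
  proof (rule nn_integral_cong)
    fix z
    show "(1 / 2) * (ennreal (?w z) * indicator (?H - ?C) z) = ennreal (?w z / 2) * indicator (?H - ?C) z"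
      by (simp only: mult.assoc[symmetric] half_ennreal)
  qed
  finally have l: "core_energy n + ennreal (log_energy n) =
     (\<integral>\<^sup>+z. ennreal (?w z * (1 - ?r z) / 2) * indicator ?C z + ennreal (?w z / 2) * indicator (?H
         - ?C) z \<partial>lborel2)"
    unfolding core_energy_def \<delta>_def[symmetric] by (subst nn_integral_add) (simp_all, measurable)
  show ?thesis unfolding m l
  proof (rule nn_integral_mono_AE)
    \<comment> \<open>Off this null line s t < 1 in the corner. At s = t = 1 the quotient 1 / 0 is
      0, and the cut-off weight would not be below the true one.\<close>
    have "AE z in lborel2. fst z \<noteq> (1::real)"
    proof (rule lborel_pair.AE_pair_measure)
      show "AE x in lborel. AE y in (lborel::real measure). fst (x, y) \<noteq> (1::real)"
        using AE_lborel_singleton[of 1] by eventually_elim simp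
    qed measurable
    then show "AE z in lborel2. ennreal (?v z * (1 - ?r z) / 2) * indicator ?H z + ennreal (?w z
        * ?r z / 2) * indicator ({0..1} \<times> {0..1} - ?C) z
       \<le> ennreal (?w z * (1 - ?r z) / 2) * indicator ?C z + ennreal (?w z / 2) * indicator (?H - ?C) z"
    proof eventually_elim
      case (elim z)
      obtain s t where z: "z = (s, t)" by (cases z)
      consider "z \<in> ?C" | "z \<in> ?H - ?C" | "z \<notin> ?H" by auto
      then show ?case
      proof cases
        case 1
        have "z \<in> ?H" using 1 \<delta> by auto
        have "s < 1" "t \<le> 1" "0 \<le> s" using 1 elim \<delta> z by auto
        then have "s * t < 1" using mult_left_mono[of t 1 s] by auto
        then have "?v z \<le> ?w z"
          unfolding cutoff_riesz_def z fst_conv snd_conv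
              by (intro divide_left_mono power_mono) (auto simp: zero_less_mult_iff)
        then have "?v z * (1 - ?r z) / 2 \<le> ?w z * (1 - ?r z) / 2"
          using r1[OF \<open>z \<in> ?H\<close>] by (intro divide_right_mono mult_right_mono) auto
        then show ?thesis using 1 \<open>z \<in> ?H\<close> by (auto intro!: ennreal_leI)
      next
        case 2
        have "s * t \<le> 1 - \<delta>"
        proof -
          have st: "0 \<le> s" "s \<le> 1" "t \<le> 1" "s \<le> 1 - \<delta> \<or> t \<le> 1 - \<delta>" using 2 z by auto
          show ?thesis
          proof (cases "s \<le> 1 - \<delta>")
            case True
            then show ?thesis using mult_left_mono[of t 1 s] st by simp
          next
            case False
            then have "s * t \<le> s * (1 - \<delta>)" using st by (intro mult_left_mono) auto
            also have "\<dots> \<le> 1 * (1 - \<delta>)" using st \<delta> by (intro mult_right_mono) auto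
            finally show ?thesis by simp
          qed
        qed
        \<comment> \<open>Outside the corner 1 - s t is at least \<delta>, hence at least
          \<epsilon>, and the cut-off does nothing.\<close>
        then have v: "?v z = ?w z" using \<delta> by (simp add: cutoff_riesz_def z max_def)
        have "ennreal (?v z * (1 - ?r z) / 2) * indicator ?H z + ennreal (?w z * ?r z / 2)
            * indicator ({0..1} \<times> {0..1} - ?C) z
          \<le> ennreal (?w z * (1 - ?r z) / 2) + ennreal (?w z * ?r z / 2)"
          unfolding v by (intro add_mono) (auto split: split_indicator)
        also have "\<dots> = ennreal (?w z * (1 - ?r z) / 2 + ?w z * ?r z / 2)"
          using r1[of z] 2 by (intro ennreal_plus[symmetric]) auto
        also have "?w z * (1 - ?r z) / 2 + ?w z * ?r z / 2 = ?w z / 2"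
        proof -
          have "a * (1 - b) / 2 + a * b / 2 = a / 2" for a b :: real by (simp add: field_simps)
          then show ?thesis .
        qed
        finally show ?thesis using 2 by simp
      next
        case 3
        then have "z \<notin> {0..1} \<times> {0..1}" by auto
        then show ?thesis using 3 by simp
      qed
    qed
  qed
qed

section \<open>Rescaling near the corner\<close>

text \<open>To leading order \<open>x\<close> is \<open>n\<close> times the polar angle. The
  interval from 0 to \<open>sqrt 2 * real n\<close> corresponds to heights from 1 down to 0.\<close>

definition height :: "nat \<Rightarrow> real \<Rightarrow> real" where
  "height n x = 1 - x\<^sup>2 / (2 * (real n)\<^sup>2)"

lemma height_measurable [measurable]: "height n \<in> borel_measurable borel"
  unfolding height_def by measurable

lemma nn_integral_height_substitution:
  fixes f :: "real \<Rightarrow> ennreal"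
  assumes [measurable]: "f \<in> borel_measurable borel" and n: "n > 0"
  shows "(\<integral>\<^sup>+s. f s * indicator {0..1} s \<partial>lborel)
    = (\<integral>\<^sup>+x. f (height n x) * (ennreal (x / (real n)\<^sup>2) * indicator {0..sqrt 2 * real n} x) \<partial>lborel)"
proof -
  define g where "g x = x\<^sup>2 / (2 * (real n)\<^sup>2)" for x :: real
  have g: "g 0 = 0" "g (sqrt 2 * real n) = 1" using n by (simp_all add: g_def power_mult_distrib)
  have "(\<integral>\<^sup>+s. f s * indicator {0..1} s \<partial>lborel) = (\<integral>\<^sup>+p. f (1 - p) * indicator {0..1} (1 - p) \<partial>lborel)"
    by (subst nn_integral_real_affine[where c = "-1" and t = 1]) auto
  also have "\<dots> = (\<integral>\<^sup>+p. f (1 - p) * indicator {g 0..g (sqrt 2 * real n)} p \<partial>lborel)"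
    unfolding g by (intro nn_integral_cong) (auto split: split_indicator)
  also have "\<dots> = (\<integral>\<^sup>+x. f (1 - g x) * ennreal (x / (real n)\<^sup>2) * indicator {0..sqrt 2 * real n} x \<partial>lborel)"
  proof (rule nn_integral_substitution_aux)
    show "(g has_real_derivative x / (real n)\<^sup>2) (at x)" for x
      unfolding g_def using n by (auto intro!: derivative_eq_intros simp: power2_eq_square)
  qed (use n in \<open>auto intro!: continuous_intros\<close>)
  finally show ?thesis by (simp add: height_def g_def mult.assoc)
qed

lemma nn_integral_height_substitution2:
  fixes f :: "real \<Rightarrow> real \<Rightarrow> ennreal"
  assumes f: "(\<lambda>z. f (fst z) (snd z)) \<in> borel_measurable (borel \<Otimes>\<^sub>M borel)" and n: "n > 0"
  shows "(\<integral>\<^sup>+z. f (fst z) (snd z) * indicator ({0..1} \<times> {0..1}) z \<partial>lborel2)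
    = (\<integral>\<^sup>+z. f (height n (fst z)) (height n (snd z)) * (ennreal (fst z / (real n)\<^sup>2)
        * ennreal (snd z / (real n)\<^sup>2))
        * indicator ({0..sqrt 2 * real n} \<times> {0..sqrt 2 * real n}) z \<partial>lborel2)"
proof -
  have fm [measurable (raw)]: "(\<lambda>z. f (g z) (h z)) \<in> borel_measurable M"
    if [measurable]: "g \<in> borel_measurable M" "h \<in> borel_measurable M" for M :: "'z measure" and g h
    using measurable_compose[OF _ f, of "\<lambda>z. (g z, h z)" M] by simp
  let ?R = "{0..sqrt 2 * real n}"
  define W where "W x = ennreal (x / (real n)\<^sup>2) * (indicator ?R x :: ennreal)" for x
  have [measurable]: "W \<in> borel_measurable borel" unfolding W_def by measurable
  have "(\<integral>\<^sup>+z. f (fst z) (snd z) * indicator ({0..1} \<times> {0..1}) z \<partial>lborel2)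
     = (\<integral>\<^sup>+z. f (fst z) (snd z) * indicator {0..1} (fst z) * indicator {0..1} (snd z) \<partial>lborel2)"
    by (intro nn_integral_cong) (auto split: split_indicator)
  also have "\<dots> = (\<integral>\<^sup>+t. (\<integral>\<^sup>+s. f s t * indicator {0..1} s * indicator {0..1} t \<partial>lborel) \<partial>lborel)"
    by (rule nn_integral_lborel2(1)) measurable
  also have "\<dots> = (\<integral>\<^sup>+t. (\<integral>\<^sup>+s. f s t * indicator {0..1} s \<partial>lborel) * indicator {0..1} t \<partial>lborel)"
    by (rule nn_integral_cong, rule nn_integral_multc) measurable
  also have "\<dots> = (\<integral>\<^sup>+t. (\<integral>\<^sup>+x. f (height n x) t * W x \<partial>lborel) * indicator {0..1} t \<partial>lborel)"
    unfolding W_def by (subst nn_integral_height_substitution[OF _ n]) measurable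
  also have "\<dots> = (\<integral>\<^sup>+y. (\<integral>\<^sup>+x. f (height n x) (height n y) * W x \<partial>lborel) * W y \<partial>lborel)"
    unfolding W_def[of y for y] by (rule nn_integral_height_substitution[OF _ n]) measurable
  also have "\<dots> = (\<integral>\<^sup>+y. (\<integral>\<^sup>+x. f (height n x) (height n y) * W x * W y \<partial>lborel) \<partial>lborel)"
    by (rule nn_integral_cong, rule nn_integral_multc[symmetric]) measurable
  also have "\<dots> = (\<integral>\<^sup>+z. f (height n (fst z)) (height n (snd z)) * W (fst z) * W (snd z) \<partial>lborel2)"
    by (rule nn_integral_lborel2(1)[symmetric]) measurable
  also have "\<dots> = (\<integral>\<^sup>+z. f (height n (fst z)) (height n (snd z)) * (ennreal (fst z / (real n)\<^sup>2)
      * ennreal (snd z / (real n)\<^sup>2))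
        * indicator (?R \<times> ?R) z \<partial>lborel2)"
    unfolding W_def by (intro nn_integral_cong) (auto split: split_indicator simp: mult_ac)
  finally show ?thesis .
qed

text \<open>Half of (1 - s t)^-2 in the rescaled variables, times the Jacobian x y / n^4; all outer
  powers of \<open>n\<close> cancel, which is special to this exponent.\<close>

definition scaled_weight :: "nat \<Rightarrow> real \<Rightarrow> real \<Rightarrow> real" where
  "scaled_weight n x y = 2 * x * y / (x\<^sup>2 + y\<^sup>2 - x\<^sup>2 * y\<^sup>2 / (2 * (real n)\<^sup>2))\<^sup>2"

definition limit_weight :: "real \<Rightarrow> real \<Rightarrow> real" where
  "limit_weight x y = 2 * x * y / (x\<^sup>2 + y\<^sup>2)\<^sup>2"

definition scaled_kernel :: "nat \<Rightarrow> real \<Rightarrow> real \<Rightarrow> real" where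
  "scaled_kernel n x y = (rel_kernel n (height n x) (height n y))\<^sup>2"

definition limit_kernel :: "real \<Rightarrow> real \<Rightarrow> real" where
  "limit_kernel x y = (bessel_quotient x * bessel_quotient y)\<^sup>2"

lemma scaled_weight_eq:
  assumes n: "n > 0"
  shows "1 / (1 - height n x * height n y)\<^sup>2 * a / 2 * (x / (real n)\<^sup>2 * (y / (real n)\<^sup>2))
      = scaled_weight n x y * a"
proof -
  define D where "D = x\<^sup>2 + y\<^sup>2 - x\<^sup>2 * y\<^sup>2 / (2 * (real n)\<^sup>2)"
  have D: "1 - height n x * height n y = D / (2 * (real n)\<^sup>2)"
    using n by (simp add: height_def D_def field_simps power2_eq_square)
  show ?thesis unfolding D scaled_weight_def D_def[symmetric]
    using n by (simp add: power_divide power_mult_distrib power2_eq_square)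
qed

lemma height_bounds:
  assumes "n > 0" "x \<in> {0..sqrt 2 * real n}" shows "0 \<le> height n x" "height n x \<le> 1"
proof -
  have "x\<^sup>2 \<le> (sqrt 2 * real n)\<^sup>2" using assms by (intro power_mono) auto
  then show "0 \<le> height n x" "height n x \<le> 1" using assms by (auto simp: height_def power_mult_distrib)
qed

lemma height_core_iff:
  assumes "n > 0" "0 \<le> x" shows "1 - 1 / (2 * (real n)\<^sup>2) < height n x \<longleftrightarrow> x < 1"
proof -
  have "1 - 1 / (2 * (real n)\<^sup>2) < height n x \<longleftrightarrow> x\<^sup>2 < 1"
    using assms by (simp add: height_def divide_less_cancel)
  also have "\<dots> \<longleftrightarrow> x < 1" using assms by (simp add: abs_square_less_1)
  finally show ?thesis .
qed

lemma core_energy_scaled: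
  assumes n: "n > 0"
  shows "core_energy n = (\<integral>\<^sup>+z. ennreal (scaled_weight n (fst z) (snd z) * (1
      - scaled_kernel n (fst z) (snd z)))
     * indicator ({0..<1} \<times> {0..<1}) z \<partial>lborel2)"
proof -
  let ?C = "{1 - 1 / (2 * (real n)\<^sup>2)<..1}"
  let ?R = "{0..sqrt 2 * real n}"
  define h where "h s t = ennreal (1 / (1 - s * t)\<^sup>2 * (1 - (rel_kernel n s t)\<^sup>2) / 2)
      * indicator (?C \<times> ?C) (s, t)" for s t
  have n1: "real n \<ge> 1" using n by simp
  then have "(real n)\<^sup>2 \<ge> 1" by simp
  then have "1 / (2 * (real n)\<^sup>2) \<le> 1 / 1" by (intro frac_le) auto
  then have c0: "1 - 1 / (2 * (real n)\<^sup>2) \<ge> 0" by simp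
  have "sqrt 2 * real n \<ge> 1 * 1" using n1 by (intro mult_mono) auto
  then have R: "x \<in> ?R" if "x \<in> {0..<1}" for x using that by auto
  have "core_energy n = (\<integral>\<^sup>+z. h (fst z) (snd z) * indicator ({0..1} \<times> {0..1}) z \<partial>lborel2)"
    unfolding core_energy_def h_def using c0 by (intro nn_integral_cong) (auto split: split_indicator)
  also have "\<dots> = (\<integral>\<^sup>+z. h (height n (fst z)) (height n (snd z)) * (ennreal (fst z / (real n)\<^sup>2)
      * ennreal (snd z / (real n)\<^sup>2))
        * indicator (?R \<times> ?R) z \<partial>lborel2)"
    by (rule nn_integral_height_substitution2[OF _ n]) (unfold h_def, measurable)
  also have "\<dots> = (\<integral>\<^sup>+z. ennreal (scaled_weight n (fst z) (snd z) * (1 - scaled_kernel n (fst z) (snd z)))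
     * indicator ({0..<1} \<times> {0..<1}) z \<partial>lborel2)"
  proof (rule nn_integral_cong)
    fix z :: "real \<times> real"
    obtain x y where z: "z = (x, y)" by (cases z)
    consider "x \<in> {0..<1}" "y \<in> {0..<1}" | "x \<in> ?R" "y \<in> ?R" "x \<notin> {0..<1} \<or> y \<notin> {0..<1}" | "x \<notin> ?R \<or>
        y \<notin> ?R" by blast
    then show "h (height n (fst z)) (height n (snd z)) * (ennreal (fst z / (real n)\<^sup>2)
        * ennreal (snd z / (real n)\<^sup>2)) * indicator (?R \<times> ?R) z
      = ennreal (scaled_weight n (fst z) (snd z) * (1 - scaled_kernel n (fst z) (snd z)))
          * indicator ({0..<1} \<times> {0..<1}) z"
    proof cases
      case 1
      then have xy: "x \<in> ?R" "y \<in> ?R" using R by auto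
      have k: "0 \<le> 1 - (rel_kernel n (height n x) (height n y))\<^sup>2"
        using rel_kernel_abs_le_1[OF n, of "height n x" "height n y"] height_bounds[OF n xy(1)]
            height_bounds[OF n xy(2)]
        by (simp add: abs_square_le_1)
      have "h (height n x) (height n y) = ennreal (1 / (1 - height n x * height n y)\<^sup>2 * (1
          - (rel_kernel n (height n x) (height n y))\<^sup>2) / 2)"
        using 1 height_core_iff[OF n] height_bounds[OF n xy(1)] height_bounds[OF n xy(2)]
            by (simp add: h_def)
      then have "h (height n x) (height n y) * (ennreal (x / (real n)\<^sup>2) * ennreal (y / (real n)\<^sup>2)) =
        ennreal (1 / (1 - height n x * height n y)\<^sup>2 * (1
            - (rel_kernel n (height n x) (height n y))\<^sup>2) / 2 * (x / (real n)\<^sup>2 * (y / (real n)\<^sup>2)))"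
        using 1 k by (simp only: ennreal_mult'[symmetric] ennreal_mult''[symmetric]
            zero_le_divide_iff zero_le_power2 atLeastLessThan_iff)
           (simp add: ennreal_mult'[symmetric] ennreal_mult''[symmetric])
      then show ?thesis using 1 xy unfolding scaled_weight_eq[OF n] by (simp add: z scaled_kernel_def)
    next
      case 2
      then have "x \<ge> 1 \<or> y \<ge> 1" by auto
      then have "h (height n x) (height n y) = 0"
        using 2 height_core_iff[OF n, of x] height_core_iff[OF n, of y] by (auto simp: h_def)
      then show ?thesis using 2 by (auto simp: z)
    next
      case 3
      then show ?thesis using R by (auto simp: z split: split_indicator)
    qed
  qed
  finally show ?thesis .
qed

lemma outer_energy_scaled:
  assumes n: "n > 0"
  shows "outer_energy n = (\<integral>\<^sup>+z. ennreal (scaled_weight n (fst z) (snd z) * scaled_kernel n (fst z) (snd z))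
     * indicator ({0..sqrt 2 * real n} \<times> {0..sqrt 2 * real n} - {0..<1} \<times> {0..<1}) z \<partial>lborel2)"
proof -
  let ?C = "{1 - 1 / (2 * (real n)\<^sup>2)<..1}"
  let ?R = "{0..sqrt 2 * real n}"
  define h where "h s t = ennreal (1 / (1 - s * t)\<^sup>2 * (rel_kernel n s t)\<^sup>2 / 2)
      * indicator (- (?C \<times> ?C)) (s, t)" for s t
  have "outer_energy n = (\<integral>\<^sup>+z. h (fst z) (snd z) * indicator ({0..1} \<times> {0..1}) z \<partial>lborel2)"
    unfolding outer_energy_def h_def by (intro nn_integral_cong) (auto split: split_indicator)
  also have "\<dots> = (\<integral>\<^sup>+z. h (height n (fst z)) (height n (snd z)) * (ennreal (fst z / (real n)\<^sup>2)
      * ennreal (snd z / (real n)\<^sup>2))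
        * indicator (?R \<times> ?R) z \<partial>lborel2)"
    by (rule nn_integral_height_substitution2[OF _ n]) (unfold h_def, measurable)
  also have "\<dots> = (\<integral>\<^sup>+z. ennreal (scaled_weight n (fst z) (snd z) * scaled_kernel n (fst z) (snd z))
     * indicator (?R \<times> ?R - {0..<1} \<times> {0..<1}) z \<partial>lborel2)"
  proof (rule nn_integral_cong)
    fix z :: "real \<times> real"
    obtain x y where z: "z = (x, y)" by (cases z)
    consider "x \<in> ?R" "y \<in> ?R" "x \<in> {0..<1}" "y \<in> {0..<1}" | "x \<in> ?R" "y
        \<in> ?R" "x \<notin> {0..<1} \<or> y \<notin> {0..<1}" | "x \<notin> ?R \<or> y \<notin> ?R" by blast
    then show "h (height n (fst z)) (height n (snd z)) * (ennreal (fst z / (real n)\<^sup>2)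
        * ennreal (snd z / (real n)\<^sup>2)) * indicator (?R \<times> ?R) z
      = ennreal (scaled_weight n (fst z) (snd z) * scaled_kernel n (fst z) (snd z))
          * indicator (?R \<times> ?R - {0..<1} \<times> {0..<1}) z"
    proof cases
      case 2
      then have "x \<ge> 1 \<or> y \<ge> 1" by auto
      then have "h (height n x) (height n y) = ennreal (1 / (1 - height n x * height n y)\<^sup>2
          * (rel_kernel n (height n x) (height n y))\<^sup>2 / 2)"
        using 2 height_core_iff[OF n, of x] height_core_iff[OF n, of y] by (auto simp: h_def)
      then have "h (height n x) (height n y) * (ennreal (x / (real n)\<^sup>2) * ennreal (y / (real n)\<^sup>2)) =
        ennreal (1 / (1 - height n x * height n y)\<^sup>2 * (rel_kernel n (height n x) (height n y))\<^sup>2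
            / 2 * (x / (real n)\<^sup>2 * (y / (real n)\<^sup>2)))"
        using 2 by (simp add: ennreal_mult'[symmetric] ennreal_mult''[symmetric])
      then show ?thesis using 2 unfolding scaled_weight_eq[OF n] by (auto simp: z scaled_kernel_def)
    next
      case 1
      then have "h (height n x) (height n y) = 0"
        using height_core_iff[OF n, of x] height_core_iff[OF n, of y] height_bounds[OF n 1(1)]
            height_bounds[OF n 1(2)] by (auto simp: h_def)
      then show ?thesis using 1 by (auto simp: z)
    next
      case 3
      then show ?thesis by (auto simp: z split: split_indicator)
    qed
  qed
  finally show ?thesis .
qed

lemma bessel_quotient_measurable [measurable]: "bessel_quotient \<in> borel_measurable borel"
proof (rule borel_measurable_LIMSEQ_real)
  show "(\<lambda>n. zonal_kernel n (1 - x\<^sup>2 / (2 * (real n)\<^sup>2)) / (real n)\<^sup>2) \<longlonglongrightarrow> bessel_quotient x" for x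
    by (rule zonal_kernel_scaled_tendsto)
qed measurable

lemma scaled_kernel_tendsto: "(\<lambda>n. scaled_kernel n x y) \<longlonglongrightarrow> limit_kernel x y"
  unfolding scaled_kernel_def limit_kernel_def height_def
      by (intro tendsto_intros rel_kernel_scaled_tendsto)

lemma scaled_weight_tendsto:
  "(\<lambda>n. scaled_weight n x y) \<longlonglongrightarrow> limit_weight x y"
proof (cases "x = 0 \<and> y = 0")
  case True
  then show ?thesis by (simp add: scaled_weight_def limit_weight_def)
next
  case False
  have l: "(\<lambda>n. x\<^sup>2 * y\<^sup>2 / (2 * (real n)\<^sup>2)) \<longlonglongrightarrow> 0" by real_asymp
  have "x\<^sup>2 + y\<^sup>2 \<noteq> 0" using False by (simp add: sum_power2_eq_zero_iff)
  then have "(\<lambda>n. scaled_weight n x y) \<longlonglongrightarrow> 2 * x * y / (x\<^sup>2 + y\<^sup>2 - 0)\<^sup>2"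
    unfolding scaled_weight_def by (intro tendsto_intros l) auto
  then show ?thesis by (simp add: limit_weight_def)
qed

lemma limit_kernel_bounds:
  assumes "0 \<le> x" "0 \<le> y" shows "0 \<le> limit_kernel x y" "limit_kernel x y \<le> 1"
proof -
  show "0 \<le> limit_kernel x y" by (simp add: limit_kernel_def)
  have "\<forall>\<^sub>F n in sequentially. scaled_kernel n x y \<le> 1"
  proof -
    have "\<forall>\<^sub>F n in sequentially. x \<le> sqrt 2 * real n" "\<forall>\<^sub>F n in sequentially. y \<le> sqrt 2 * real n"
        by real_asymp+
    then show ?thesis using eventually_gt_at_top[of 0]
    proof eventually_elim
      case (elim n)
      then show ?case
        using rel_kernel_abs_le_1[OF elim(3), of "height n x" "height n y"] assms
          height_bounds[OF elim(3), of x] height_bounds[OF elim(3), of y]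
        by (simp add: scaled_kernel_def abs_square_le_1)
    qed
  qed
  then show "limit_kernel x y \<le> 1" by (rule tendsto_upperbound[OF scaled_kernel_tendsto]) simp
qed

section \<open>Limits of the two parts of the energy\<close>

definition core_limit :: ennreal where
  "core_limit = (\<integral>\<^sup>+z. ennreal (limit_weight (fst z) (snd z) * (1 - limit_kernel (fst z) (snd z)))
     * indicator ({0..<1} \<times> {0..<1}) z \<partial>lborel2)"

definition outer_limit :: ennreal where
  "outer_limit = (\<integral>\<^sup>+z. ennreal (limit_weight (fst z) (snd z) * limit_kernel (fst z) (snd z))
     * indicator ({0..} \<times> {0..} - {0..<1} \<times> {0..<1}) z \<partial>lborel2)"

text \<open>Dominated convergence with the constant 8 on the unit square. With E = x^2 + y^2, the
  weight is at most E / (E / 2)^2 = 4 / E and 1 - \<kappa>^2 is at most 2 E.\<close>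

lemma core_energy_tendsto: "core_energy \<longlonglongrightarrow> core_limit" and core_limit_finite: "core_limit < \<infinity>"
  unfolding core_limit_def
proof -
  let ?L = "(\<integral>\<^sup>+z. ennreal (limit_weight (fst z) (snd z) * (1 - limit_kernel (fst z) (snd z)))
     * indicator ({0..<1} \<times> {0..<1}) z \<partial>lborel2)"
  define u where "u n z = ennreal (scaled_weight n (fst z) (snd z) * (1
      - scaled_kernel n (fst z) (snd z))) * indicator ({0..<1} \<times> {0..<1}) z" for n z
  have um [measurable]: "u n \<in> borel_measurable lborel2" for n
    unfolding u_def scaled_weight_def scaled_kernel_def by measurable
  \<comment> \<open>The estimates need a positive index, so the convergence is proved for the
    shifted sequence.\<close>
  have bound: "u (Suc n) z \<le> 8 * indicator ({0..<1} \<times> {0..<1}) z" for n z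
  proof (cases "z \<in> {0..<1} \<times> {0..<1}")
    case True
    let ?n = "Suc n"
    obtain x y where z: "z = (x, y)" by (cases z)
    have xy: "0 \<le> x" "x < 1" "0 \<le> y" "y < 1" using True z by auto
    have n1: "real ?n \<ge> 1" by simp
    have nn: "?n > 0" by simp
    have sq: "1 \<le> sqrt 2 * real ?n" using mult_mono[of 1 "sqrt 2" 1 "real ?n"] n1 by simp
    have hb: "0 \<le> height ?n x" "height ?n x \<le> 1" "0 \<le> height ?n y" "height ?n y \<le> 1"
      using height_bounds[OF nn, of x] height_bounds[OF nn, of y] xy sq by auto
    define k where "k = rel_kernel ?n (height ?n x) (height ?n y)"
    have "\<bar>k\<bar> \<le> 1" unfolding k_def using hb by (intro rel_kernel_abs_le_1) auto
    moreover have "1 - k \<le> x\<^sup>2 + y\<^sup>2"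
      unfolding k_def height_def using xy by (intro one_minus_rel_kernel_le) auto
    ultimately have "1 - k\<^sup>2 \<le> 2 * (x\<^sup>2 + y\<^sup>2)"
    proof -
      have "1 - k\<^sup>2 = (1 + k) * (1 - k)" by (simp add: power2_eq_square algebra_simps)
      also have "\<dots> \<le> 2 * (1 - k)" using \<open>\<bar>k\<bar> \<le> 1\<close> by (intro mult_right_mono) auto
      also have "\<dots> \<le> 2 * (x\<^sup>2 + y\<^sup>2)" using \<open>1 - k \<le> x\<^sup>2 + y\<^sup>2\<close> by simp
      finally show ?thesis .
    qed
    define E where "E = x\<^sup>2 + y\<^sup>2"
    have "scaled_weight ?n x y * (1 - k\<^sup>2) \<le> 8"
    proof (cases "E = 0")
      case True
      then show ?thesis by (simp add: E_def scaled_weight_def sum_power2_eq_zero_iff)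
    next
      case False
      then have E: "E > 0" unfolding E_def by (metis add_nonneg_nonneg order_le_less zero_le_power2)
      have "x\<^sup>2 * y\<^sup>2 / (2 * (real ?n)\<^sup>2) \<le> x\<^sup>2 * 1 / (2 * 1)"
        using xy n1 by (intro frac_le mult_left_mono mult_mono) (auto simp: power_le_one one_le_power)
      then have "x\<^sup>2 * y\<^sup>2 / (2 * (real ?n)\<^sup>2) \<le> x\<^sup>2 / 2" by (simp only: mult_1_right)
      then have D: "E / 2 \<le> E - x\<^sup>2 * y\<^sup>2 / (2 * (real ?n)\<^sup>2)"
        unfolding E_def add_divide_distrib using zero_le_power2[of y] by linarith
      have "2 * x * y \<le> E" unfolding E_def using sum_squares_bound[of x y] by simp
      then have "scaled_weight ?n x y \<le> E / (E / 2)\<^sup>2"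
        unfolding scaled_weight_def E_def[symmetric] using D E xy by (intro frac_le power_mono) auto
      moreover have "0 \<le> scaled_weight ?n x y" using xy by (simp add: scaled_weight_def)
      moreover have "0 \<le> 1 - k\<^sup>2" using \<open>\<bar>k\<bar> \<le> 1\<close> by (simp add: abs_square_le_1)
      ultimately have "scaled_weight ?n x y * (1 - k\<^sup>2) \<le> E / (E / 2)\<^sup>2 * (2 * E)"
        using \<open>1 - k\<^sup>2 \<le> _\<close> E by (intro mult_mono) (auto simp: E_def)
      also have "\<dots> = 8" using E by (simp add: power2_eq_square field_simps)
      finally show ?thesis .
    qed
    then have "ennreal (scaled_weight ?n x y * (1 - scaled_kernel ?n x y)) \<le> ennreal 8"
      unfolding scaled_kernel_def k_def by (rule ennreal_leI)
    then show ?thesis using True by (simp add: u_def z)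
  qed (simp add: u_def)
  have lim: "(\<lambda>n. u n z) \<longlonglongrightarrow> ennreal (limit_weight (fst z) (snd z) * (1
      - limit_kernel (fst z) (snd z))) * indicator ({0..<1} \<times> {0..<1}) z" for z
  proof -
    have "(\<lambda>n. ennreal (scaled_weight n (fst z) (snd z) * (1 - scaled_kernel n (fst z) (snd z))))
        \<longlonglongrightarrow> ennreal (limit_weight (fst z) (snd z) * (1 - limit_kernel (fst z) (snd z)))"
      by (intro tendsto_intros scaled_weight_tendsto scaled_kernel_tendsto)
    then show ?thesis unfolding u_def by (cases "z \<in> {0..<1} \<times> {0..<1}") auto
  qed
  have fin: "(\<integral>\<^sup>+z. 8 * indicator ({0..<1} \<times> {0..<1}) z \<partial>lborel2) < \<infinity>"
  proof -
    have "(\<integral>\<^sup>+z. 8 * indicator ({0..<1} \<times> {0..<1}) z \<partial>lborel2) = 8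
        * emeasure lborel2 ({0..<1::real} \<times> {0..<1::real})"
      by (rule nn_integral_cmult_indicator) simp
    also have "\<dots> = 8" by (subst lborel.emeasure_pair_measure_Times) auto
    finally show ?thesis by simp
  qed
  have "(\<lambda>n. \<integral>\<^sup>+z. u (Suc n) z \<partial>lborel2) \<longlonglongrightarrow> ?L"
  proof (rule nn_integral_dominated_convergence[where w = "\<lambda>z. 8 * indicator ({0..<1} \<times> {0..<1}) z"])
    show "AE z in lborel2. (\<lambda>n. u (Suc n) z) \<longlonglongrightarrow> ennreal (limit_weight (fst z) (snd z) * (1
        - limit_kernel (fst z) (snd z))) * indicator ({0..<1} \<times> {0..<1}) z"
      using LIMSEQ_Suc[OF lim] by simp
    show "(\<lambda>z. ennreal (limit_weight (fst z) (snd z) * (1 - limit_kernel (fst z) (snd z)))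
        * indicator ({0..<1} \<times> {0..<1}) z) \<in> borel_measurable lborel2"
      unfolding limit_weight_def limit_kernel_def by measurable
  qed (use bound fin in auto)
  then have "(\<lambda>n. core_energy (Suc n)) \<longlonglongrightarrow> ?L" by (simp add: core_energy_scaled u_def)
  then show "core_energy \<longlonglongrightarrow> ?L" by (rule LIMSEQ_imp_Suc)
  have "?L \<le> (\<integral>\<^sup>+z. 8 * indicator ({0..<1} \<times> {0..<1}) z \<partial>lborel2)"
  proof (rule nn_integral_mono)
    fix z
    show "ennreal (limit_weight (fst z) (snd z) * (1 - limit_kernel (fst z) (snd z)))
        * indicator ({0..<1} \<times> {0..<1}) z \<le> 8 * indicator ({0..<1} \<times> {0..<1}) z"
      by (rule LIMSEQ_le_const2[OF LIMSEQ_Suc[OF lim]]) (use bound in auto)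
  qed
  also note fin
  finally show "?L < \<infinity>" .
qed

lemma outer_energy_liminf: "outer_limit \<le> liminf outer_energy"
proof -
  define u where "u n z = ennreal (scaled_weight n (fst z) (snd z) * scaled_kernel n (fst z) (snd z))
    * indicator ({0..sqrt 2 * real n} \<times> {0..sqrt 2 * real n} - {0..<1} \<times> {0..<1}) z" for n z
  have um [measurable]: "u n \<in> borel_measurable lborel2" for n
    unfolding u_def scaled_weight_def scaled_kernel_def by measurable
  have "ennreal (limit_weight (fst z) (snd z) * limit_kernel (fst z) (snd z))
      * indicator ({0..} \<times> {0..} - {0..<1} \<times> {0..<1}) z
     \<le> liminf (\<lambda>n. u n z)" for z
  proof (cases "z \<in> {0..} \<times> {0..} - {0..<1} \<times> {0..<1}")
    case True
    have "\<forall>\<^sub>F n in sequentially. fst z \<le> sqrt 2 * real n" "\<forall>\<^sub>F n in sequentially. snd z \<le> sqrt 2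
        * real n" by real_asymp+
    then have ev: "\<forall>\<^sub>F n in sequentially. ennreal (scaled_weight n (fst z) (snd z)
        * scaled_kernel n (fst z) (snd z)) = u n z"
      by eventually_elim (use True in \<open>auto simp: u_def split: split_indicator\<close>)
    have "(\<lambda>n. ennreal (scaled_weight n (fst z) (snd z) * scaled_kernel n (fst z) (snd z)))
        \<longlonglongrightarrow> ennreal (limit_weight (fst z) (snd z) * limit_kernel (fst z) (snd z))"
      by (intro tendsto_intros scaled_weight_tendsto scaled_kernel_tendsto)
    then have "(\<lambda>n. u n z) \<longlonglongrightarrow> ennreal (limit_weight (fst z) (snd z) * limit_kernel (fst z) (snd z))"
      using tendsto_cong[OF ev] by simp
    then have "liminf (\<lambda>n. u n z) = ennreal (limit_weight (fst z) (snd z) * limit_kernel (fst z) (snd z))"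
      by (rule lim_imp_Liminf[OF sequentially_bot])
    then show ?thesis using True by simp
  qed simp
  then have "(\<integral>\<^sup>+z. ennreal (limit_weight (fst z) (snd z) * limit_kernel (fst z) (snd z))
     * indicator ({0..} \<times> {0..} - {0..<1} \<times> {0..<1}) z \<partial>lborel2) \<le> (\<integral>\<^sup>+z. liminf (\<lambda>n. u n z) \<partial>lborel2)"
    by (intro nn_integral_mono)
  also have "\<dots> \<le> liminf (\<lambda>n. \<integral>\<^sup>+z. u n z \<partial>lborel2)" by (rule nn_integral_liminf) simp
  also have "liminf (\<lambda>n. \<integral>\<^sup>+z. u n z \<partial>lborel2) = liminf outer_energy"
  proof (rule Liminf_eq)
    show "\<forall>\<^sub>F n in sequentially. (\<integral>\<^sup>+z. u n z \<partial>lborel2) = outer_energy n"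
      using eventually_gt_at_top[of 0] by eventually_elim (simp add: outer_energy_scaled u_def)
  qed
  finally show ?thesis by (simp only: outer_limit_def)
qed

text \<open>By reproduction the mean of \<kappa>^2 is 1 / N, and outside the corner (1 - s t)^-2 is
  at most 4 n^4, which is of the order of N. This crude bound makes \<open>outer_limit\<close>
  finite, as needed to subtract it and to identify it with the integrals in
  \<open>C\<^sub>4\<close>.\<close>

lemma outer_energy_le_16:
  assumes n: "n > 0" shows "outer_energy n \<le> 16"
proof -
  let ?N = "real (even_dim n)"
  have N: "?N > 0" using n by (simp add: real_even_dim add_pos_pos)
  define \<delta> where "\<delta> = 1 / (2 * (real n)\<^sup>2)"
  have \<delta>: "\<delta> > 0" using n by (simp add: \<delta>_def)
  define F where "F s t = (rel_kernel n s t)\<^sup>2" for s t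
  have Fm: "(\<lambda>z. F (fst z) (snd z)) \<in> borel_measurable (borel \<Otimes>\<^sub>M borel)" unfolding F_def by measurable
  have F1: "0 \<le> F s t \<and> F s t \<le> 1" if "s \<in> {-1..1}" "t \<in> {-1..1}" for s t
    using rel_kernel_abs_le_1[OF n, of s t] that by (auto simp: F_def abs_square_le_1)
  have mean: "(\<integral>t. (\<integral>s. F s t \<partial>interval_measure_pm1) \<partial>interval_measure_pm1) = 1 / ?N"
  proof -
    let ?u = "axis 1 1 :: real ^ 3"
    have u: "norm ?u = 1" "?u \<bullet> ?u = 1" by (simp_all add: norm_axis_1 inner_axis_axis)
    have K: "reproducing_kernel sphere_pair (pair_kernel n) ?N" by (rule reproducing_pair_kernel[OF n])
    have sp: "(?u, ?u) \<in> space sphere_pair" using u by (simp add: space_sphere_pair)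
    have cF: "continuous_on UNIV (\<lambda>(s, t). F s t)"
      unfolding F_def rel_kernel_def case_prod_beta using N by (intro continuous_intros) auto
    have "(\<integral>t. (\<integral>s. F s t \<partial>interval_measure_pm1) \<partial>interval_measure_pm1)
        = (\<integral>z. F (fst z \<bullet> ?u) (snd z \<bullet> ?u) \<partial>sphere_pair)"
      by (rule sphere_pair_integral_heights[OF cF u(1) u(1), symmetric])
    also have "\<dots> = (\<integral>z. (pair_kernel n (?u, ?u) z * pair_kernel n (?u, ?u) z) / ?N\<^sup>2 \<partial>sphere_pair)"
      by (rule Bochner_Integration.integral_cong)
         (simp_all add: F_def rel_kernel_def pair_kernel_def inner_commute power2_eq_square)
    also have "\<dots> = pair_kernel n (?u, ?u) (?u, ?u) / ?N\<^sup>2"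
      using sphere_pair.P.kernel_repro[OF K sp sp] by simp
    also have "pair_kernel n (?u, ?u) (?u, ?u) = ?N"
      using n u zonal_kernel_1[OF n] zonal_kernel_minus_1[OF n]
      by (simp add: pair_kernel_def even_kernel_def real_even_dim flip: power2_eq_square)
    finally show ?thesis using N by (simp add: power2_eq_square)
  qed
  have "outer_energy n \<le> (\<integral>\<^sup>+z. ennreal (8 * (real n)^4) * (ennreal (F (fst z) (snd z) / 4)
      * indicator ({-1..1} \<times> {-1..1}) z) \<partial>lborel2)"
    unfolding outer_energy_def \<delta>_def[symmetric]
  proof (rule nn_integral_mono)
    fix z :: "real \<times> real"
    obtain s t where z: "z = (s, t)" by (cases z)
    show "ennreal (1 / (1 - fst z * snd z)\<^sup>2 * (rel_kernel n (fst z) (snd z))\<^sup>2 / 2)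
        * indicator ({0..1} \<times> {0..1} - {1 - \<delta><..1} \<times> {1 - \<delta><..1}) z
      \<le> ennreal (8 * (real n)^4) * (ennreal (F (fst z) (snd z) / 4) * indicator ({-1..1} \<times> {-1..1}) z)"
    proof (cases "z \<in> {0..1} \<times> {0..1} - {1 - \<delta><..1} \<times> {1 - \<delta><..1}")
      case True
      then have st: "0 \<le> s" "s \<le> 1" "0 \<le> t" "t \<le> 1" "s \<le> 1 - \<delta> \<or> t \<le> 1 - \<delta>" by (auto simp: z)
      have "s * t \<le> 1 - \<delta>"
        using mult_left_mono[OF st(4,1)] mult_right_mono[OF st(2,3)] st by auto
      then have "1 / (1 - s * t)\<^sup>2 \<le> 1 / \<delta>\<^sup>2"
        using \<delta> by (intro divide_left_mono power_mono) auto
      also have "1 / \<delta>\<^sup>2 = 4 * (real n)^4" by (simp add: \<delta>_def power_divide power_mult_distrib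
          power2_eq_square power4_eq_xxxx)
      finally have "1 / (1 - s * t)\<^sup>2 * F s t / 2 \<le> 4 * (real n)^4 * F s t / 2"
        using F1[of s t] st by (intro divide_right_mono mult_right_mono) auto
      also have "\<dots> = 8 * (real n)^4 * (F s t / 4)" by simp
      finally have "ennreal (1 / (1 - s * t)\<^sup>2 * F s t / 2) \<le> ennreal (8 * (real n)^4)
          * ennreal (F s t / 4)"
        by (subst ennreal_mult'[symmetric]) (auto intro: ennreal_leI)
      then show ?thesis using st by (simp add: z F_def indicator_def)
    qed simp
  qed
  also have "\<dots> = ennreal (8 * (real n)^4) * (\<integral>\<^sup>+z. ennreal (F (fst z) (snd z) / 4)
      * indicator ({-1..1} \<times> {-1..1}) z \<partial>lborel2)"
    by (rule nn_integral_cmult) (unfold F_def, measurable)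
  also have "\<dots> = ennreal (8 * (real n)^4 * (1 / ?N))"
  proof -
    have "(\<integral>\<^sup>+z. ennreal (F (fst z) (snd z) / 4) * indicator ({-1..1} \<times> {-1..1}) z \<partial>lborel2)
        = ennreal (1 / ?N)"
      using interval_pair_nn_integral[OF Fm F1] mean by simp
    then show ?thesis by (simp only:) (rule ennreal_mult'[symmetric], simp)
  qed
  also have "\<dots> \<le> ennreal 16"
    using n by (intro ennreal_leI) (simp add: real_even_dim field_simps add_pos_pos)
  finally show ?thesis by simp
qed

section \<open>The constant and the general case\<close>

text \<open>The iterated integrals in \<open>C\<^sub>4\<close> would be 0 by default where
  integrability fails; finiteness of the nonnegative double integral excludes this.\<close>

lemma nested_set_integral_nonneg:
  fixes f :: "real \<Rightarrow> real \<Rightarrow> real"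
  assumes f [measurable]: "(\<lambda>z. f (fst z) (snd z)) \<in> borel_measurable lborel2"
    and AB [measurable]: "A \<in> sets borel" "B \<in> sets borel"
    and nn: "\<And>x y. x \<in> A \<Longrightarrow> y \<in> B \<Longrightarrow> 0 \<le> f x y"
    and fin: "(\<integral>\<^sup>+z. ennreal (f (fst z) (snd z)) * indicator (A \<times> B) z \<partial>lborel2) < \<infinity>"
  shows "ennreal (LBINT y:B. LBINT x:A. f x y) = (\<integral>\<^sup>+z. ennreal (f (fst z) (snd z))
      * indicator (A \<times> B) z \<partial>lborel2)"
    and "0 \<le> (LBINT y:B. LBINT x:A. f x y)"
proof -
  define g where "g x y = indicator A x * indicator B y * f x y" for x y
  have gm: "(\<lambda>z. g (fst z) (snd z)) \<in> borel_measurable lborel2" unfolding g_def by measurable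
  have g0: "0 \<le> g x y" for x y using nn by (auto simp: g_def split: split_indicator)
  have eq: "(\<integral>\<^sup>+z. ennreal (g (fst z) (snd z)) \<partial>lborel2) = (\<integral>\<^sup>+z. ennreal (f (fst z) (snd z))
      * indicator (A \<times> B) z \<partial>lborel2)"
    by (intro nn_integral_cong) (auto simp: g_def split: split_indicator)
  have int: "integrable lborel2 (\<lambda>z. g (fst z) (snd z))"
    using gm g0 fin by (intro integrableI_nonneg) (auto simp: eq)
  have "(LBINT y:B. LBINT x:A. f x y) = (\<integral>y. (\<integral>x. g x y \<partial>lborel) \<partial>lborel)"
    unfolding set_lebesgue_integral_def g_def
    by (intro Bochner_Integration.integral_cong refl) (simp add: mult_ac flip: integral_mult_right_zero)
  also have "\<dots> = (\<integral>z. g (fst z) (snd z) \<partial>lborel2)"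
    using lborel_pair.integral_snd[of g] int by (simp add: case_prod_beta')
  finally have E: "(LBINT y:B. LBINT x:A. f x y) = (\<integral>z. g (fst z) (snd z) \<partial>lborel2)" .
  show "0 \<le> (LBINT y:B. LBINT x:A. f x y)" unfolding E using g0 by (intro integral_nonneg_AE) auto
  show "ennreal (LBINT y:B. LBINT x:A. f x y) = (\<integral>\<^sup>+z. ennreal (f (fst z) (snd z))
      * indicator (A \<times> B) z \<partial>lborel2)"
    unfolding E eq[symmetric] using nn_integral_eq_integral[OF int] g0 by simp
qed

lemma nn_integral_lborel2_swap:
  fixes f :: "real \<Rightarrow> real \<Rightarrow> ennreal"
  assumes f: "(\<lambda>z. f (fst z) (snd z)) \<in> borel_measurable (borel \<Otimes>\<^sub>M borel)"
  shows "(\<integral>\<^sup>+z. f (fst z) (snd z) \<partial>lborel2) = (\<integral>\<^sup>+z. f (snd z) (fst z) \<partial>lborel2)"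
proof -
  have "(\<lambda>z. f (snd z) (fst z)) \<in> borel_measurable (borel \<Otimes>\<^sub>M borel)"
    using measurable_compose[OF _ f, of "\<lambda>z. (snd z, fst z)" "borel \<Otimes>\<^sub>M borel"] by simp
  then have m: "(\<lambda>z. f (snd z) (fst z)) \<in> borel_measurable lborel2" by (simp cong: measurable_cong_sets)
  have m': "(\<lambda>z. f (fst z) (snd z)) \<in> borel_measurable lborel2" using f by (simp cong: measurable_cong_sets)
  show ?thesis
    using nn_integral_lborel2(1)[OF m'] nn_integral_lborel2(2)[of "\<lambda>x y. f y x", OF m] by simp
qed

lemma limit_measurable [measurable (raw)]:
  assumes [measurable]: "f \<in> borel_measurable M" "g \<in> borel_measurable M"
  shows "(\<lambda>z. limit_weight (f z) (g z)) \<in> borel_measurable M" "(\<lambda>z. limit_kernel (f z) (g z))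
      \<in> borel_measurable M"
  unfolding limit_weight_def limit_kernel_def by measurable

lemma limit_weight_nonneg: "0 \<le> x \<Longrightarrow> 0 \<le> y \<Longrightarrow> 0 \<le> limit_weight x y"
  by (simp add: limit_weight_def)

text \<open>The limit of \<kappa> is 4 J_1(x) J_1(y) / (x y), so its square times x^2 y^2 is the
  term with 16. On the axes both sides are 0, the left one by division by zero.\<close>

lemma core_integrand_eq:
  "(x\<^sup>2 * y\<^sup>2 - 16 * (bessel_J 1 x)\<^sup>2 * (bessel_J 1 y)\<^sup>2) / (x * y * (x\<^sup>2 + y\<^sup>2)\<^sup>2)
      = limit_weight x y * (1 - limit_kernel x y) / 2"
proof (cases "x = 0 \<or> y = 0")
  case False
  have "x\<^sup>2 * y\<^sup>2 - 16 * (bessel_J 1 x)\<^sup>2 * (bessel_J 1 y)\<^sup>2 = (x * y) * (x * y * (1 - limit_kernel x y))"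
    unfolding bessel_J_1_eq limit_kernel_def by (simp add: field_simps power2_eq_square)
  then have "(x\<^sup>2 * y\<^sup>2 - 16 * (bessel_J 1 x)\<^sup>2 * (bessel_J 1 y)\<^sup>2) / (x * y * (x\<^sup>2 + y\<^sup>2)\<^sup>2) = (x
      * y * (1 - limit_kernel x y)) / (x\<^sup>2 + y\<^sup>2)\<^sup>2"
    using False by simp
  then show ?thesis by (simp add: limit_weight_def)
qed (auto simp: limit_weight_def)

lemma outer_integrand_eq:
  "(bessel_J 1 x)\<^sup>2 * (bessel_J 1 y)\<^sup>2 / (x * y * (x\<^sup>2 + y\<^sup>2)\<^sup>2) = limit_weight x y * limit_kernel x y / 32"
proof (cases "x = 0 \<or> y = 0")
  case False
  have eq: "(bessel_J 1 x)\<^sup>2 * (bessel_J 1 y)\<^sup>2 = (x * y) * (x * y * limit_kernel x y / 16)"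
    unfolding bessel_J_1_eq limit_kernel_def by (simp add: field_simps power2_eq_square)
  then have "(bessel_J 1 x)\<^sup>2 * (bessel_J 1 y)\<^sup>2 / (x * y * (x\<^sup>2 + y\<^sup>2)\<^sup>2) = (x * y
      * limit_kernel x y / 16) / (x\<^sup>2 + y\<^sup>2)\<^sup>2"
    unfolding eq using False by simp
  then show ?thesis by (simp add: limit_weight_def)
qed (auto simp: limit_weight_def)

lemma ennreal_scale_nn_integral:
  fixes f :: "real \<times> real \<Rightarrow> real"
  assumes [measurable]: "f \<in> borel_measurable lborel2" "S \<in> sets lborel2" and c: "c \<ge> 0"
  shows "(\<integral>\<^sup>+z. ennreal (c * f z) * indicator S z \<partial>lborel2) = ennreal c * (\<integral>\<^sup>+z. ennreal (f z)
      * indicator S z \<partial>lborel2)"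
  using c by (subst nn_integral_cmult[symmetric]) (auto simp: ennreal_mult' mult.assoc)

lemma outer_limit_finite: "outer_limit < \<infinity>"
proof -
  have "liminf outer_energy \<le> liminf (\<lambda>_. 16)"
    by (rule Liminf_mono) (rule eventually_mono[OF eventually_gt_at_top[of 0] outer_energy_le_16])
  also have "\<dots> = 16" by (simp add: Liminf_const)
  finally have "outer_limit \<le> 16" using outer_energy_liminf by simp
  also have "(16 :: ennreal) < \<infinity>" by simp
  finally show ?thesis .
qed

text \<open>The complement of the unit square in the quadrant consists of one quadrant and two
  strips. The strips contribute equally because the integrand is symmetric, which turns 32 into 64.
  Half-open and closed edges differ by null sets.\<close>

lemma C\<^sub>4_eq: "C\<^sub>4 = 7 * ln 2 / 4 + enn2real core_limit - enn2real outer_limit"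
proof -
  let ?f = "\<lambda>x y. limit_weight x y * (1 - limit_kernel x y) / 2"
  let ?g = "\<lambda>x y. limit_weight x y * limit_kernel x y / 32"
  have fnn: "0 \<le> ?f x y" and gnn: "0 \<le> ?g x y" if "0 \<le> x" "0 \<le> y" for x y
    using limit_weight_nonneg[OF that] limit_kernel_bounds[OF that] by auto
  have core: "2 * (LBINT y:{0..1}. LBINT x:{0..1}. ?f x y) = enn2real core_limit"
  proof -
    have *: "(\<integral>\<^sup>+z. ennreal (?f (fst z) (snd z)) * indicator ({0..1} \<times> {0..1}) z \<partial>lborel2)
        = ennreal (1/2) * core_limit"
    proof -
      have "AE z in lborel2. fst z \<noteq> (1::real) \<and> snd z \<noteq> (1::real)"
      proof (rule lborel_pair.AE_pair_measure)
        show "AE x in lborel. AE y in lborel. fst (x, y) \<noteq> (1::real) \<and> snd (x, y) \<noteq> (1::real)"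
          using AE_lborel_singleton[of 1]
        proof eventually_elim
          case (elim x)
          show ?case using AE_lborel_singleton[of 1] by eventually_elim (use elim in auto)
        qed
      qed measurable
      then have "(\<integral>\<^sup>+z. ennreal (?f (fst z) (snd z)) * indicator ({0..1} \<times> {0..1}) z \<partial>lborel2)
        = (\<integral>\<^sup>+z. ennreal (1 / 2 * (limit_weight (fst z) (snd z) * (1
            - limit_kernel (fst z) (snd z)))) * indicator ({0..<1} \<times> {0..<1}) z \<partial>lborel2)"
        by (intro nn_integral_cong_AE) (elim eventually_mono, auto split: split_indicator)
      also have "\<dots> = ennreal (1/2) * core_limit" unfolding core_limit_def
      proof (rule ennreal_scale_nn_integral)
        show "(\<lambda>z. limit_weight (fst z) (snd z) * (1 - limit_kernel (fst z) (snd z)))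
            \<in> borel_measurable lborel2" by measurable
        show "{0..<1} \<times> {0..<1} \<in> sets lborel2" by (rule pair_measureI) simp_all
      qed simp
      finally show ?thesis .
    qed
    have fin: "ennreal (1/2) * core_limit < \<infinity>" using core_limit_finite
        by (simp only: ennreal_mult_less_top infinity_ennreal_def ennreal_less_top simp_thms)
    have "ennreal (LBINT y:{0..1}. LBINT x:{0..1}. ?f x y) = ennreal (1/2) * core_limit"
      and nn: "0 \<le> (LBINT y:{0..1}. LBINT x:{0..1}. ?f x y)"
      using nested_set_integral_nonneg[of ?f "{0..1}" "{0..1}"] fnn fin by (auto simp: *)
    then have "enn2real (ennreal (LBINT y:{0..1}. LBINT x:{0..1}. ?f x y)) = enn2real (ennreal (1/2)
        * core_limit)" by simp
    moreover have "enn2real (ennreal (1/2) * core_limit) = 1 / 2 * enn2real core_limit"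
      by (subst enn2real_mult, subst enn2real_ennreal) simp_all
    ultimately show ?thesis using nn by simp
  qed
  let ?A = "{1..} \<times> {1..} :: (real \<times> real) set" let ?B = "{0..1} \<times> {1..} :: (real \<times> real) set"
  let ?J = "\<lambda>S. \<integral>\<^sup>+z. ennreal (?g (fst z) (snd z)) * indicator S z \<partial>lborel2"
  have split: "outer_limit = 32 * ?J ?A + 64 * ?J ?B"
  proof -
    let ?h = "\<lambda>z. ennreal (limit_weight (fst z) (snd z) * limit_kernel (fst z) (snd z))"
    have scale: "(\<integral>\<^sup>+z. ?h z * indicator S z \<partial>lborel2) = 32 * ?J S" if "S \<in> sets lborel2" for S
    proof -
      have "(\<lambda>z. ?g (fst z) (snd z)) \<in> borel_measurable lborel2" by measurable
      from ennreal_scale_nn_integral[OF this that, of 32] show ?thesis by simp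
    qed
    have swap: "(\<integral>\<^sup>+z. ?h z * indicator ({1..} \<times> {0..<1}) z \<partial>lborel2) = (\<integral>\<^sup>+z. ?h z
        * indicator ({0..<1} \<times> {1..}) z \<partial>lborel2)"
    proof -
      have "(\<integral>\<^sup>+z. ?h (fst z, snd z) * indicator ({1..} \<times> {0..<1}) (fst z, snd z) \<partial>lborel2)
        = (\<integral>\<^sup>+z. ?h (snd z, fst z) * indicator ({1..} \<times> {0..<1}) (snd z, fst z) \<partial>lborel2)"
        by (rule nn_integral_lborel2_swap[of "\<lambda>x y. ?h (x, y)
            * indicator ({1..} \<times> {0..<1}) (x, y)"]) measurable
      also have "\<dots> = (\<integral>\<^sup>+z. ?h z * indicator ({0..<1} \<times> {1..}) z \<partial>lborel2)"
        by (intro nn_integral_cong) (auto simp: limit_weight_def limit_kernel_def add.commute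
            mult_ac split: split_indicator)
      finally show ?thesis by simp
    qed
    have half: "(\<integral>\<^sup>+z. ?h z * indicator ({0..<1} \<times> {1..}) z \<partial>lborel2) = (\<integral>\<^sup>+z. ?h z
        * indicator ?B z \<partial>lborel2)"
    proof (rule nn_integral_cong_AE)
      have "AE z in lborel2. fst z \<noteq> (1::real)"
      proof (rule lborel_pair.AE_pair_measure)
        show "AE x in lborel. AE y in (lborel::real measure). fst (x, y) \<noteq> (1::real)"
          using AE_lborel_singleton[of 1] by eventually_elim simp
      qed measurable
      then show "AE z in lborel2. ?h z * indicator ({0..<1} \<times> {1..}) z = ?h z * indicator ?B z"
        by eventually_elim (auto split: split_indicator)
    qed
    have "outer_limit = (\<integral>\<^sup>+z. (?h z * indicator ?A z + ?h z * indicator ({0..<1} \<times> {1..}) z) + ?h z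
        * indicator ({1..} \<times> {0..<1}) z \<partial>lborel2)"
      unfolding outer_limit_def by (intro nn_integral_cong) (auto split: split_indicator)
    also have "\<dots> = (\<integral>\<^sup>+z. ?h z * indicator ?A z \<partial>lborel2) + (\<integral>\<^sup>+z. ?h z
        * indicator ({0..<1} \<times> {1..}) z \<partial>lborel2) + (\<integral>\<^sup>+z. ?h z * indicator ({1..} \<times> {0..<1}) z \<partial>lborel2)"
      by (subst nn_integral_add; (subst nn_integral_add)?) (simp_all, measurable)
    also have "\<dots> = 32 * ?J ?A + 32 * ?J ?B + 32 * ?J ?B"
    proof -
      have "?A \<in> sets lborel2" "?B \<in> sets lborel2" by (rule pair_measureI; simp)+
      then show ?thesis unfolding swap half by (simp only: scale)
    qed
    also have "\<dots> = 32 * ?J ?A + 64 * ?J ?B"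
    proof -
      have "32 * a + 32 * a = 64 * (a :: ennreal)" for a by (simp flip: distrib_right)
      then show ?thesis by (simp only: add.assoc)
    qed
    finally show ?thesis .
  qed
  have Jfin: "?J ?A < \<infinity>" "?J ?B < \<infinity>"
  proof -
    have "32 * ?J ?A < \<infinity>" "64 * ?J ?B < \<infinity>"
      using outer_limit_finite unfolding split by (simp_all add: ennreal_add_less_top)
    then show "?J ?A < \<infinity>" "?J ?B < \<infinity>" by (auto simp: ennreal_mult_less_top)
  qed
  have IA: "ennreal (LBINT y:{1..}. LBINT x:{1..}. ?g x y) = ?J ?A" "0
      \<le> (LBINT y:{1..}. LBINT x:{1..}. ?g x y)"
    using nested_set_integral_nonneg[of ?g "{1..}" "{1..}"] gnn Jfin by auto
  have IB: "ennreal (LBINT y:{1..}. LBINT x:{0..1}. ?g x y) = ?J ?B" "0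
      \<le> (LBINT y:{1..}. LBINT x:{0..1}. ?g x y)"
    using nested_set_integral_nonneg[of ?g "{0..1}" "{1..}"] gnn Jfin by auto
  have ol: "outer_limit = ennreal (32 * (LBINT y:{1..}. LBINT x:{1..}. ?g x y) + 64
      * (LBINT y:{1..}. LBINT x:{0..1}. ?g x y))"
  proof -
    have "32 * ennreal a + 64 * ennreal b = ennreal (32 * a + 64 * b)" if "0 \<le> a" "0 \<le> b" for a b
      using that by (simp add: ennreal_plus ennreal_mult')
    then show ?thesis unfolding split IA(1)[symmetric] IB(1)[symmetric] using IA(2) IB(2) by blast
  qed
  have outer: "enn2real outer_limit = 32 * (LBINT y:{1..}. LBINT x:{1..}. ?g x y) + 64
      * (LBINT y:{1..}. LBINT x:{0..1}. ?g x y)"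
    unfolding ol by (rule enn2real_ennreal, rule add_nonneg_nonneg; rule mult_nonneg_nonneg[OF _
        IA(2)] mult_nonneg_nonneg[OF _ IB(2)]; simp)
  show ?thesis unfolding C\<^sub>4_def core_integrand_eq outer_integrand_eq core outer by simp
qed

section \<open>Configurations of \<open>even_dim n\<close> planes\<close>

definition scaled_energy :: "nat \<Rightarrow> real" where
  "scaled_energy n = enn2real (core_energy n) + log_energy n - enn2real (outer_energy n)"

lemma log_energy_nonneg: "n > 0 \<Longrightarrow> 0 \<le> log_energy n"
proof -
  assume n: "n > 0"
  then have "(real n)\<^sup>2 \<ge> 1" by simp
  then have "1 / (2 * (real n)\<^sup>2) \<le> 1 / 1" by (intro frac_le) auto
  then have "1 / (2 * (real n)\<^sup>2) \<le> 1" "0 < 1 / (2 * (real n)\<^sup>2)" using n by auto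
  then have "0 \<le> - ln (1 / (2 * (real n)\<^sup>2))" "0 \<le> ln (2 - 1 / (2 * (real n)\<^sup>2))"
      by (simp_all only: ln_ge_zero neg_0_le_iff_le ln_le_zero_iff)
  then show ?thesis by (simp only: log_energy_def Let_def) (auto intro!: add_nonneg_nonneg
      divide_nonneg_nonneg)
qed

lemma configuration_exists:
  assumes n: "n > 0" and fin: "core_energy n < \<infinity>"
  shows "\<exists>S. S \<subseteq> Gr24 \<and> finite S \<and> card S = even_dim n \<and> riesz_energy 4 S \<le> (real (even_dim n))\<^sup>2
      * scaled_energy n"
proof -
  let ?N = "real (even_dim n)"
  have N: "?N > 0" using n by (simp add: real_even_dim add_pos_pos)
  have out: "outer_energy n < \<infinity>" using outer_energy_le_16[OF n] by (simp add: order_le_less_trans)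
  have bound: "mean_energy n \<epsilon> \<le> ?N\<^sup>2 * scaled_energy n" if "0 < \<epsilon>" "\<epsilon> \<le> 1 / (2 * (real n)\<^sup>2)" for \<epsilon>
  proof -
    let ?m = "mean_energy n \<epsilon> / ?N\<^sup>2"
    have "ennreal ?m + ennreal (enn2real (outer_energy n)) \<le> ennreal (enn2real (core_energy n))
        + ennreal (log_energy n)"
      using mean_energy_bound[OF n that] fin out by (simp add: ennreal_enn2real_if less_top[symmetric])
    then have "ennreal ?m + ennreal (enn2real (outer_energy n)) \<le> ennreal (enn2real (core_energy n)
        + log_energy n)"
      by (simp add: log_energy_nonneg[OF n])
    \<comment> \<open>As \<open>ennreal\<close> sends negative reals to 0, additivity is not
      automatic; the sign of the mean energy is left open here.\<close>
    moreover have "ennreal (?m + enn2real (outer_energy n)) \<le> ennreal ?m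
        + ennreal (enn2real (outer_energy n))"
    proof (cases "?m \<ge> 0")
      case True
      then show ?thesis by simp
    next
      case False
      then have "ennreal (?m + enn2real (outer_energy n)) \<le> ennreal (enn2real (outer_energy n))"
          by (intro ennreal_leI) simp
      also have "\<dots> \<le> ennreal ?m + ennreal (enn2real (outer_energy n))" by simp
      finally show ?thesis .
    qed
    ultimately have "ennreal (?m + enn2real (outer_energy n)) \<le> ennreal (enn2real (core_energy n)
        + log_energy n)" by (rule order_trans[rotated])
    then have "?m + enn2real (outer_energy n) \<le> enn2real (core_energy n) + log_energy n"
      using log_energy_nonneg[OF n] by (subst (asm) ennreal_le_iff) auto
    then have "?m \<le> scaled_energy n" by (simp add: scaled_energy_def)
    then show ?thesis using N by (simp add: pos_divide_le_eq mult.commute)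
  qed
  \<comment> \<open>A nonnegative bound for all mean energies in question. Since B < (B + 1)^2,
    taking \<epsilon> at most 1 / (B + 1) puts the mean energy below 1 / \<epsilon>^2.\<close>
  define B where "B = max 0 (?N\<^sup>2 * scaled_energy n)"
  define \<epsilon> where "\<epsilon> = min (1 / (2 * (real n)\<^sup>2)) (1 / (B + 1))"
  have B0: "B \<ge> 0" by (simp add: B_def)
  have \<epsilon>: "0 < \<epsilon>" "\<epsilon> \<le> 1 / (2 * (real n)\<^sup>2)" "\<epsilon> \<le> 1 / (B + 1)" using n B0 by (auto simp: \<epsilon>_def)
  have "mean_energy n \<epsilon> \<le> B" using bound[OF \<epsilon>(1,2)] by (simp add: B_def)
  also have "B < (B + 1)\<^sup>2"
  proof -
    have "(B + 1)\<^sup>2 = B + (1 + (B + B * B))" by (simp add: power2_eq_square algebra_simps)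
    then show ?thesis using B0 mult_nonneg_nonneg[OF B0 B0] by linarith
  qed
  also have "(B + 1)\<^sup>2 = 1 / (1 / (B + 1))\<^sup>2" by (simp add: power_divide)
  also have "\<dots> \<le> 1 / \<epsilon>\<^sup>2" using \<epsilon> B0 by (intro divide_left_mono power_mono) auto
  finally obtain S where "S \<subseteq> Gr24" "finite S" "card S = even_dim n" "riesz_energy 4 S \<le> mean_energy n \<epsilon>"
    using determinantal_configuration[OF n \<epsilon>(1)] by blast
  then show ?thesis using bound[OF \<epsilon>(1,2)] by (intro exI[of _ S]) auto
qed

text \<open>With \<delta> = 1 / (2 n^2) the energy is ln n + (3 / 2) ln 2 + o(1), while ln N is 4 ln
  n - ln 2 + o(1). A quarter of the latter leaves (3 / 2 + 1 / 4) ln 2.\<close>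

lemma log_energy_asymp:
  "(\<lambda>n. log_energy n - ln (real (even_dim n)) / 4) \<longlonglongrightarrow> 7 * ln 2 / 4"
proof -
  have "(\<lambda>n. log_energy n - ln (real (even_dim n)) / 4) \<longlonglongrightarrow> (2 * ln 2 - ln (1 / 2)) / 2 - ln (1 / 2) / 4"
    unfolding log_energy_def Let_def real_even_dim by real_asymp
  also have "(2 * ln 2 - ln (1 / 2)) / 2 - ln (1 / 2) / 4 = 7 * ln 2 / (4 :: real)" by (simp add: ln_div)
  finally show ?thesis .
qed

lemma scaled_energy_eventually_le:
  assumes \<eta>: "\<eta> > 0"
  shows "\<forall>\<^sub>F n in sequentially. core_energy n < \<infinity> \<and> scaled_energy n \<le> ln (real (even_dim n)) / 4 + C\<^sub>4 + \<eta>"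
proof -
  have ev_fin: "\<forall>\<^sub>F n in sequentially. core_energy n < \<infinity>"
    by (rule order_tendstoD(2)[OF core_energy_tendsto core_limit_finite])
  have "(\<lambda>n. enn2real (core_energy n)) \<longlonglongrightarrow> enn2real core_limit"
    using core_energy_tendsto core_limit_finite by (intro tendsto_enn2real) auto
  then have ev_core: "\<forall>\<^sub>F n in sequentially. enn2real (core_energy n) < enn2real core_limit + \<eta> / 3"
    by (rule order_tendstoD(2)) (use \<eta> in simp)
  have ev_log: "\<forall>\<^sub>F n in sequentially. log_energy n - ln (real (even_dim n)) / 4 < 7 * ln 2 / 4 + \<eta> / 3"
    by (rule order_tendstoD(2)[OF log_energy_asymp]) (use \<eta> in simp)
  have ev_out: "\<forall>\<^sub>F n in sequentially. enn2real outer_limit - \<eta> / 3 \<le> enn2real (outer_energy n)"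
  proof (cases "enn2real outer_limit - \<eta> / 3 \<le> 0")
    \<comment> \<open>A nonpositive lower bound holds trivially; otherwise \<open>ennreal\<close> is
      faithful and the liminf can be used.\<close>
    case True
    then show ?thesis by (intro always_eventually allI) (meson enn2real_nonneg order_trans)
  next
    case False
    have "ennreal (enn2real outer_limit - \<eta> / 3) < ennreal (enn2real outer_limit)"
      using \<eta> False by (intro ennreal_lessI) auto
    also have "\<dots> = outer_limit" using outer_limit_finite
        by (simp add: ennreal_enn2real_if less_top[symmetric])
    also have "\<dots> \<le> liminf outer_energy" by (rule outer_energy_liminf)
    finally have "\<forall>\<^sub>F n in sequentially. ennreal (enn2real outer_limit - \<eta> / 3) < outer_energy n"
      by (rule less_LiminfD)
    then show ?thesis using eventually_gt_at_top[of 0]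
    proof eventually_elim
      case (elim n)
      have "outer_energy n < \<infinity>" using outer_energy_le_16[OF elim(2)] by (simp add: order_le_less_trans)
      then have "enn2real (ennreal (enn2real outer_limit - \<eta> / 3)) \<le> enn2real (outer_energy n)"
        using elim(1) by (intro enn2real_mono) auto
      then show ?case using False by simp
    qed
  qed
  show ?thesis using ev_fin ev_core ev_log ev_out
  proof eventually_elim
    case (elim n)
    have "scaled_energy n \<le> ln (real (even_dim n)) / 4 + C\<^sub>4 + \<eta>"
      using elim(2-4) unfolding scaled_energy_def C\<^sub>4_eq by linarith
    then show ?case using elim(1) by blast
  qed
qed

section \<open>Thinning and arbitrary numbers of planes\<close>

lemma riesz_energy_nonneg: "0 \<le> riesz_energy s S"
  unfolding riesz_energy_def by (intro sum_nonneg) auto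

text \<open>The sum \<open>a P\<close> counts both orders of every pair containing \<open>P\<close>,
  so these sums add up to 2 E and some point carries at least 2 E / M. Removing it leaves at most (1
  - 2 / M) E. The slightly weaker factor (1 - 1 / M)^2 is preferred because it telescopes.\<close>

lemma riesz_energy_remove_point:
  assumes S: "finite S" "S \<noteq> {}"
  shows "\<exists>P\<in>S. riesz_energy s (S - {P}) \<le> ((real (card S) - 1) / real (card S))\<^sup>2 * riesz_energy s S"
proof -
  let ?M = "real (card S)" and ?E = "riesz_energy s S"
  let ?w = "\<lambda>P Q. chordal_dist P Q powr (- s)"
  define a where "a P = (\<Sum>Q\<in>S - {P}. ?w P Q) + (\<Sum>Q\<in>S - {P}. ?w Q P)" for P
  have M: "?M > 0" using S by (simp add: card_gt_0_iff)
  have off_diag: "(\<Sum>Q\<in>S. if Q = P then 0 else f Q) = (\<Sum>Q\<in>S - {P}. f Q)" if "P \<in> S" for P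
      and f :: "(real ^ 4) set \<Rightarrow> real"
    by (subst sum.remove[OF S(1) that]) (auto intro: sum.cong)
  have "(\<Sum>P\<in>S. \<Sum>Q\<in>S - {P}. ?w Q P) = (\<Sum>P\<in>S. \<Sum>Q\<in>S. if Q = P then 0 else ?w Q P)"
    by (intro sum.cong refl off_diag[symmetric])
  also have "\<dots> = (\<Sum>Q\<in>S. \<Sum>P\<in>S. if P = Q then 0 else ?w Q P)" by (subst sum.swap) (simp add: eq_commute)
  also have "\<dots> = ?E" unfolding riesz_energy_def by (intro sum.cong refl off_diag)
  finally have sum_a: "(\<Sum>P\<in>S. a P) = 2 * ?E"
    by (simp add: a_def sum.distrib riesz_energy_def)
  have "\<exists>P\<in>S. a P \<ge> 2 * ?E / ?M"
  proof (rule ccontr)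
    assume "\<not> ?thesis"
    then have "(\<Sum>P\<in>S. a P) < (\<Sum>P\<in>S. 2 * ?E / ?M)" using S by (intro sum_strict_mono) auto
    then show False using M by (simp add: sum_a)
  qed
  then obtain P where P: "P \<in> S" "a P \<ge> 2 * ?E / ?M" by blast
  have "?E = riesz_energy s (S - {P}) + a P"
  proof -
    have "?E = (\<Sum>Q\<in>S - {P}. ?w P Q) + (\<Sum>R\<in>S - {P}. \<Sum>Q\<in>S - {R}. ?w R Q)"
      unfolding riesz_energy_def using S P by (simp add: sum.remove)
    also have "(\<Sum>R\<in>S - {P}. \<Sum>Q\<in>S - {R}. ?w R Q) = (\<Sum>R\<in>S - {P}. ?w R P + (\<Sum>Q\<in>S - {P} - {R}. ?w R Q))"
    proof (rule sum.cong[OF refl])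
      fix R assume "R \<in> S - {P}"
      then have "P \<in> S - {R}" "S - {R} - {P} = S - {P} - {R}" using P by auto
      then show "(\<Sum>Q\<in>S - {R}. ?w R Q) = ?w R P + (\<Sum>Q\<in>S - {P} - {R}. ?w R Q)"
        using S by (subst sum.remove[of "S - {R}" P]) auto
    qed
    finally show ?thesis by (simp add: a_def riesz_energy_def sum.distrib)
  qed
  then have "riesz_energy s (S - {P}) \<le> ?E - 2 * ?E / ?M" using P by simp
  also have "\<dots> \<le> ((?M - 1) / ?M)\<^sup>2 * ?E"
  proof -
    have "((?M - 1) / ?M)\<^sup>2 = 1 - 2 / ?M + (1 / ?M)\<^sup>2" using M by (simp add: field_simps power2_eq_square)
    then have "((?M - 1) / ?M)\<^sup>2 * ?E = ?E - 2 * ?E / ?M + (1 / ?M)\<^sup>2 * ?E"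
    proof -
      have "(1 - 2 / m + x) * e = e - 2 * e / m + x * e" for m x e :: real by (simp add: algebra_simps)
      then show ?thesis using \<open>((?M - 1) / ?M)\<^sup>2 = _\<close> by (simp only:)
    qed
    then show ?thesis using riesz_energy_nonneg[of s S] by simp
  qed
  finally show ?thesis using P by blast
qed

text \<open>The factors telescope, so the energy divided by the square of the number of points does
  not increase under thinning.\<close>

lemma riesz_energy_subset:
  assumes "finite S" "N \<le> card S" "N > 0"
  shows "\<exists>T\<subseteq>S. card T = N \<and> riesz_energy s T \<le> (real N / real (card S))\<^sup>2 * riesz_energy s S"
  using assms
proof (induction "card S - N" arbitrary: S)
  case 0
  then show ?case by (intro exI[of _ S]) auto
next
  case (Suc k)
  then have S: "S \<noteq> {}" by auto
  obtain P where P: "P \<in> S" "riesz_energy s (S - {P}) \<le> ((real (card S) - 1) / real (card S))\<^sup>2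
      * riesz_energy s S"
    using riesz_energy_remove_point[OF Suc.prems(1) S] by blast
  have card: "card (S - {P}) = card S - 1" using P Suc.prems by simp
  have big: "card S > N" using Suc.hyps(2) by simp
  obtain T where T: "T \<subseteq> S - {P}" "card T = N" "riesz_energy s T \<le> (real N / real (card (S
      - {P})))\<^sup>2 * riesz_energy s (S - {P})"
  proof -
    have "k = card (S - {P}) - N" "finite (S - {P})" "N \<le> card (S - {P})"
        using Suc.hyps(2) Suc.prems big card by auto
    from Suc.hyps(1)[OF this Suc.prems(3)] show ?thesis using that by blast
  qed
  have "riesz_energy s T \<le> (real N / (real (card S) - 1))\<^sup>2 * (((real (card S) - 1)
      / real (card S))\<^sup>2 * riesz_energy s S)"
    using T(3) P(2) big Suc.prems(3) unfolding card by (intro order_trans[OF T(3)[unfolded card]])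
        (auto simp: of_nat_diff intro!: mult_left_mono)
  also have "\<dots> = (real N / real (card S))\<^sup>2 * riesz_energy s S"
    using big Suc.prems(3) by (simp add: power_divide)
  finally show ?case using T by auto
qed

lemma min_energy_le:
  assumes "S \<subseteq> Gr24" "finite S"
  shows "min_energy s (card S) \<le> riesz_energy s S"
  unfolding min_energy_def
  by (rule cINF_lower) (use assms in \<open>auto intro!: bdd_belowI2[where m = 0] riesz_energy_nonneg\<close>)

lemma even_dim_mono: "m \<le> n \<Longrightarrow> even_dim m \<le> even_dim n"
  unfolding even_dim_def by (intro div_le_mono add_mono power_mono) auto

lemma le_even_dim: "n \<le> even_dim n"
proof -
  have "n \<le> n ^ 2" "n ^ 2 \<le> n ^ 4" by (cases "n = 0"; simp add: self_le_power power_increasing)+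
  then show ?thesis unfolding even_dim_def by linarith
qed

text \<open>The number N lies between consecutive dimensions. Thinning keeps the energy per N^2, so
  the only loss is replacing the logarithm of the upper dimension by ln N, and the logarithms of
  consecutive dimensions differ by o(1).\<close>

lemma min_energy_eventually_le:
  assumes c: "c > 0"
  shows "\<forall>\<^sub>F N in sequentially. min_energy 4 N \<le> (real N)\<^sup>2 * (ln (real N) / 4 + C\<^sub>4 + c)"
proof -
  have "\<forall>\<^sub>F n in sequentially. core_energy n < \<infinity> \<and> scaled_energy n \<le> ln (real (even_dim n)) / 4
      + C\<^sub>4 + c / 2"
    using c by (intro scaled_energy_eventually_le) simp
  moreover have "(\<lambda>n. ln (real (even_dim n)) - ln (real (even_dim (n - 1)))) \<longlonglongrightarrow> 0"
  proof -
    have "(\<lambda>n. ln ((real n ^ 4 + (real n)\<^sup>2) / 2) - ln (((real n - 1) ^ 4 + (real n - 1)\<^sup>2) / 2))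
        \<longlonglongrightarrow> 0" by real_asymp
    moreover have "\<forall>\<^sub>F n in sequentially. ln ((real n ^ 4 + (real n)\<^sup>2) / 2) - ln (((real n - 1) ^ 4
        + (real n - 1)\<^sup>2) / 2) = ln (real (even_dim n)) - ln (real (even_dim (n - 1)))"
      using eventually_gt_at_top[of 0] by eventually_elim (simp add: real_even_dim of_nat_diff)
    ultimately show ?thesis by (simp add: tendsto_cong)
  qed
  \<comment> \<open>The gap is divided by 4 in the energy, so 2 c becomes c / 2, the other half
    being the error in \<open>scaled_energy\<close>.\<close>
  then have "\<forall>\<^sub>F n in sequentially. ln (real (even_dim n)) - ln (real (even_dim (n - 1))) < 2 * c"
    using c by (intro order_tendstoD(2)) auto
  ultimately have "\<forall>\<^sub>F n in sequentially. core_energy n < \<infinity> \<and> scaled_energy n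
      \<le> ln (real (even_dim n)) / 4 + C\<^sub>4 + c / 2
      \<and> ln (real (even_dim n)) - ln (real (even_dim (n - 1))) < 2 * c"
    by eventually_elim simp
  then obtain n0 where n0: "\<And>n. n \<ge> n0 \<Longrightarrow> core_energy n < \<infinity> \<and> scaled_energy n
      \<le> ln (real (even_dim n)) / 4 + C\<^sub>4 + c / 2
      \<and> ln (real (even_dim n)) - ln (real (even_dim (n - 1))) < 2 * c"
    unfolding eventually_sequentially by blast
  have "min_energy 4 N \<le> (real N)\<^sup>2 * (ln (real N) / 4 + C\<^sub>4 + c)" if N: "N > even_dim (max n0 1)" for N
  proof -
    define n where "n = (LEAST n. N \<le> even_dim n)"
    have Nn: "N \<le> even_dim n" unfolding n_def by (rule LeastI[of _ N]) (rule le_even_dim)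
    have nn0: "n > max n0 1"
    proof (rule ccontr)
      assume "\<not> ?thesis"
      then have "n \<le> max n0 1" by linarith
      then have "even_dim n \<le> even_dim (max n0 1)" by (rule even_dim_mono)
      then show False using Nn N by simp
    qed
    have "\<not> N \<le> even_dim (n - 1)" unfolding n_def
      by (rule not_less_Least) (use nn0 in \<open>simp add: n_def\<close>)
    then have prev: "even_dim (n - 1) < N" by simp
    have n: "n > 0" "n \<ge> n0" using nn0 by auto
    have prev0: "0 < even_dim (n - 1)" using le_even_dim[of "n - 1"] nn0 by linarith
    have N0: "N > 0" using N by simp
    note n0' = n0[OF n(2)]
    let ?M = "real (even_dim n)"
    have M: "?M > 0" using N0 Nn by simp
    obtain S where S: "S \<subseteq> Gr24" "finite S" "card S = even_dim n" "riesz_energy 4 S \<le> ?M\<^sup>2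
        * scaled_energy n"
      using configuration_exists[OF n(1)] n0' by blast
    obtain T where T: "T \<subseteq> S" "card T = N" "riesz_energy 4 T \<le> (real N / ?M)\<^sup>2 * riesz_energy 4 S"
      using riesz_energy_subset[OF S(2), of N 4] S(3) Nn N0 by auto
    have "min_energy 4 N \<le> riesz_energy 4 T"
      using min_energy_le[of T 4] T S finite_subset[OF T(1)] by auto
    also have "\<dots> \<le> (real N / ?M)\<^sup>2 * (?M\<^sup>2 * scaled_energy n)"
      using T(3) S(4) by (meson mult_left_mono order_trans zero_le_power2)
    also have "\<dots> = (real N)\<^sup>2 * scaled_energy n" using M by (simp add: power_divide)
    also have "\<dots> \<le> (real N)\<^sup>2 * (ln (real N) / 4 + C\<^sub>4 + c)"
    proof (rule mult_left_mono)
      have "ln (real (even_dim (n - 1))) \<le> ln (real N)" using prev prev0 by simp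
      then show "scaled_energy n \<le> ln (real N) / 4 + C\<^sub>4 + c" using n0' by linarith
    qed simp
    finally show ?thesis .
  qed
  then show ?thesis unfolding eventually_sequentially by (intro exI[of _ "Suc (even_dim (max n0 1))"]) auto
qed

theorem corollary2p11:
  shows "\<exists>r :: nat \<Rightarrow> real. r \<in> o(\<lambda>N. (real N)\<^sup>2) \<and>
    (\<forall>N\<ge>1. min_energy 4 N \<le> (real N)\<^sup>2 * ln (real N) / 4 + C\<^sub>4 * (real N)\<^sup>2 + r N)"
proof -
  \<comment> \<open>The positive part of the excess makes the inequality true for every N by
    definition. It must be the positive part, because the excess is only bounded from above.\<close>
  define r where "r N = max 0 (min_energy 4 N - ((real N)\<^sup>2 * ln (real N) / 4 + C\<^sub>4 * (real N)\<^sup>2))" for N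
  have "r \<in> o(\<lambda>N. (real N)\<^sup>2)"
  proof (rule landau_o.smallI)
    fix c :: real assume "c > 0"
    from min_energy_eventually_le[OF this] show "\<forall>\<^sub>F N in sequentially. norm (r N) \<le> c * norm ((real N)\<^sup>2)"
    proof eventually_elim
      case (elim N)
      have "(real N)\<^sup>2 * (ln (real N) / 4 + C\<^sub>4 + c) = (real N)\<^sup>2 * ln (real N) / 4 + C\<^sub>4
          * (real N)\<^sup>2 + c * (real N)\<^sup>2"
        by (simp add: algebra_simps)
      then show ?case using elim \<open>c > 0\<close> by (simp add: r_def)
    qed
  qed
  moreover have "min_energy 4 N \<le> (real N)\<^sup>2 * ln (real N) / 4 + C\<^sub>4 * (real N)\<^sup>2 + r N" for N
    by (simp add: r_def)
  ultimately show ?thesis by blast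
qed

end
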